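(* Let $N\ge3$, $s\in(0,1)$, $k\in\{3,\dots,N\}$ and $\alpha\in\left(-\infty,\left(\frac{k-2}{2}\right)^2\right)$. Let $\gamma_{\alpha,k,1}$ be the first eigenvalue of the weighted hemisphere problem and $\eta_{\alpha,k,1}$ the first eigenvalue of the problem $-\Delta_{\mathbb{S}'}\Psi-\frac{\alpha}{|\theta'|_k^2}\Psi=\eta\Psi$ on $\mathbb{S}'$ (see context). Then $$\gamma_{\alpha,k,1}= 2(1-s)\left[\sqrt{\left(\frac{N-2}{2}\right)^2+\eta_{\alpha,k,1}}-\frac{N-2}{2}\right] +\eta_{\alpha,k,1}.$$ If $k=N$, then $$\gamma_{\alpha,N,1}= 2(1-s)\left[\sqrt{\left(\frac{N-2}{2}\right)^2-\alpha}-\frac{N-2}{2}\right] -\alpha.$$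
   Context: Notation: $|\theta|_k^2=\sum_{i=1}^k\theta_i^2$ for $\theta\in\mathbb{R}^{N+1}$, and likewise $|\theta'|_k^2=\sum_{i=1}^k\theta_i'^2$ for $\theta'\in\mathbb{R}^N$. Hemisphere problem. $\mathbb{S}^+=\{\theta\in\mathbb{R}^{N+1}:|\theta|=1,\theta_{N+1}>0\}$. $H^1(\mathbb{S}^+,\theta_{N+1}^{1-2s})$ is the completion of $C^\infty(\overline{\mathbb{S}^+})$ with respect to $\left(\int_{\mathbb{S}^+}\theta_{N+1}^{1-2s}(\phi^2+|\nabla_{\mathbb{S}}\phi|^2)\,dS\right)^{1/2}$, where $\nabla_{\mathbb{S}}$ is the Riemannian gradient on the unit sphere. A number $\gamma$ is an eigenvalue if there is $Z\in H^1(\mathbb{S}^+,\theta_{N+1}^{1-2s})\setminus\{0\}$ with $$\int_{\mathbb{S}^+}\theta_{N+1}^{1-2s}\Big(\nabla_{\mathbb{S}}Z\cdot\nabla_{\mathbb{S}}\Psi-\frac{\alpha}{|\theta|_k^2}Z\Psi\Big)dS=\gamma\int_{\mathbb{S}^+}\theta_{N+1}^{1-2s}Z\Psi\,dS\quad\forall\,\Psi\in H^1(\mathbb{S}^+,\theta_{N+1}^{1-2s});$$ the eigenvalues form a non-decreasing diverging sequence $\{\gamma_{\alpha,k,n}\}_{n\ge1}$. Problem on $\mathbb{S}'$. $\mathbb{S}'$ is the unit sphere of $\mathbb{R}^N$ (the set $\{\theta_{N+1}=0\}$ of the unit sphere of $\mathbb{R}^{N+1}$) and $\eta_{\alpha,k,1}$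 is the smallest eigenvalue of $-\Delta_{\mathbb{S}'}-\frac{\alpha}{|\theta'|_k^2}$ in the weak sense on $H^1(\mathbb{S}')$. *)

theory Defs
  imports "HOL-Analysis.Analysis"
begin

text \<open>
  \<open>Ck n f\<close>: \<open>f\<close> has continuous derivatives up to order \<open>n\<close> on the whole space.
\<close>

primrec Ck :: "nat \<Rightarrow> ('a::euclidean_space \<Rightarrow> real) \<Rightarrow> bool" where
  "Ck 0 f \<longleftrightarrow> continuous_on UNIV f"
| "Ck (Suc n) f \<longleftrightarrow>
     (\<exists>f'. (\<forall>x. (f has_derivative f' x) (at x)) \<and> (\<forall>b\<in>Basis. Ck n (\<lambda>x. f' x b)))"

definition smooth :: "('a::euclidean_space \<Rightarrow> real) \<Rightarrow> bool" where
  "smooth f \<longleftrightarrow> (\<forall>n. Ck n f)"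

definition grad :: "('a::euclidean_space \<Rightarrow> real) \<Rightarrow> 'a \<Rightarrow> 'a" where
  "grad f x = (\<Sum>b\<in>Basis. frechet_derivative f (at x) b *\<^sub>R b)"

text \<open>
  The Riemannian gradient at a point \<open>\<theta>\<close> of the unit sphere of the restriction of \<open>f\<close> to the sphere:
  the orthogonal projection of the ambient gradient onto the tangent space
  \<open>{v. v \<bullet> \<theta> = 0}\<close>. For \<open>\<theta>\<close> in the sphere, or in the closed hemisphere, it depends only on the
  values of \<open>f\<close> there.
\<close>

definition sphere_grad :: "('a::euclidean_space \<Rightarrow> real) \<Rightarrow> 'a \<Rightarrow> 'a" where
  "sphere_grad f \<theta> = grad f \<theta> - (grad f \<theta> \<bullet> \<theta>) *\<^sub>R \<theta>"

text \<open>
  Surface measure \<open>dS\<close> on the unit sphere, as a Borel measure on the ambient space concentrated on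
  the sphere. It is defined through polar coordinates:
  \<open>S(A) = d * Leb {x. 0 < norm x < 1 \<and> x / norm x \<in> A}\<close> with \<open>d\<close> the dimension of the ambient
  space (the factor \<open>d\<close> being \<open>1 / (\<integral>r=0..1. r^(d-1))\<close>). Recall \<open>sgn x = x / norm x\<close>.
\<close>

definition sphere_measure :: "'a::euclidean_space measure" where
  "sphere_measure =
     distr (density lborel (\<lambda>x::'a. of_nat DIM('a) * indicator (ball 0 1 - {0}) x)) borel sgn"

text \<open>
  The space \<open>H\<^sup>1\<close> on (part of) the unit sphere with respect to a measure \<open>\<mu>\<close> of the form
  weight times \<open>dS\<close>: the completion of the smooth functions in the norm
  \<open>(\<integral> \<phi>\<^sup>2 + |\<nabla>\<^sub>S \<phi>|\<^sup>2 d\<mu>)\<^sup>1\<^sup>/\<^sup>2\<close>. Since \<open>\<phi> \<mapsto> (\<phi>, \<nabla>\<^sub>S \<phi>)\<close> is an isometry into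
  \<open>L\<^sup>2(\<mu>) \<times> L\<^sup>2(\<mu>)\<close>, which is complete, the completion is the closure of its image. An element is
  thus a pair \<open>(Z, G)\<close> (up to equality almost everywhere), with \<open>G\<close> playing the role of
  \<open>\<nabla>\<^sub>S Z\<close>. The functions in \<open>C\<^sup>\<infinity>\<close> of the sphere or of the closed hemisphere are exactly the
  restrictions of smooth functions on the ambient space.
\<close>

definition sphere_H1 :: "'a::euclidean_space measure \<Rightarrow> (('a \<Rightarrow> real) \<times> ('a \<Rightarrow> 'a)) set" where
  "sphere_H1 \<mu> =
     {(Z, G). Z \<in> borel_measurable \<mu> \<and> G \<in> borel_measurable \<mu> \<and>
        (\<exists>\<phi>. (\<forall>n::nat. smooth (\<phi> n)) \<and>
          (\<lambda>n. \<integral>\<^sup>+\<theta>. ennreal ((Z \<theta> - \<phi> n \<theta>)\<^sup>2 + (norm (G \<theta> - sphere_grad (\<phi> n) \<theta>))\<^sup>2) \<partial>\<mu>)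
            \<longlonglongrightarrow> 0)}"

text \<open>
  Weak eigenvalues, relative to \<open>\<mu>\<close>, of minus the (weighted) spherical Laplacian minus the
  potential \<open>V\<close>. An element \<open>(Z, G)\<close> of \<open>sphere_H1 \<mu>\<close> is zero iff its norm vanishes, i.e. iff
  both components vanish almost everywhere. For the Hardy-type potentials used below the
  integrands are integrable on all of \<open>sphere_H1 \<mu>\<close>, so the value 0 of non-convergent
  integrals is never used.
\<close>

definition sphere_eigenvalue ::
    "'a::euclidean_space measure \<Rightarrow> ('a \<Rightarrow> real) \<Rightarrow> real \<Rightarrow> bool" where
  "sphere_eigenvalue \<mu> V \<gamma> \<longleftrightarrow>
     (\<exists>(Z, G) \<in> sphere_H1 \<mu>.
        \<not> (AE \<theta> in \<mu>. Z \<theta> = 0 \<and> G \<theta> = 0) \<and>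
        (\<forall>(\<Psi>, P) \<in> sphere_H1 \<mu>.
           (\<integral>\<theta>. (G \<theta> \<bullet> P \<theta> - V \<theta> * Z \<theta> * \<Psi> \<theta>) \<partial>\<mu>) = \<gamma> * (\<integral>\<theta>. Z \<theta> * \<Psi> \<theta> \<partial>\<mu>)))"

text \<open>
  Here \<open>\<real>\<^sup>N\<close> is \<open>real ^ 'n\<close> with \<open>N = CARD('n)\<close>, and \<open>\<real>\<^sup>N\<^sup>+\<^sup>1\<close> is \<open>(real ^ 'n) \<times> real\<close>, so that a
  point \<open>\<theta>\<close> has \<open>\<theta>\<^sub>N\<^sub>+\<^sub>1 = snd \<theta>\<close>. The index type carries no order; \<open>e\<close> is an enumeration of it by
  \<open>{1..N}\<close>, the \<open>i\<close>-th coordinate of \<open>x\<close> being \<open>x $ e i\<close>. \<open>partial_norm_sq e k\<close> is \<open>|x|\<^sub>k\<^sup>2\<close>.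
\<close>

definition partial_norm_sq :: "(nat \<Rightarrow> 'n::finite) \<Rightarrow> nat \<Rightarrow> real ^ 'n \<Rightarrow> real" where
  "partial_norm_sq e k x = (\<Sum>i=1..k. (x $ e i)\<^sup>2)"

text \<open>The measure \<open>\<theta>\<^sub>N\<^sub>+\<^sub>1\<^bsup>1-2s\<^esup> dS\<close> on the open upper hemisphere.\<close>

definition hemisphere_measure :: "real \<Rightarrow> ((real ^ 'n::finite) \<times> real) measure" where
  "hemisphere_measure s =
     density sphere_measure (\<lambda>\<theta>. ennreal (indicator {\<theta>. snd \<theta> > 0} \<theta> * snd \<theta> powr (1 - 2 * s)))"

definition hemisphere_eigenvalue ::
    "(nat \<Rightarrow> 'n::finite) \<Rightarrow> real \<Rightarrow> real \<Rightarrow> nat \<Rightarrow> real \<Rightarrow> bool" where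
  "hemisphere_eigenvalue e s \<alpha> k =
     sphere_eigenvalue (hemisphere_measure s) (\<lambda>\<theta>. \<alpha> / partial_norm_sq e k (fst \<theta>))"

definition equator_eigenvalue ::
    "(nat \<Rightarrow> 'n::finite) \<Rightarrow> real \<Rightarrow> nat \<Rightarrow> real \<Rightarrow> bool" where
  "equator_eigenvalue e \<alpha> k =
     sphere_eigenvalue sphere_measure (\<lambda>\<theta>'. \<alpha> / partial_norm_sq e k \<theta>')"

text \<open>The first eigenvalues \<open>\<gamma>\<^bsub>\<alpha>,k,1\<^esub>\<close> and \<open>\<eta>\<^bsub>\<alpha>,k,1\<^esub>\<close>.\<close>

definition hemisphere_eigenvalue_1 ::
    "(nat \<Rightarrow> 'n::finite) \<Rightarrow> real \<Rightarrow> real \<Rightarrow> nat \<Rightarrow> real" where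
  "hemisphere_eigenvalue_1 e s \<alpha> k = (LEAST \<gamma>. hemisphere_eigenvalue e s \<alpha> k \<gamma>)"

definition equator_eigenvalue_1 ::
    "(nat \<Rightarrow> 'n::finite) \<Rightarrow> real \<Rightarrow> nat \<Rightarrow> real" where
  "equator_eigenvalue_1 e \<alpha> k = (LEAST \<eta>. equator_eigenvalue e \<alpha> k \<eta>)"

end

(* Write rho for the norm of the first k coordinates. With
   sigma = -(k-2)/2 + sqrt (((k-2)/2)^2 - alpha), the homogeneous function rho^sigma satisfies
   -Laplace u = alpha u / rho^2, both on R^N and, being independent of the last variable, for the
   weighted operator on the half-space. Its restriction to the sphere is therefore a positive
   eigenfunction for both problems, with eigenvalue sigma (sigma + M), where M = N - 2 on the
   equator and M = N - 2 s on the hemisphere. Positivity makes it the first eigenvalue, by Picone's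
   inequality, and the formula follows since sqrt (((N-2)/2)^2 + eta) = sigma + (N-2)/2.
   All that is needed of the two measures is the integration by parts formula for the tangential
   derivative in one of the first k coordinate directions, with constant M + 1; the singular
   vector field X / rho^2, where X is half the tangential gradient of rho^2, is reached from
   X / (rho^2 + eps). *)

theory Submission
  imports Defs
begin

section \<open>Smooth functions and gradients\<close>

text \<open>\<open>M + 2\<close> acts as an effective dimension: N on the equator and N + 2 - 2 s
  for the weighted half-space. This is why the two eigenvalues differ by exactly 2 (1 - s) \<sigma>.
  The root \<sigma> is the larger solution of \<sigma> (\<sigma> + k - 2) = -\<alpha>. The squared
  gradient of rho^\<sigma> is of order rho^(2 \<sigma> - 2), integrable when 2 \<sigma> - 2 > -k,
  and the strict bound on \<alpha> gives precisely 2 \<sigma> > -(k - 2). The obstacle is that the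
  function space is a closure of smooth functions, while the potential and possibly rho^\<sigma> are
  singular at rho = 0. All limits are therefore taken in L2, for the function, its gradient and its
  quotient by rho. The quotient needs Hardy's inequality, which is Picone's inequality for the
  exponent -(k - 2) / 2. The surface measure is given by a solid ball, so no charts occur:
  integration by parts descends from the translation invariance of Lebesgue measure. Compactness and
  the rest of the spectrum do not enter either, since a least element only needs membership and a
  lower bound.\<close>

lemma Ck_imp_continuous_on: "Ck n f \<Longrightarrow> continuous_on UNIV f"
proof (cases n)
  case (Suc m)
  assume "Ck n f"
  then obtain f' where "\<And>x. (f has_derivative f' x) (at x)" using Suc by auto
  then show ?thesis
    by (meson UNIV_I continuous_at_imp_continuous_on has_derivative_continuous)
qed auto

lemma Ck_SucI:
  "(\<And>x. (f has_derivative f' x) (at x)) \<Longrightarrow> (\<And>b. b \<in> Basis \<Longrightarrow> Ck n (\<lambda>x. f' x b)) \<Longrightarrow> Ck (Suc n) f"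
  by auto

lemma Ck_SucE:
  assumes "Ck (Suc n) f"
  obtains f' where "\<And>x. (f has_derivative f' x) (at x)"
    "\<And>b. b \<in> Basis \<Longrightarrow> Ck n (\<lambda>x. f' x b)"
  using assms by auto

lemma Ck_SucD: "Ck (Suc n) f \<Longrightarrow> Ck n f"
proof (induction n arbitrary: f)
  case 0 then show ?case using Ck_imp_continuous_on by fastforce
next
  case (Suc n)
  from Suc.prems show ?case
    by (elim Ck_SucE) (rule Ck_SucI, auto simp del: Ck.simps intro: Suc.IH)
qed

lemma Ck_const [simp]: "Ck n (\<lambda>x. c)"
proof (induction n arbitrary: c)
  case (Suc n)
  show ?case unfolding Ck.simps
    by (rule exI[where x = "\<lambda>x v. 0"]) (use Suc in auto)
qed auto

lemma Ck_inner_right [simp]: "Ck n (\<lambda>x. x \<bullet> a)"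
proof (cases n)
  case 0 then show ?thesis by (simp add: continuous_intros)
next
  case (Suc m)
  show ?thesis unfolding Suc Ck.simps
    by (rule exI[where x = "\<lambda>x v. v \<bullet> a"]) (auto intro!: derivative_eq_intros)
qed

lemma Ck_add: "Ck n f \<Longrightarrow> Ck n g \<Longrightarrow> Ck n (\<lambda>x. f x + g x)"
proof (induction n arbitrary: f g)
  case 0 then show ?case by (simp add: continuous_intros)
next
  case (Suc n)
  obtain f' where f': "\<And>x. (f has_derivative f' x) (at x)"
    "\<And>b. b \<in> Basis \<Longrightarrow> Ck n (\<lambda>x. f' x b)" using Suc.prems(1) by (elim Ck_SucE) blast
  obtain g' where g': "\<And>x. (g has_derivative g' x) (at x)"
    "\<And>b. b \<in> Basis \<Longrightarrow> Ck n (\<lambda>x. g' x b)" using Suc.prems(2) by (elim Ck_SucE) blast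
  note * = f' g'
  show ?case unfolding Ck.simps
    by (rule exI[where x = "\<lambda>x v. f' x v + g' x v"])
      (use * Suc.IH in \<open>auto intro!: derivative_eq_intros\<close>)
qed

lemma Ck_mult: "Ck n f \<Longrightarrow> Ck n g \<Longrightarrow> Ck n (\<lambda>x. f x * g x)"
proof (induction n arbitrary: f g)
  case 0 then show ?case by (simp add: continuous_intros)
next
  case (Suc n)
  obtain f' where f': "\<And>x. (f has_derivative f' x) (at x)"
    "\<And>b. b \<in> Basis \<Longrightarrow> Ck n (\<lambda>x. f' x b)" using Suc.prems(1) by (elim Ck_SucE) blast
  obtain g' where g': "\<And>x. (g has_derivative g' x) (at x)"
    "\<And>b. b \<in> Basis \<Longrightarrow> Ck n (\<lambda>x. g' x b)" using Suc.prems(2) by (elim Ck_SucE) blast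
  note * = f' g'
  have "Ck n f" "Ck n g" using Suc.prems Ck_SucD by auto
  then have "Ck n (\<lambda>x. f x * g' x b + f' x b * g x)" if "b \<in> Basis" for b
    using * that by (intro Ck_add Suc.IH) auto
  then show ?case unfolding Ck.simps
    by (intro exI[where x = "\<lambda>x v. f x * g' x v + f' x v * g x"])
      (use * in \<open>auto intro!: derivative_eq_intros\<close>)
qed

lemma Ck_sum: "(\<And>i. i \<in> I \<Longrightarrow> Ck n (f i)) \<Longrightarrow> Ck n (\<lambda>x. \<Sum>i\<in>I. f i x)"
  by (induction I rule: infinite_finite_induct) (auto intro: Ck_add)

lemma has_derivative_powr_const:
  fixes f :: "'a::real_normed_vector \<Rightarrow> real"
  assumes "(f has_derivative f') (at x)" "f x > 0"
  shows "((\<lambda>x. f x powr p) has_derivative (\<lambda>v. (p * f x powr (p - 1)) * f' v)) (at x)"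
proof -
  have "((\<lambda>y. y powr p) has_derivative (*) (p * f x powr (p - 1))) (at (f x))"
    using has_real_derivative_powr[OF assms(2)] by (simp add: has_field_derivative_def)
  from has_derivative_compose[OF assms(1) this] show ?thesis .
qed

text \<open>The exponent is kept general in the induction because each derivative lowers it by 1.
  Positivity of the base is what the shift of \<open>r2\<close> by \<epsilon> will secure.\<close>

lemma Ck_powr: "Ck n f \<Longrightarrow> (\<And>x. f x > 0) \<Longrightarrow> Ck n (\<lambda>x. f x powr p)"
proof (induction n arbitrary: p)
  case 0 then show ?case
    by (auto intro!: continuous_intros simp: less_imp_neq[THEN not_sym])
next
  case (Suc n)
  from Suc.prems obtain f' where *: "\<And>x. (f has_derivative f' x) (at x)"
    "\<And>b. b \<in> Basis \<Longrightarrow> Ck n (\<lambda>x. f' x b)" by (auto simp only: Ck.simps)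
  have "Ck n f" using Suc.prems Ck_SucD by auto
  then have "Ck n (\<lambda>x. (p * f x powr (p - 1)) * f' x b)" if "b \<in> Basis" for b
    using * that Suc by (intro Ck_mult Suc.IH) auto
  moreover have "((\<lambda>x. f x powr p) has_derivative (\<lambda>v. (p * f x powr (p - 1)) * f' x v)) (at x)" for x
    by (rule has_derivative_powr_const[OF *(1) Suc.prems(2)])
  ultimately show ?case unfolding Ck.simps
    by (intro exI[where x = "\<lambda>x v. (p * f x powr (p - 1)) * f' x v"]) auto
qed

section \<open>Ambient gradients and their tangential parts\<close>

lemma grad_eqI:
  assumes "(f has_derivative (\<lambda>v. g \<bullet> v)) (at x)"
  shows "grad f x = g"
  unfolding grad_def frechet_derivative_at[OF assms, symmetric] by (rule euclidean_representation)

lemma has_derivative_grad: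
  assumes "Ck (Suc 0) f"
  shows "(f has_derivative (\<lambda>v. grad f x \<bullet> v)) (at x)"
proof -
  obtain f' where f': "(f has_derivative f') (at x)" using assms by auto
  then interpret bounded_linear f' by (rule has_derivative_bounded_linear)
  have "grad f x \<bullet> v = f' v" for v
  proof -
    have "f' v = f' (\<Sum>b\<in>Basis. (v \<bullet> b) *\<^sub>R b)" by (simp add: euclidean_representation)
    also have "\<dots> = (\<Sum>b\<in>Basis. f' b * (b \<bullet> v))" by (simp add: sum scaleR inner_commute mult.commute)
    also have "\<dots> = grad f x \<bullet> v"
      unfolding grad_def frechet_derivative_at[OF f', symmetric]
      by (simp add: inner_sum_left)
    finally show ?thesis by simp
  qed
  then show ?thesis using f' by simp
qed

lemma continuous_on_grad:
  assumes "Ck (Suc 0) f"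
  shows "continuous_on UNIV (grad f)"
proof -
  obtain f' where f': "\<And>x. (f has_derivative f' x) (at x)"
    "\<And>b. b \<in> Basis \<Longrightarrow> continuous_on UNIV (\<lambda>x. f' x b)" using assms by auto
  show ?thesis
    unfolding grad_def[abs_def] frechet_derivative_at[OF f'(1), symmetric]
    by (intro continuous_intros f')
qed

text \<open>The closed ball rather than the sphere, because bounds are also needed at
  \<open>sgn x\<close> for every x, and \<open>sgn 0 = 0\<close>.\<close>

lemma continuous_on_bounded_cball:
  fixes f :: "'a::euclidean_space \<Rightarrow> 'b::real_normed_vector"
  assumes "continuous_on UNIV f"
  obtains K where "\<And>x. norm x \<le> 1 \<Longrightarrow> norm (f x) \<le> K"
proof -
  have "compact (f ` cball 0 1)"
    by (intro compact_continuous_image continuous_on_subset[OF assms] compact_cball) simp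
  then have "bounded (f ` cball 0 1)" by (rule compact_imp_bounded)
  then obtain K where "\<forall>x\<in>cball 0 1. norm (f x) \<le> K"
    unfolding bounded_iff by auto
  then show thesis using that[of K] by simp
qed

declare Ck.simps [simp del]

lemma smooth_Ck: "smooth f \<Longrightarrow> Ck n f"
  by (simp add: smooth_def)

lemma grad_mult:
  assumes "Ck (Suc 0) f" "Ck (Suc 0) g"
  shows "grad (\<lambda>x. f x * g x) x = f x *\<^sub>R grad g x + g x *\<^sub>R grad f x"
  by (rule grad_eqI)
    (auto intro!: derivative_eq_intros has_derivative_grad[OF assms(1)] has_derivative_grad[OF assms(2)]
      simp: algebra_simps)

lemma grad_diff:
  assumes "Ck (Suc 0) f" "Ck (Suc 0) g"
  shows "grad (\<lambda>x. f x - g x) x = grad f x - grad g x"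
  by (rule grad_eqI)
    (auto intro!: derivative_eq_intros has_derivative_grad[OF assms(1)] has_derivative_grad[OF assms(2)]
      simp: algebra_simps)

lemma grad_inner: "grad (\<lambda>x. x \<bullet> a) x = a"
  by (rule grad_eqI) (auto intro!: derivative_eq_intros simp: inner_commute)

lemma grad_powr:
  assumes "Ck (Suc 0) f" "f x > 0"
  shows "grad (\<lambda>x. f x powr p) x = (p * f x powr (p - 1)) *\<^sub>R grad f x"
proof (rule grad_eqI)
  show "((\<lambda>x. f x powr p) has_derivative (\<lambda>v. (p * f x powr (p - 1)) *\<^sub>R grad f x \<bullet> v)) (at x)"
    using has_derivative_powr_const[OF has_derivative_grad[OF assms(1)] assms(2)] by simp
qed

lemma sphere_grad_diff:
  assumes "Ck (Suc 0) f" "Ck (Suc 0) g"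
  shows "sphere_grad (\<lambda>x. f x - g x) x = sphere_grad f x - sphere_grad g x"
  unfolding sphere_grad_def grad_diff[OF assms] by (simp add: algebra_simps)

lemma continuous_on_sphere_grad:
  "Ck (Suc 0) f \<Longrightarrow> continuous_on UNIV (sphere_grad f)"
  unfolding sphere_grad_def[abs_def] by (intro continuous_intros continuous_on_grad)

section \<open>Integration in polar coordinates\<close>

lemma ball_in_sets_borel [measurable]: "ball (x::'a::euclidean_space) r \<in> sets borel"
  by simp

lemma borel_measurable_sgn_euclidean [measurable]:
  "(sgn :: 'a::euclidean_space \<Rightarrow> 'a) \<in> borel_measurable borel"
  unfolding sgn_div_norm[abs_def] by measurable

lemma lborel_integral_translation:
  fixes f :: "'a::euclidean_space \<Rightarrow> real"
  assumes [measurable]: "f \<in> borel_measurable borel"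
  shows "(\<integral>x. f (a + x) \<partial>lborel) = (\<integral>x. f x \<partial>lborel)"
  by (subst (2) lborel_distr_plus[symmetric, of a]) (simp add: integral_distr)

lemma lborel_integral_scaling:
  fixes f :: "'a::euclidean_space \<Rightarrow> real"
  assumes [measurable]: "f \<in> borel_measurable borel" and c: "c > 0"
  shows "(\<integral>x. f x \<partial>lborel) = c ^ DIM('a) * (\<integral>x. f (c *\<^sub>R x) \<partial>lborel)"
proof -
  have "(\<integral>x. f x \<partial>lborel) =
      (\<integral>x. f x \<partial>density (distr lborel borel (\<lambda>x. 0 + c *\<^sub>R x)) (\<lambda>_. ennreal (\<bar>c\<bar> ^ DIM('a))))"
    using c by (subst lborel_affine[of c 0]) (auto simp: ennreal_power)
  also have "\<dots> = c ^ DIM('a) * (\<integral>x. f (c *\<^sub>R x) \<partial>lborel)"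
    using c by (simp add: integral_density integral_distr)
  finally show ?thesis .
qed

lemma integrable_lborel_bounded_support:
  fixes f :: "'a::euclidean_space \<Rightarrow> real"
  assumes [measurable]: "f \<in> borel_measurable borel"
    and "\<And>x. norm x < r \<Longrightarrow> \<bar>f x\<bar> \<le> C" "\<And>x. norm x \<ge> r \<Longrightarrow> f x = 0"
  shows "integrable lborel f"
proof (rule Bochner_Integration.integrable_bound)
  show "integrable lborel (\<lambda>x. C * indicator (ball 0 r :: 'a set) x)"
    by (intro integrable_mult_right integrable_real_indicator)
      (auto intro: emeasure_bounded_finite[OF bounded_ball, unfolded infinity_ennreal_def])
  show "AE x in lborel. norm (f x) \<le> norm (C * indicator (ball 0 r) x)"
    using assms(2,3) by (intro always_eventually allI) (force simp: indicator_def not_less)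
qed simp

text \<open>By translation invariance the difference quotients of \<open>u\<close> integrate to zero.\<close>

lemma integral_derivative_eq_0:
  fixes u :: "'a::euclidean_space \<Rightarrow> real"
  assumes u: "\<And>x. (u has_derivative u' x) (at x)"
    and supp: "\<And>x. norm x \<ge> 1 \<Longrightarrow> u x = 0"
    and bound: "\<And>x. \<bar>u' x b\<bar> \<le> C" and b: "norm b = 1"
  shows "(\<integral>x. u' x b \<partial>lborel) = 0"
proof -
  have cont: "continuous_on UNIV u"
    by (meson UNIV_I continuous_at_imp_continuous_on has_derivative_continuous u)
  then have [measurable]: "u \<in> borel_measurable borel"
    by (rule borel_measurable_continuous_onI)
  define g where "g n x = real (Suc n) * (u ((1 / real (Suc n)) *\<^sub>R b + x) - u x)" for n x
  have [measurable]: "g n \<in> borel_measurable borel" for n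
    unfolding g_def[abs_def] by measurable
  have deriv: "((\<lambda>t. u (x + t *\<^sub>R b)) has_real_derivative u' (x + t *\<^sub>R b) b) (at t)" for x t
  proof -
    interpret bounded_linear "u' (x + t *\<^sub>R b)" by (rule has_derivative_bounded_linear[OF u])
    have "((\<lambda>t. x + t *\<^sub>R b) has_derivative (\<lambda>h. h *\<^sub>R b)) (at t)"
      by (auto intro!: derivative_eq_intros)
    from has_derivative_compose[OF this u]
    show ?thesis by (simp add: has_field_derivative_def scaleR mult.commute[of _ "u' (x + t *\<^sub>R b) b"])
  qed
  have bnd: "\<bar>g n x\<bar> \<le> C" for n x
  proof -
    let ?h = "1 / real (Suc n)"
    obtain z where "u (x + ?h *\<^sub>R b) - u (x + 0 *\<^sub>R b) = (?h - 0) * u' (x + z *\<^sub>R b) b"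
      using MVT2[of 0 ?h "\<lambda>t. u (x + t *\<^sub>R b)" "\<lambda>t. u' (x + t *\<^sub>R b) b"] deriv by auto
    then have "g n x = u' (x + z *\<^sub>R b) b" by (simp add: g_def add.commute)
    then show ?thesis using bound by simp
  qed
  have lim: "(\<lambda>n. g n x) \<longlonglongrightarrow> u' x b" for x
  proof -
    have "((\<lambda>h. (u (x + h *\<^sub>R b) - u x) / h) \<longlongrightarrow> u' x b) (at 0)"
      using deriv[of x 0] by (simp add: has_field_derivative_iff)
    moreover have "filterlim (\<lambda>n. 1 / real (Suc n)) (at 0) sequentially"
      using LIMSEQ_inverse_real_of_nat by (simp add: filterlim_at inverse_eq_divide del: of_nat_Suc)
    ultimately have "(\<lambda>n. (u (x + (1 / real (Suc n)) *\<^sub>R b) - u x) / (1 / real (Suc n))) \<longlonglongrightarrow> u' x b"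
      by (rule filterlim_compose)
    then show ?thesis by (simp add: g_def add.commute mult.commute)
  qed
  \<comment> \<open>The shift has length at most 1, so all quotients vanish outside the ball of
    radius 2 and a constant on that ball is an integrable majorant.\<close>
  have supp': "g n x = 0" if "norm x \<ge> 2" for n x
  proof -
    have "norm ((1 / real (Suc n)) *\<^sub>R b) \<le> 1" using b by simp
    then have "norm ((1 / real (Suc n)) *\<^sub>R b + x) \<ge> 1"
      using that norm_diff_ineq[of x "(1 / real (Suc n)) *\<^sub>R b"]
      by (simp only: add.commute)
    then show ?thesis using that supp unfolding g_def by simp
  qed
  obtain K where K: "\<And>x. norm x \<le> 1 \<Longrightarrow> \<bar>u x\<bar> \<le> K"
    using continuous_on_bounded_cball[OF cont] by auto
  have iu: "integrable lborel u"
    by (rule integrable_lborel_bounded_support[where r = 1 and C = K]) (use K supp in auto)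
  have "integrable lborel (\<lambda>x. u (a + x))" for a :: 'a
    using iu by (subst (asm) lborel_distr_plus[symmetric, of a]) (simp add: integrable_distr_eq)
  then have "(\<integral>x. g n x \<partial>lborel) = 0" for n
    unfolding g_def using iu
    by (simp add: Bochner_Integration.integral_diff lborel_integral_translation del: of_nat_Suc)
  moreover have "(\<lambda>n. \<integral>x. g n x \<partial>lborel) \<longlonglongrightarrow> (\<integral>x. u' x b \<partial>lborel)"
  proof (rule integral_dominated_convergence)
    show "(\<lambda>x. u' x b) \<in> borel_measurable lborel"
      by (rule borel_measurable_LIMSEQ_real[OF lim]) simp
    show "integrable lborel (\<lambda>x. C * indicator (ball 0 2 :: 'a set) x)"
      by (intro integrable_mult_right integrable_real_indicator)
        (auto intro: emeasure_bounded_finite[OF bounded_ball, unfolded infinity_ennreal_def])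
    show "AE x in lborel. norm (g n x) \<le> C * indicator (ball 0 2) x" for n
      using bnd supp' by (intro always_eventually allI) (force simp: indicator_def not_less)
  qed (use lim in auto)
  ultimately show ?thesis by (simp add: LIMSEQ_const_iff)
qed

text \<open>Dilation by c keeps \<open>sgn x\<close>, multiplies the radial power by c^p and
  Lebesgue measure by c^DIM.\<close>

lemma integral_shell_scaling:
  fixes H :: "'a::euclidean_space \<Rightarrow> real"
  assumes [measurable]: "H \<in> borel_measurable borel" and c: "0 < c"
  shows "(\<integral>x. norm x ^ p * H (sgn x) * indicator (ball 0 c) x \<partial>lborel)
    = c ^ (p + DIM('a)) * (\<integral>x. norm x ^ p * H (sgn x) * indicator (ball 0 1) x \<partial>lborel)"
proof -
  have "indicator (ball 0 c) (c *\<^sub>R x) = (indicator (ball 0 1) x :: real)" for x :: 'a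
    using c by (auto simp: indicator_def)
  then show ?thesis
    using c by (subst lborel_integral_scaling[OF _ c])
      (auto simp: power_mult_distrib sgn_scaleR power_add mult.assoc)
qed

text \<open>For \<open>H \<ge> 0\<close> the contribution of a thin shell \<open>c \<le> norm x < 1\<close> pins down the ratio of
  the two integrals as \<open>c\<close> tends to 1.\<close>

lemma integral_norm_power_sgn_nonneg:
  fixes H :: "'a::euclidean_space \<Rightarrow> real"
  assumes [measurable]: "H \<in> borel_measurable borel"
    and H: "\<And>x. 0 \<le> H x" "\<And>x. H x \<le> K"
  defines "I \<equiv> \<lambda>p::nat. \<integral>x. norm x ^ p * H (sgn x) * indicator (ball 0 1) x \<partial>lborel"
  shows "real (p + DIM('a)) * I p = real DIM('a) * I 0"
proof -
  let ?f = "\<lambda>p c x. norm x ^ p * H (sgn x) * indicator (ball 0 c) (x::'a)"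
  have int: "integrable lborel (?f p c)" if "c \<le> 1" for p c
  proof (rule integrable_lborel_bounded_support[where r = 1 and C = K])
    show "\<bar>?f p c x\<bar> \<le> K" if "norm x < 1" for x
    proof -
      have "norm x ^ p * H (sgn x) \<le> 1 * K"
        by (intro mult_mono) (use that H order_trans[OF H] in \<open>auto simp: power_le_one\<close>)
      then show ?thesis using H order_trans[OF H] by (auto simp: indicator_def)
    qed
    show "?f p c x = 0" if "1 \<le> norm x" for x
      using that \<open>c \<le> 1\<close> by auto
  qed measurable
  have scal: "(\<integral>x. ?f p c x \<partial>lborel) = c ^ (p + DIM('a)) * I p" if "0 < c" for c p
    unfolding I_def using that by (rule integral_shell_scaling[rotated]) simp
  have shell: "(\<integral>x. ?f p 1 x - ?f p c x \<partial>lborel) = (1 - c ^ (p + DIM('a))) * I p"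
    if "0 < c" "c < 1" for c p
  proof -
    have "(\<integral>x. ?f p 1 x - ?f p c x \<partial>lborel) = I p - c ^ (p + DIM('a)) * I p"
      using that by (subst Bochner_Integration.integral_diff[OF int int]) (simp_all only: scal, auto simp: I_def)
    then show ?thesis by (simp add: algebra_simps)
  qed
  \<comment> \<open>On the shell c <= norm x < 1 the radial factor lies between c^p and 1; off the
    shell both differences are 0.\<close>
  have pt: "?f p 1 x - ?f p c x \<le> ?f 0 1 x - ?f 0 c x"
    "c ^ p * (?f 0 1 x - ?f 0 c x) \<le> ?f p 1 x - ?f p c x" if "0 < c" "c < 1" for c x
    using that H(1)[of "sgn x"] power_mono[of c "norm x" p] power_le_one[of "norm x" p]
    by (auto simp: indicator_def intro!: mult_left_le_one_le mult_right_mono)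
  \<comment> \<open>1 - c^n is 1 - c times this geometric sum. Cancelling 1 - c leaves sums that
    tend to n as c tends to 1, which produces the factors p + DIM and DIM.\<close>
  let ?S = "\<lambda>c n. \<Sum>i<n. c ^ i :: real"
  have "?S c (p + DIM('a)) * I p \<le> ?S c DIM('a) * I 0"
    and "c ^ p * (?S c DIM('a) * I 0) \<le> ?S c (p + DIM('a)) * I p"
    if c: "0 < c" "c < 1" for c
  proof -
    have "(1 - c ^ (p + DIM('a))) * I p \<le> (1 - c ^ (0 + DIM('a))) * I 0"
      unfolding shell[OF c, symmetric] using c
      by (intro integral_mono Bochner_Integration.integrable_diff int pt) auto
    moreover have "c ^ p * ((1 - c ^ (0 + DIM('a))) * I 0) \<le> (1 - c ^ (p + DIM('a))) * I p"
      unfolding shell[OF c, symmetric] using c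
      by (subst integral_mult_right_zero[symmetric],
          intro integral_mono integrable_mult_right Bochner_Integration.integrable_diff int pt) auto
    ultimately have "(1 - c) * (?S c (p + DIM('a)) * I p) \<le> (1 - c) * (?S c DIM('a) * I 0)"
      "(1 - c) * (c ^ p * (?S c DIM('a) * I 0)) \<le> (1 - c) * (?S c (p + DIM('a)) * I p)"
      by (simp_all add: one_diff_power_eq mult.assoc mult.left_commute)
    then show "?S c (p + DIM('a)) * I p \<le> ?S c DIM('a) * I 0"
      "c ^ p * (?S c DIM('a) * I 0) \<le> ?S c (p + DIM('a)) * I p" using c by simp_all
  qed
  note ineq = this
  have ev: "\<forall>\<^sub>F c in at_left (1::real). 0 < c \<and> c < 1"
    using eventually_at_left_real[of 0 1] by auto
  have lim: "((\<lambda>c. ?S c n) \<longlongrightarrow> real n) (at_left 1)" for n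
    by (auto intro!: tendsto_eq_intros)
  have limp: "((\<lambda>c. c ^ p) \<longlongrightarrow> 1) (at_left (1::real))"
    by (auto intro!: tendsto_eq_intros)
  have "real (p + DIM('a)) * I p \<le> real DIM('a) * I 0"
    by (rule tendsto_le[OF _ tendsto_mult_right[OF lim] tendsto_mult_right[OF lim]])
      (use ineq in \<open>auto intro: eventually_mono[OF ev]\<close>)
  moreover have "1 * (real DIM('a) * I 0) \<le> real (p + DIM('a)) * I p"
    by (rule tendsto_le[OF _ tendsto_mult_right[OF lim] tendsto_mult[OF limp tendsto_mult_right[OF lim]]])
      (use ineq in \<open>auto intro: eventually_mono[OF ev]\<close>)
  ultimately show ?thesis by simp
qed

text \<open>In polar coordinates the radial integral of r^(p + d - 1) over (0, 1) is 1 / (p + d),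
  against 1 / d without the extra power.\<close>

lemma integral_norm_power_sgn:
  fixes H :: "'a::euclidean_space \<Rightarrow> real"
  assumes [measurable]: "H \<in> borel_measurable borel"
    and H: "\<And>x. \<bar>H (sgn x)\<bar> \<le> K"
  shows "integrable lborel (\<lambda>x. norm x ^ p * H (sgn x) * indicator (ball 0 1) x)"
    and "(\<integral>x. norm x ^ p * H (sgn x) * indicator (ball 0 1) x \<partial>lborel)
    = real DIM('a) / real (p + DIM('a)) * (\<integral>x. H (sgn x) * indicator (ball 0 1) x \<partial>lborel)"
proof -
  \<comment> \<open>Adding K makes the function nonnegative. The truncation is there because H is
    controlled only at points \<open>sgn x\<close>, whereas the nonnegative case asks for bounds
    everywhere; at points \<open>sgn x\<close> it changes nothing.\<close>
  define G where "G x = min (2 * K) (max 0 (H x + K))" for x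
  have G: "G (sgn x) = H (sgn x) + K" for x using H[of x] by (auto simp: G_def)
  have [measurable]: "G \<in> borel_measurable borel" unfolding G_def[abs_def] by measurable
  have K: "0 \<le> K" using H[of 0] by simp
  let ?f = "\<lambda>p H x. norm x ^ p * H (sgn x) * indicator (ball 0 1) (x::'a)"
  have int: "integrable lborel (?f p H)"
    if [measurable]: "H \<in> borel_measurable borel" and H: "\<And>x. \<bar>H (sgn x)\<bar> \<le> K" for H :: "'a \<Rightarrow> real" and K p
  proof (rule integrable_lborel_bounded_support[where r = 1 and C = K])
    show "\<bar>?f p H x\<bar> \<le> K" if "norm x < 1" for x
    proof -
      have "norm x ^ p * \<bar>H (sgn x)\<bar> \<le> 1 * K"
        by (intro mult_mono) (use that H order_trans[OF abs_ge_zero H] in \<open>auto simp: power_le_one\<close>)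
      then show ?thesis using order_trans[OF abs_ge_zero H] by (auto simp: indicator_def abs_mult)
    qed
  qed auto
  show "integrable lborel (?f p H)" using int[where H = H and K = K, OF _ H] by simp
  have *: "(\<integral>x. ?f q G x \<partial>lborel) = (\<integral>x. ?f q H x \<partial>lborel) + (\<integral>x. ?f q (\<lambda>_. K) x \<partial>lborel)" for q
    unfolding G distrib_left distrib_right
    by (rule Bochner_Integration.integral_add) (use int[where H = H and K = K, OF _ H] int[where H = "\<lambda>_. K" and K = K] K in auto)
  have "real (p + DIM('a)) * (\<integral>x. ?f p G x \<partial>lborel) = real DIM('a) * (\<integral>x. ?f 0 G x \<partial>lborel)"
    by (rule integral_norm_power_sgn_nonneg[where K = "2 * K"]) (use K in \<open>auto simp: G_def\<close>)
  moreover have "real (p + DIM('a)) * (\<integral>x. ?f p (\<lambda>_. K) x \<partial>lborel) = real DIM('a) * (\<integral>x. ?f 0 (\<lambda>_. K) x \<partial>lborel)"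
    by (rule integral_norm_power_sgn_nonneg[where K = K]) (use K in auto)
  ultimately have "real (p + DIM('a)) * (\<integral>x. ?f p H x \<partial>lborel) = real DIM('a) * (\<integral>x. ?f 0 H x \<partial>lborel)"
    unfolding * distrib_left by linarith
  then show "(\<integral>x. ?f p H x \<partial>lborel) = real DIM('a) / real (p + DIM('a)) * (\<integral>x. H (sgn x) * indicator (ball 0 1) x \<partial>lborel)"
    using DIM_positive[where 'a = 'a] by (simp add: divide_simps mult_ac del: of_nat_add)
qed

section \<open>Integration by parts on the sphere\<close>

text \<open>Brings the density into the form \<open>ennreal\<close> of a real function, the shape
  expected by \<open>integral_density\<close>.\<close>

lemma density_lborel_punctured_ball:
  "density lborel (\<lambda>x::'a::euclidean_space. of_nat DIM('a) * indicator (ball 0 1 - {0}) x) =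
   density lborel (\<lambda>x::'a. ennreal (real DIM('a) * indicator (ball 0 1 - {0}) x))"
  by (intro arg_cong[where f = "density lborel"] ext)
    (auto simp: indicator_def ennreal_of_nat_eq_real_of_nat)

lemma sets_sphere_measure [simp, measurable_cong]: "sets sphere_measure = sets borel"
  by (simp add: sphere_measure_def)

lemma space_sphere_measure [simp]: "space sphere_measure = UNIV"
  by (simp add: sphere_measure_def)

lemma AE_sphere_measure: "AE x in (sphere_measure :: 'a::euclidean_space measure). norm x = 1"
proof -
  have [measurable]: "ball 0 1 - {0::'a} \<in> sets borel" by auto
  show ?thesis
    unfolding sphere_measure_def density_lborel_punctured_ball
    by (subst AE_distr_iff) (auto simp: AE_density norm_sgn indicator_def)
qed

lemma emeasure_sphere_measure_finite:
  "emeasure (sphere_measure :: 'a::euclidean_space measure) UNIV < \<infinity>"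
proof -
  have [measurable]: "ball 0 1 - {0::'a} \<in> sets borel" by auto
  have "emeasure lborel (ball 0 1 - {0::'a}) < \<infinity>"
    by (rule emeasure_bounded_finite) (auto intro: bounded_subset[OF bounded_ball])
  then show ?thesis
    unfolding sphere_measure_def
    by (simp add: emeasure_distr emeasure_density nn_integral_cmult ennreal_mult_less_top of_nat_less_top)
qed

lemma integral_sphere_measure:
  fixes h :: "'a::euclidean_space \<Rightarrow> real"
  assumes [measurable]: "h \<in> borel_measurable borel"
  shows "(\<integral>x. h x \<partial>sphere_measure) = real DIM('a) * (\<integral>x. h (sgn x) * indicator (ball 0 1) x \<partial>lborel)"
proof -
  have [measurable]: "ball 0 1 - {0::'a} \<in> sets borel" by auto
  have "(\<integral>x. h x \<partial>sphere_measure) =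
      (\<integral>x. real DIM('a) * indicator (ball 0 1 - {0}) x * h (sgn x) \<partial>lborel)"
    unfolding sphere_measure_def density_lborel_punctured_ball
    by (simp add: integral_distr integral_density)
  also have "\<dots> = (\<integral>x. real DIM('a) * (h (sgn x) * indicator (ball 0 1) x) \<partial>lborel)"
    by (rule integral_cong_AE)
      (use AE_lborel_singleton[of 0] in \<open>auto elim!: eventually_mono simp: indicator_def\<close>)
  finally show ?thesis by simp
qed

text \<open>Squaring makes the positive part continuously differentiable at 0 as well. It serves in
  the radial cutoff and again in the regularized hemisphere weight.\<close>

lemma has_real_derivative_max_square:
  "((\<lambda>z::real. (max 0 z)\<^sup>2) has_real_derivative 2 * max 0 z) (at z)"
proof (cases z "0 :: real" rule: linorder_cases)
  case less
  show ?thesis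
    by (rule has_field_derivative_transform_within_open[of "\<lambda>_. 0" _ _ "{..<0}"])
      (use less in \<open>auto intro!: derivative_eq_intros\<close>)
next
  case greater
  show ?thesis
    by (rule has_field_derivative_transform_within_open[of "\<lambda>z. z\<^sup>2" _ _ "{0<..}"])
      (use greater in \<open>auto intro!: derivative_eq_intros\<close>)
next
  case equal
  have "((\<lambda>h::real. (max 0 h)\<^sup>2 / h) \<longlongrightarrow> 0) (at 0)"
    by (rule Lim_null_comparison[where g = "\<lambda>h. \<bar>h\<bar>"])
      (auto simp: power2_eq_square max_def abs_mult intro!: always_eventually tendsto_eq_intros)
  then show ?thesis using equal by (simp add: has_field_derivative_iff)
qed

text \<open>With y = |x|^2, the factor y neutralizes the discontinuity of \<open>sgn\<close> at the
  origin, and the squared positive part ends the support at the unit sphere.\<close>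

lemma has_real_derivative_cutoff:
  "((\<lambda>y::real. y * (max 0 (1 - y))\<^sup>2) has_real_derivative
     (max 0 (1 - y))\<^sup>2 - 2 * y * max 0 (1 - y)) (at y)"
proof -
  have "((\<lambda>y::real. (max 0 (1 - y))\<^sup>2) has_real_derivative (2 * max 0 (1 - y)) * (- 1)) (at y)"
    by (rule DERIV_chain'[OF _ has_real_derivative_max_square]) (auto intro!: derivative_eq_intros)
  from DERIV_mult[OF DERIV_ident this] show ?thesis
    by (simp add: algebra_simps)
qed

lemma has_derivative_sgn:
  fixes x :: "'a::euclidean_space"
  assumes "x \<noteq> 0"
  shows "(sgn has_derivative (\<lambda>v. (1 / norm x) *\<^sub>R (v - (v \<bullet> sgn x) *\<^sub>R sgn x))) (at x)"
proof -
  have "((\<lambda>x::'a. inverse (norm x) *\<^sub>R x) has_derivative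
    (\<lambda>v. (1 / norm x) *\<^sub>R (v - (v \<bullet> sgn x) *\<^sub>R sgn x))) (at x)"
    using assms
    by (auto intro!: derivative_eq_intros has_derivative_norm
        simp: fun_eq_iff sgn_div_norm algebra_simps divide_simps)
  then show ?thesis by (simp add: sgn_div_norm[abs_def])
qed

text \<open>The derivative of c(|x|^2) F(x / |x|) in direction b has integral 0 over the whole
  space. In the unit ball its radial factors are polynomials in |x|, so polar integration leaves one
  linear relation between the two angular integrals in question.\<close>

lemma sphere_measure_ibp:
  fixes F :: "'a::euclidean_space \<Rightarrow> real"
  assumes F: "Ck (Suc 0) F" and b: "b \<in> Basis"
  shows "(\<integral>x. sphere_grad F x \<bullet> b \<partial>sphere_measure)
    = (real DIM('a) - 1) * (\<integral>x. (x \<bullet> b) * F x \<partial>sphere_measure)"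
proof -
  define c where "c = (\<lambda>y::real. y * (max 0 (1 - y))\<^sup>2)"
  define c' where "c' = (\<lambda>y::real. (max 0 (1 - y))\<^sup>2 - 2 * y * max 0 (1 - y))"
  define u where "u x = c (x \<bullet> x) * F (sgn x)" for x :: 'a
  \<comment> \<open>Differentiating F(x / |x|) gives the tangential gradient at x / |x| divided by
    |x|; the projection comes from the derivative of \<open>sgn\<close>.\<close>
  define u' where "u' x v = 2 * c' (x \<bullet> x) * (x \<bullet> v) * F (sgn x)
      + c (x \<bullet> x) / norm x * (sphere_grad F (sgn x) \<bullet> v)" for x v :: 'a
  have contF: "continuous_on UNIV F" using F Ck_imp_continuous_on by blast
  have contG: "continuous_on UNIV (sphere_grad F)" using F by (rule continuous_on_sphere_grad)
  have [measurable]: "F \<in> borel_measurable borel" "sphere_grad F \<in> borel_measurable borel"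
    using contF contG by (auto intro: borel_measurable_continuous_onI)
  have bdd: "\<exists>K. \<forall>x. norm (f (sgn x)) \<le> K" if f: "continuous_on UNIV f" for f :: "'a \<Rightarrow> 'b::real_normed_vector"
  proof -
    obtain K where "\<And>x. norm x \<le> 1 \<Longrightarrow> norm (f x) \<le> K"
      using continuous_on_bounded_cball[OF f] by auto
    then have "norm (f (sgn x)) \<le> K" for x by (simp add: norm_sgn)
    then show ?thesis by blast
  qed
  obtain KF where KF: "\<And>x. \<bar>F (sgn x)\<bar> \<le> KF" using bdd[OF contF] by auto
  obtain KG where KG: "\<And>x. norm (sphere_grad F (sgn x)) \<le> KG" using bdd[OF contG] by auto
  have KGb: "\<bar>sphere_grad F (sgn x) \<bullet> b\<bar> \<le> KG" for x
    using Cauchy_Schwarz_ineq2[of "sphere_grad F (sgn x)" b] KG[of x] b by simp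
  have c01: "0 \<le> c y" "c y \<le> y" if "0 \<le> y" for y
    using that by (auto simp: c_def max_def power_le_one mult_left_le)
  have "(u has_derivative u' x) (at x)" for x
  proof (cases "x = 0")
    case False
    have "((\<lambda>x. x \<bullet> x) has_derivative (\<lambda>v. 2 * (x \<bullet> v))) (at x)"
      by (auto intro!: derivative_eq_intros simp: inner_commute)
    moreover have "(c has_derivative (*) (c' (x \<bullet> x))) (at (x \<bullet> x))"
      using has_real_derivative_cutoff by (simp add: c_def c'_def has_field_derivative_def)
    ultimately have 1: "((\<lambda>x. c (x \<bullet> x)) has_derivative (\<lambda>v. c' (x \<bullet> x) * (2 * (x \<bullet> v)))) (at x)"
      by (rule has_derivative_compose)
    have 2: "((\<lambda>x. F (sgn x)) has_derivative
        (\<lambda>v. grad F (sgn x) \<bullet> ((1 / norm x) *\<^sub>R (v - (v \<bullet> sgn x) *\<^sub>R sgn x)))) (at x)"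
      by (rule has_derivative_compose[OF has_derivative_sgn[OF False] has_derivative_grad[OF F]])
    show ?thesis
      unfolding u_def[abs_def]
      by (rule has_derivative_eq_rhs[OF has_derivative_mult[OF 1 2]])
        (auto simp: u'_def fun_eq_iff sphere_grad_def algebra_simps inner_commute diff_divide_distrib)
  next
    case True
    have "u' 0 = (\<lambda>v. 0)" by (auto simp: u'_def fun_eq_iff c_def)
    moreover have "((\<lambda>y. norm (u y) / norm y) \<longlongrightarrow> 0) (at 0)"
    proof (rule Lim_null_comparison[where g = "\<lambda>y. norm y * KF"])
      have "\<bar>u y\<bar> \<le> (norm y * norm y) * KF" for y
        unfolding u_def abs_mult
        by (rule mult_mono) (use c01[of "y \<bullet> y"] KF in \<open>auto simp: power2_norm_eq_inner[symmetric] power2_eq_square\<close>)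
      then have "\<bar>u y\<bar> / norm y \<le> norm y * KF" for y
        by (cases "y = 0") (auto simp: divide_simps mult_ac)
      then show "\<forall>\<^sub>F y in at 0. norm (norm (u y) / norm y) \<le> norm y * KF"
        by (intro always_eventually) simp
    qed (auto intro!: tendsto_eq_intros)
    moreover have "u 0 = 0" by (simp add: u_def c_def)
    ultimately show ?thesis using True by (simp add: has_derivative_at)
  qed
  note deriv = this
  \<comment> \<open>With r = |x| < 1, c(r^2) / r = r (1 - r^2)^2 has coefficients 1, -2, 1 and 2 r
    c'(r^2) = 2 r (1 - 4 r^2 + 3 r^4) has coefficients 2, -8, 6.\<close>
  have poly: "u' x b = (2 * (norm x ^ 1 * (sgn x \<bullet> b * F (sgn x) * indicator (ball 0 1) x))
       - 8 * (norm x ^ 3 * (sgn x \<bullet> b * F (sgn x) * indicator (ball 0 1) x))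
       + 6 * (norm x ^ 5 * (sgn x \<bullet> b * F (sgn x) * indicator (ball 0 1) x)))
     + ((norm x ^ 1 * (sphere_grad F (sgn x) \<bullet> b * indicator (ball 0 1) x))
       - 2 * (norm x ^ 3 * (sphere_grad F (sgn x) \<bullet> b * indicator (ball 0 1) x))
       + (norm x ^ 5 * (sphere_grad F (sgn x) \<bullet> b * indicator (ball 0 1) x)))" for x
  proof (cases "norm x < 1")
    case True
    define r where "r = norm x"
    have xx: "x \<bullet> x = r\<^sup>2" by (simp add: r_def power2_norm_eq_inner)
    have xb: "x \<bullet> b = r * (sgn x \<bullet> b)" by (cases "x = 0") (auto simp: r_def sgn_div_norm)
    have "r\<^sup>2 < 1" using True by (simp add: r_def abs_square_less_1)
    then have "c (x \<bullet> x) / norm x = r * (1 - r\<^sup>2)\<^sup>2" "c' (x \<bullet> x) = (1 - r\<^sup>2)\<^sup>2 - 2 * r\<^sup>2 * (1 - r\<^sup>2)"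
      unfolding c_def c'_def xx r_def[symmetric] by (auto simp: power2_eq_square max_def)
    then show ?thesis using True
      by (simp add: u'_def xb r_def[symmetric]) (simp add: power2_eq_square power3_eq_cube algebra_simps eval_nat_numeral)
  next
    case False
    then have "1 \<le> x \<bullet> x" unfolding power2_norm_eq_inner[symmetric] by (simp add: not_less one_le_power)
    then show ?thesis using False by (simp add: u'_def c_def c'_def max_def)
  qed
  define A where "A = (\<integral>x. sgn x \<bullet> b * F (sgn x) * indicator (ball 0 1) x \<partial>lborel)"
  define T where "T = (\<integral>x. sphere_grad F (sgn x) \<bullet> b * indicator (ball 0 1) x \<partial>lborel)"
  define D where "D = real DIM('a)"
  have D: "D \<ge> 1" using DIM_positive[where 'a = 'a] by (simp add: D_def Suc_leI)
  have sb: "\<bar>sgn x \<bullet> b\<bar> \<le> 1" for x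
    using Cauchy_Schwarz_ineq2[of "sgn x" b] b by (auto simp: norm_sgn split: if_splits)
  have KFb: "\<bar>(\<lambda>y. (y \<bullet> b) * F y) (sgn x)\<bar> \<le> 1 * KF" for x
    unfolding abs_mult by (rule mult_mono) (use sb KF in auto)
  note A = integral_norm_power_sgn[of "\<lambda>y. (y \<bullet> b) * F y" "1 * KF", OF _ KFb, simplified mult.assoc]
  note T = integral_norm_power_sgn[of "\<lambda>y. sphere_grad F y \<bullet> b" KG, OF _ KGb, simplified mult.assoc]
  \<comment> \<open>16 = 2 + 8 + 6 and 4 = 1 + 2 + 1 sum the absolute coefficients in
    \<open>poly\<close>.\<close>
  have "\<bar>u' x b\<bar> \<le> 16 * KF + 4 * KG" for x
  proof (cases "norm x < 1")
    case True
    have *: "\<bar>norm x ^ n * y\<bar> \<le> K" if "\<bar>y\<bar> \<le> K" for n y K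
    proof -
      have "norm x ^ n * \<bar>y\<bar> \<le> 1 * K"
        using True that by (intro mult_mono) (auto simp: power_le_one)
      then show ?thesis by (simp add: abs_mult)
    qed
    have lin: "\<bar>a1\<bar> \<le> K \<Longrightarrow> \<bar>a3\<bar> \<le> K \<Longrightarrow> \<bar>a5\<bar> \<le> K \<Longrightarrow> \<bar>t1\<bar> \<le> L \<Longrightarrow> \<bar>t3\<bar> \<le> L \<Longrightarrow> \<bar>t5\<bar> \<le> L \<Longrightarrow>
        \<bar>(2 * a1 - 8 * a3 + 6 * a5) + (t1 - 2 * t3 + t5)\<bar> \<le> 16 * K + 4 * L" for a1 a3 a5 t1 t3 t5 K L :: real
      by linarith
    then show ?thesis
      unfolding poly by (intro lin *) (use True KFb[of x] KGb[of x] in simp_all)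
  next
    case False
    have "0 \<le> KF" "0 \<le> KG" using KF[of 0] KGb[of 0] by auto
    then show ?thesis unfolding poly using False by simp
  qed
  moreover have "u x = 0" if "norm x \<ge> 1" for x
  proof -
    have "1 \<le> x \<bullet> x" using that unfolding power2_norm_eq_inner[symmetric] by (simp add: one_le_power)
    then show ?thesis by (simp add: u_def c_def)
  qed
  ultimately have "(\<integral>x. u' x b \<partial>lborel) = 0"
    using deriv b by (intro integral_derivative_eq_0[where u = u and u' = u' and C = "16 * KF + 4 * KG"]) auto
  moreover define a where "a n x = norm x ^ n * (sgn x \<bullet> b * F (sgn x) * indicator (ball 0 1) x)" for n x
  moreover define t where "t n x = norm x ^ n * (sphere_grad F (sgn x) \<bullet> b * indicator (ball 0 1) x)" for n x
  ultimately have "(\<integral>x. (2 * a 1 x - 8 * a 3 x + 6 * a 5 x) + (t 1 x - 2 * t 3 x + t 5 x) \<partial>lborel) = 0"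
    by (simp only: poly)
  moreover have "integrable lborel (a n)" "integral\<^sup>L lborel (a n) = D / (n + D) * A"
    "integrable lborel (t n)" "integral\<^sup>L lborel (t n) = D / (n + D) * T" for n
    using A[of n] T[of n] by (simp_all add: a_def[abs_def] t_def[abs_def] A_def T_def D_def mult.assoc)
  ultimately have "2 * (D / (1 + D) * A) - 8 * (D / (3 + D) * A) + 6 * (D / (5 + D) * A)
      + (D / (1 + D) * T - 2 * (D / (3 + D) * T) + D / (5 + D) * T) = 0"
    by simp
  \<comment> \<open>After clearing (1 + D) (3 + D) (5 + D), the coefficient of D T is 8 and that of
    D A is 8 - 8 D.\<close>
  then have "A * (D * 8) + D * (T * 8) = A * (D * (D * 8))"
    using D by (simp add: divide_simps) (simp add: algebra_simps)
  then have "D * (T - (D - 1) * A) = 0" by algebra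
  then have "T - (D - 1) * A = 0" using D by (simp only: mult_eq_0_iff) auto
  then show ?thesis
    by (simp add: integral_sphere_measure A_def T_def D_def)
qed

section \<open>Convergence in L2\<close>

lemma integrable_inner_L2:
  fixes U V :: "'a \<Rightarrow> 'b::euclidean_space"
  assumes [measurable]: "U \<in> borel_measurable M" "V \<in> borel_measurable M"
    and U: "integrable M (\<lambda>x. (norm (U x))\<^sup>2)" and V: "integrable M (\<lambda>x. (norm (V x))\<^sup>2)"
  shows "integrable M (\<lambda>x. U x \<bullet> V x)"
proof (rule Bochner_Integration.integrable_bound[OF Bochner_Integration.integrable_add[OF U V]])
  have "\<bar>U x \<bullet> V x\<bar> \<le> (norm (U x))\<^sup>2 + (norm (V x))\<^sup>2" for x
  proof -
    have "2 * (norm (U x) * norm (V x)) \<le> (norm (U x))\<^sup>2 + (norm (V x))\<^sup>2"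
      using sum_squares_bound[of "norm (U x)" "norm (V x)"] by (simp add: mult.assoc)
    moreover have "0 \<le> norm (U x) * norm (V x)" by simp
    ultimately show ?thesis using Cauchy_Schwarz_ineq2[of "U x" "V x"] by linarith
  qed
  then show "AE x in M. norm (U x \<bullet> V x) \<le> norm ((norm (U x))\<^sup>2 + (norm (V x))\<^sup>2)"
    by simp
qed simp

text \<open>The discriminant argument: the squared L2 norm of U + t V is a quadratic polynomial in t
  without negative values.\<close>

lemma Cauchy_Schwarz_integral_inner:
  fixes U V :: "'a \<Rightarrow> 'b::euclidean_space"
  assumes [measurable]: "U \<in> borel_measurable M" "V \<in> borel_measurable M"
    and U: "integrable M (\<lambda>x. (norm (U x))\<^sup>2)" and V: "integrable M (\<lambda>x. (norm (V x))\<^sup>2)"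
  shows "\<bar>\<integral>x. U x \<bullet> V x \<partial>M\<bar> \<le> sqrt (\<integral>x. (norm (U x))\<^sup>2 \<partial>M) * sqrt (\<integral>x. (norm (V x))\<^sup>2 \<partial>M)"
proof -
  define a where "a = (\<integral>x. (norm (U x))\<^sup>2 \<partial>M)"
  define b where "b = (\<integral>x. (norm (V x))\<^sup>2 \<partial>M)"
  define c where "c = (\<integral>x. U x \<bullet> V x \<partial>M)"
  have UV: "integrable M (\<lambda>x. U x \<bullet> V x)" by (rule integrable_inner_L2) (use U V in auto)
  have quad: "0 \<le> a + 2 * t * c + t\<^sup>2 * b" for t
  proof -
    have "0 \<le> (\<integral>x. (norm (U x + t *\<^sub>R V x))\<^sup>2 \<partial>M)" by simp
    also have "(\<lambda>x. (norm (U x + t *\<^sub>R V x))\<^sup>2) =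
        (\<lambda>x. (norm (U x))\<^sup>2 + 2 * t * (U x \<bullet> V x) + t\<^sup>2 * (norm (V x))\<^sup>2)"
      by (simp only: power2_norm_eq_inner) (simp add: algebra_simps inner_commute power2_eq_square)
    also have "(\<integral>x. (norm (U x))\<^sup>2 + 2 * t * (U x \<bullet> V x) + t\<^sup>2 * (norm (V x))\<^sup>2 \<partial>M) = a + 2 * t * c + t\<^sup>2 * b"
      unfolding a_def b_def c_def using U V UV by simp
    finally show ?thesis .
  qed
  have b: "0 \<le> b" by (simp add: b_def)
  have "c\<^sup>2 \<le> a * b"
  proof (cases "b = 0")
    case True
    have "c = 0"
    proof (rule ccontr)
      assume "c \<noteq> 0"
      \<comment> \<open>With b = 0 the polynomial is affine in t, and this t gives it the value
        -1.\<close>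
      then show False using quad[of "- (a + 1) / (2 * c)"] True by (simp add: field_simps)
    qed
    then show ?thesis using True by simp
  next
    case False
    then show ?thesis using quad[of "- c / b"] b
      by (simp add: divide_simps power2_eq_square split: if_splits)
  qed
  then have "\<bar>c\<bar> \<le> sqrt (a * b)" by (simp add: real_le_rsqrt)
  then show ?thesis by (simp add: a_def b_def c_def real_sqrt_mult)
qed

text \<open>The integrability clauses belong to the notion: without them the Bochner integral in the
  last clause could be 0 by default.\<close>

definition L2_conv :: "'a measure \<Rightarrow> (nat \<Rightarrow> 'a \<Rightarrow> 'b::euclidean_space) \<Rightarrow> ('a \<Rightarrow> 'b) \<Rightarrow> bool" where
  "L2_conv M Us U \<longleftrightarrow> (\<forall>n. Us n \<in> borel_measurable M) \<and> U \<in> borel_measurable M \<and>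
     (\<forall>n. integrable M (\<lambda>x. (norm (Us n x))\<^sup>2)) \<and> integrable M (\<lambda>x. (norm (U x))\<^sup>2) \<and>
     (\<lambda>n. \<integral>x. (norm (Us n x - U x))\<^sup>2 \<partial>M) \<longlonglongrightarrow> 0"

lemma norm_diff_power2_le:
  fixes x y :: "'a::real_inner"
  shows "(norm (x - y))\<^sup>2 \<le> 2 * (norm x)\<^sup>2 + 2 * (norm y)\<^sup>2"
proof -
  have "(norm (x - y))\<^sup>2 + (norm (x + y))\<^sup>2 = 2 * (norm x)\<^sup>2 + 2 * (norm y)\<^sup>2"
    by (simp add: power2_norm_eq_inner algebra_simps)
  then show ?thesis using zero_le_power2[of "norm (x + y)"] by linarith
qed

lemma norm_power2_le_diff:
  fixes x y :: "'a::real_inner"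
  shows "(norm x)\<^sup>2 \<le> 2 * (norm (x - y))\<^sup>2 + 2 * (norm y)\<^sup>2"
  using norm_diff_power2_le[of "x - y" "- y"] by simp

lemma integrable_norm_diff_power2:
  fixes U V :: "'a \<Rightarrow> 'b::euclidean_space"
  assumes [measurable]: "U \<in> borel_measurable M" "V \<in> borel_measurable M"
    and "integrable M (\<lambda>x. (norm (U x))\<^sup>2)" "integrable M (\<lambda>x. (norm (V x))\<^sup>2)"
  shows "integrable M (\<lambda>x. (norm (U x - V x))\<^sup>2)"
proof (rule Bochner_Integration.integrable_bound)
  show "integrable M (\<lambda>x. 2 * (norm (U x))\<^sup>2 + 2 * (norm (V x))\<^sup>2)" using assms by simp
qed (auto intro: order_trans[OF norm_diff_power2_le])

text \<open>Square integrability of the limit comes for free: some \<open>Us n\<close> lies at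
  finite distance from U. The distance is measured by \<open>nn_integral\<close>, which has no
  default value, and becomes a Bochner integral only afterwards.\<close>

lemma L2_convI:
  fixes U :: "'a \<Rightarrow> 'b::euclidean_space"
  assumes [measurable]: "\<And>n. Us n \<in> borel_measurable M" "U \<in> borel_measurable M"
    and Us: "\<And>n. integrable M (\<lambda>x. (norm (Us n x))\<^sup>2)"
    and lim: "(\<lambda>n. \<integral>\<^sup>+x. ennreal ((norm (U x - Us n x))\<^sup>2) \<partial>M) \<longlonglongrightarrow> 0"
  shows "L2_conv M Us U"
proof -
  have "\<forall>\<^sub>F n in sequentially. (\<integral>\<^sup>+x. ennreal ((norm (U x - Us n x))\<^sup>2) \<partial>M) < 1"
    using lim by (rule order_tendstoD) simp
  then obtain n where n: "(\<integral>\<^sup>+x. ennreal ((norm (U x - Us n x))\<^sup>2) \<partial>M) < 1"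
    using eventually_happens'[OF sequentially_bot] by blast
  have "integrable M (\<lambda>x. (norm (U x - Us n x))\<^sup>2)"
    by (rule integrableI_bounded) (use less_trans[OF n, of \<infinity>] in auto)
  then have "integrable M (\<lambda>x. 2 * (norm (U x - Us n x))\<^sup>2 + 2 * (norm (Us n x))\<^sup>2)"
    using Us by simp
  then have U: "integrable M (\<lambda>x. (norm (U x))\<^sup>2)"
    by (rule Bochner_Integration.integrable_bound) (auto intro: order_trans[OF norm_power2_le_diff])
  have "(\<integral>\<^sup>+x. ennreal ((norm (U x - Us n x))\<^sup>2) \<partial>M) = ennreal (\<integral>x. (norm (Us n x - U x))\<^sup>2 \<partial>M)" for n
    unfolding norm_minus_commute[of "U _"]
    by (rule nn_integral_eq_integral) (auto intro!: integrable_norm_diff_power2 U Us)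
  then have "(\<lambda>n. ennreal (\<integral>x. (norm (Us n x - U x))\<^sup>2 \<partial>M)) \<longlonglongrightarrow> ennreal 0"
    using lim by simp
  then have "(\<lambda>n. \<integral>x. (norm (Us n x - U x))\<^sup>2 \<partial>M) \<longlonglongrightarrow> 0"
    by (subst (asm) tendsto_ennreal_iff) auto
  then show ?thesis using U Us by (simp add: L2_conv_def)
qed

lemma L2_conv_const:
  assumes "L2_conv M Us U"
  shows "L2_conv M (\<lambda>_. U) U"
  using assms by (simp add: L2_conv_def)

lemma L2_conv_integrable_inner:
  assumes "L2_conv M Us U" "L2_conv M Vs V"
  shows "integrable M (\<lambda>x. U x \<bullet> V x)"
  using assms by (auto simp: L2_conv_def intro: integrable_inner_L2)

text \<open>Expanding both factors around their limits leaves three error terms. Each contains a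
  difference tending to 0 in L2, so Cauchy-Schwarz disposes of it.\<close>

lemma L2_conv_tendsto_inner:
  assumes U: "L2_conv M Us U" and V: "L2_conv M Vs V"
  shows "(\<lambda>n. \<integral>x. Us n x \<bullet> Vs n x \<partial>M) \<longlonglongrightarrow> (\<integral>x. U x \<bullet> V x \<partial>M)"
proof -
  let ?N = "\<lambda>F. \<integral>x. (norm (F x :: 'b))\<^sup>2 \<partial>M"
  let ?du = "\<lambda>n x. Us n x - U x" and ?dv = "\<lambda>n x. Vs n x - V x"
  note d = U[unfolded L2_conv_def] V[unfolded L2_conv_def]
  have [measurable]: "U \<in> borel_measurable M" "V \<in> borel_measurable M"
     "Us n \<in> borel_measurable M" "Vs n \<in> borel_measurable M" for n using d by auto
  have idu: "integrable M (\<lambda>x. (norm (?du n x))\<^sup>2)" and idv: "integrable M (\<lambda>x. (norm (?dv n x))\<^sup>2)" for n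
    using d by (auto intro: integrable_norm_diff_power2)
  have limu: "(\<lambda>n. ?N (?du n)) \<longlonglongrightarrow> 0" and limv: "(\<lambda>n. ?N (?dv n)) \<longlonglongrightarrow> 0"
    using d by auto
  have ints: "integrable M (\<lambda>x. ?du n x \<bullet> ?dv n x)" "integrable M (\<lambda>x. ?du n x \<bullet> V x)"
    "integrable M (\<lambda>x. U x \<bullet> ?dv n x)" "integrable M (\<lambda>x. U x \<bullet> V x)" for n
    using idu idv d by (auto intro!: integrable_inner_L2)
  have "(\<integral>x. Us n x \<bullet> Vs n x \<partial>M) = (\<integral>x. U x \<bullet> V x \<partial>M)
      + ((\<integral>x. ?du n x \<bullet> ?dv n x \<partial>M) + (\<integral>x. ?du n x \<bullet> V x \<partial>M) + (\<integral>x. U x \<bullet> ?dv n x \<partial>M))" for n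
  proof -
    have "(\<integral>x. Us n x \<bullet> Vs n x \<partial>M) =
      (\<integral>x. U x \<bullet> V x + (?du n x \<bullet> ?dv n x + ?du n x \<bullet> V x + U x \<bullet> ?dv n x) \<partial>M)"
      by (intro Bochner_Integration.integral_cong) (auto simp: algebra_simps)
    then show ?thesis using ints by (simp del: inner_diff_left inner_diff_right add: Bochner_Integration.integral_add)
  qed
  moreover have "(\<lambda>n. \<integral>x. ?du n x \<bullet> ?dv n x \<partial>M) \<longlonglongrightarrow> 0"
    by (rule Lim_null_comparison[where g = "\<lambda>n. sqrt (?N (?du n)) * sqrt (?N (?dv n))"])
      (use limu limv idu idv in \<open>auto intro!: always_eventually Cauchy_Schwarz_integral_inner tendsto_eq_intros\<close>)
  moreover have "(\<lambda>n. \<integral>x. ?du n x \<bullet> V x \<partial>M) \<longlonglongrightarrow> 0"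
    by (rule Lim_null_comparison[where g = "\<lambda>n. sqrt (?N (?du n)) * sqrt (?N V)"])
      (use limu idu d in \<open>auto intro!: always_eventually Cauchy_Schwarz_integral_inner tendsto_eq_intros\<close>)
  moreover have "(\<lambda>n. \<integral>x. U x \<bullet> ?dv n x \<partial>M) \<longlonglongrightarrow> 0"
    by (rule Lim_null_comparison[where g = "\<lambda>n. sqrt (?N U) * sqrt (?N (?dv n))"])
      (use limv idv d in \<open>auto intro!: always_eventually Cauchy_Schwarz_integral_inner tendsto_eq_intros\<close>)
  ultimately show ?thesis by (auto intro!: tendsto_eq_intros)
qed

text \<open>Fatou's lemma, for bounds that are uniform along a regularization.\<close>

lemma nn_integral_le_of_tendsto:
  fixes f :: "nat \<Rightarrow> 'a \<Rightarrow> ennreal"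
  assumes [measurable]: "\<And>n. f n \<in> borel_measurable M"
    and lim: "AE x in M. (\<lambda>n. f n x) \<longlonglongrightarrow> g x"
    and bound: "\<And>n. (\<integral>\<^sup>+x. f n x \<partial>M) \<le> R"
  shows "(\<integral>\<^sup>+x. g x \<partial>M) \<le> R"
proof -
  have "(\<integral>\<^sup>+x. g x \<partial>M) = (\<integral>\<^sup>+x. liminf (\<lambda>n. f n x) \<partial>M)"
    using lim by (intro nn_integral_cong_AE) (auto elim!: eventually_mono dest: lim_imp_Liminf[rotated])
  also have "\<dots> \<le> liminf (\<lambda>n. \<integral>\<^sup>+x. f n x \<partial>M)" by (rule nn_integral_liminf) simp
  also have "\<dots> \<le> R"
    using Liminf_mono[of "\<lambda>n. \<integral>\<^sup>+x. f n x \<partial>M" "\<lambda>_. R" sequentially] bound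
    by (simp add: Liminf_const)
  finally show ?thesis .
qed

section \<open>A divergence identity and its singular weights\<close>

text \<open>Supplies a majorant independent of \<epsilon> for dominated convergence. For a negative
  exponent the shift only decreases the power; otherwise the base is at most 2.\<close>

lemma powr_shift_le:
  fixes r :: real
  assumes "0 < r" "r \<le> 1" "0 < \<epsilon>" "\<epsilon> \<le> 1"
  shows "(r + \<epsilon>) powr p \<le> r powr p + 2 powr \<bar>p\<bar>"
proof (cases "p \<ge> 0")
  case True
  then have "(r + \<epsilon>) powr p \<le> 2 powr p" using assms by (intro powr_mono2) auto
  then show ?thesis using True by (simp add: add_increasing)
next
  case False
  then have "(r + \<epsilon>) powr p \<le> r powr p" using assms by (intro powr_mono2') auto
  then show ?thesis by (simp add: add_increasing2)
qed

text \<open>The factor r pays for one unit of the exponent, uniformly in \<epsilon>.\<close>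

lemma powr_diff_one_mult_le:
  fixes r :: real
  assumes "0 \<le> r" "0 < \<epsilon>"
  shows "(r + \<epsilon>) powr (p - 1) * r \<le> (r + \<epsilon>) powr p"
proof -
  have "(r + \<epsilon>) powr (p - 1) * r \<le> (r + \<epsilon>) powr (p - 1) * (r + \<epsilon>)"
    using assms by (intro mult_left_mono) auto
  also have "\<dots> = (r + \<epsilon>) powr p" using assms by (simp add: powr_diff)
  finally show ?thesis .
qed

text \<open>Captures what the two problems share, with B for the first k coordinate directions.
  Restricting the formula to directions in B avoids the last coordinate, the one in which the
  hemisphere weight varies.\<close>

locale sphere_ibp = finite_measure \<mu> for \<mu> :: "'a::euclidean_space measure" +
  fixes B :: "'a set" and M :: real
  assumes sets_mu [simp, measurable_cong]: "sets \<mu> = sets borel"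
    and AE_norm: "AE x in \<mu>. norm x = 1"
    and B_Basis: "B \<subseteq> Basis" and B_nonempty: "B \<noteq> {}"
    and ibp: "\<And>F b. Ck (Suc 0) F \<Longrightarrow> b \<in> B \<Longrightarrow>
      (\<integral>x. sphere_grad F x \<bullet> b \<partial>\<mu>) = (M + 1) * (\<integral>x. (x \<bullet> b) * F x \<partial>\<mu>)"
begin

definition E :: "'a \<Rightarrow> 'a" where "E x = (\<Sum>b\<in>B. (x \<bullet> b) *\<^sub>R b)"
definition r2 :: "'a \<Rightarrow> real" where "r2 x = (\<Sum>b\<in>B. (x \<bullet> b)\<^sup>2)"
definition X :: "'a \<Rightarrow> 'a" where "X x = E x - r2 x *\<^sub>R x"
abbreviation k :: real where "k \<equiv> real (card B)"

lemma space_mu [simp]: "space \<mu> = UNIV"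
  using sets_eq_imp_space_eq[OF sets_mu] by simp

lemma borel_measurable_mu [simp]: "f \<in> borel_measurable \<mu> \<longleftrightarrow> f \<in> borel_measurable borel"
  using measurable_cong_sets[OF sets_mu refl] by blast

lemma finite_B [simp]: "finite B"
  using B_Basis finite_Basis finite_subset by blast

lemma k_pos: "k \<ge> 1"
  using B_nonempty by (simp add: Suc_leI card_gt_0_iff)

lemma r2_nonneg [simp]: "0 \<le> r2 x"
  by (simp add: r2_def sum_nonneg)

lemma E_inner_self: "E x \<bullet> x = r2 x"
  unfolding E_def r2_def inner_sum_left power2_eq_square inner_scaleR_left
  by (intro sum.cong) (simp_all add: inner_commute)

lemma E_inner_E: "E x \<bullet> E x = r2 x"
proof -
  have "E x \<bullet> b = x \<bullet> b" if "b \<in> B" for b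
  proof -
    have "E x \<bullet> b = (\<Sum>c\<in>B. if c = b then x \<bullet> c else 0)"
      unfolding E_def inner_sum_left
      using that B_Basis by (intro sum.cong) (auto simp: inner_Basis subset_iff)
    then show ?thesis using that by simp
  qed
  then show ?thesis
    by (subst (2) E_def) (simp add: inner_sum_right r2_def power2_eq_square)
qed

lemma r2_le: "r2 x \<le> (norm x)\<^sup>2"
proof -
  have "r2 x \<le> norm (E x) * norm x"
    using norm_cauchy_schwarz[of "E x" x] by (simp add: E_inner_self)
  also have "norm (E x) = sqrt (r2 x)" by (simp add: norm_eq_sqrt_inner E_inner_E)
  finally have "sqrt (r2 x) * sqrt (r2 x) \<le> sqrt (r2 x) * norm x" by simp
  then have "sqrt (r2 x) \<le> norm x"
    by (cases "r2 x = 0") (auto dest!: mult_left_le_imp_le simp: less_le simp del: real_sqrt_mult_self)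
  then show ?thesis using power_mono[of "sqrt (r2 x)" "norm x" 2] by simp
qed

lemma r2_le_1: "norm x = 1 \<Longrightarrow> r2 x \<le> 1"
  using r2_le[of x] by simp

lemma Ck_r2: "Ck n r2"
  unfolding r2_def[abs_def] power2_eq_square by (intro Ck_sum Ck_mult) simp_all

lemma grad_r2: "grad r2 x = 2 *\<^sub>R E x"
proof (rule grad_eqI)
  have "((\<lambda>x. (x \<bullet> b)\<^sup>2) has_derivative (\<lambda>v. 2 * (x \<bullet> b) * (b \<bullet> v))) (at x)" for b
    by (auto intro!: derivative_eq_intros simp: fun_eq_iff inner_commute)
  then have "(r2 has_derivative (\<lambda>v. \<Sum>b\<in>B. 2 * (x \<bullet> b) * (b \<bullet> v))) (at x)"
    unfolding r2_def[abs_def] by (rule has_derivative_sum)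
  then show "(r2 has_derivative (\<lambda>v. 2 *\<^sub>R E x \<bullet> v)) (at x)"
    by (simp add: E_def inner_sum_left sum_distrib_left mult.assoc)
qed

lemma continuous_r2: "continuous_on UNIV r2"
  unfolding r2_def[abs_def] by (intro continuous_intros)

lemma continuous_X: "continuous_on UNIV X"
  unfolding X_def[abs_def] E_def[abs_def] by (intro continuous_intros continuous_r2)

lemma measurable_r2 [measurable]: "r2 \<in> borel_measurable borel"
  by (rule borel_measurable_continuous_onI[OF continuous_r2])

lemma measurable_X [measurable]: "X \<in> borel_measurable borel"
  by (rule borel_measurable_continuous_onI[OF continuous_X])

lemma X_inner_E: "X x \<bullet> E x = r2 x * (1 - r2 x)"
  by (simp add: X_def inner_diff_left E_inner_E inner_commute[of x "E x"] E_inner_self algebra_simps)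

lemma X_inner_self: "norm x = 1 \<Longrightarrow> X x \<bullet> x = 0"
  by (simp add: X_def inner_diff_left E_inner_self power2_norm_eq_inner[symmetric])

text \<open>Near rho = 0 the length of X is comparable to rho, so X / \<open>r2\<close> is of order
  1 / rho.\<close>

lemma X_inner_X: "norm x = 1 \<Longrightarrow> X x \<bullet> X x = r2 x * (1 - r2 x)"
  by (subst (2) X_def) (simp add: inner_diff_right X_inner_E X_inner_self)

lemma sphere_grad_inner_X: "norm x = 1 \<Longrightarrow> sphere_grad f x \<bullet> X x = X x \<bullet> grad f x"
  by (simp add: sphere_grad_def inner_diff_right X_inner_self inner_commute[of _ "X x"])

lemma integrable_continuous:
  fixes f :: "'a \<Rightarrow> real"
  assumes "continuous_on UNIV f"
  shows "integrable \<mu> f"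
proof -
  obtain K where "\<And>x. norm x \<le> 1 \<Longrightarrow> norm (f x) \<le> K"
    using continuous_on_bounded_cball[OF assms] by auto
  then show ?thesis
    using AE_norm assms
    by (intro integrable_const_bound[where B = K])
      (auto elim!: eventually_mono intro: borel_measurable_continuous_onI)
qed

text \<open>Sum over b in B of the integration by parts for (x . b) f in direction b.
  Differentiating the coordinates gives k; the tangential projection and the constant
  \<open>M + 1\<close> together take away (M + 2) \<open>r2\<close>.\<close>

lemma integral_X_divergence:
  assumes f: "Ck (Suc 0) f"
  shows "(\<integral>x. X x \<bullet> grad f x + (k - (M + 2) * r2 x) * f x \<partial>\<mu>) = 0"
proof -
  have cont: "continuous_on UNIV f" "continuous_on UNIV (grad f)"
    using f Ck_imp_continuous_on continuous_on_grad by blast+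
  let ?F = "\<lambda>b x. (x \<bullet> b) * f x"
  let ?T = "\<lambda>b x. f x + (x \<bullet> b) * (grad f x \<bullet> b) - (x \<bullet> b)\<^sup>2 * (f x + grad f x \<bullet> x)"
  have T: "sphere_grad (?F b) x \<bullet> b = ?T b x" if "b \<in> B" for b x
  proof -
    have "b \<bullet> b = 1" using that B_Basis by (auto simp: inner_Basis subset_iff)
    then show ?thesis
      unfolding sphere_grad_def grad_mult[OF Ck_inner_right f] grad_inner
      by (simp add: algebra_simps inner_commute power2_eq_square)
  qed
  have int: "integrable \<mu> (?T b)" "integrable \<mu> (\<lambda>x. (x \<bullet> b) * ?F b x)" for b
    using cont by (auto intro!: integrable_continuous continuous_intros)
  have "(\<integral>x. ?T b x \<partial>\<mu>) = (M + 1) * (\<integral>x. (x \<bullet> b) * ?F b x \<partial>\<mu>)" if "b \<in> B" for b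
    using ibp[OF Ck_mult[OF Ck_inner_right[of _ b] f] that] T[OF that] by simp
  then have "(\<integral>x. ?T b x - (M + 1) * ((x \<bullet> b) * ?F b x) \<partial>\<mu>) = 0" if "b \<in> B" for b
    using that int by simp
  then have "(\<integral>x. (\<Sum>b\<in>B. ?T b x - (M + 1) * ((x \<bullet> b) * ?F b x)) \<partial>\<mu>) = 0"
    using int by (subst Bochner_Integration.integral_sum) auto
  moreover have "(\<Sum>b\<in>B. ?T b x - (M + 1) * ((x \<bullet> b) * ?F b x))
      = X x \<bullet> grad f x + (k - (M + 2) * r2 x) * f x" for x
  proof -
    have "(\<Sum>b\<in>B. ?T b x - (M + 1) * ((x \<bullet> b) * ?F b x)) =
      (\<Sum>b\<in>B. f x + (x \<bullet> b) * (b \<bullet> grad f x) - (x \<bullet> b)\<^sup>2 * (x \<bullet> grad f x) - (x \<bullet> b)\<^sup>2 * ((M + 2) * f x))"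
      by (intro sum.cong) (auto simp: algebra_simps power2_eq_square inner_commute)
    also have "\<dots> = k * f x + E x \<bullet> grad f x - r2 x * (x \<bullet> grad f x) - r2 x * ((M + 2) * f x)"
      by (simp add: sum.distrib sum_subtractf E_def inner_sum_left r2_def sum_distrib_right)
    finally show ?thesis by (simp add: X_def algebra_simps)
  qed
  ultimately show ?thesis by simp
qed

lemma shift_pos: "\<epsilon> > 0 \<Longrightarrow> 0 < r2 x + \<epsilon>"
  by (simp add: add_nonneg_pos)

lemma continuous_shift_powr: "\<epsilon> > 0 \<Longrightarrow> continuous_on UNIV (\<lambda>x. (r2 x + \<epsilon>) powr p)"
  by (intro continuous_intros continuous_r2 ballI less_imp_neq[THEN not_sym] shift_pos)

lemma Ck_shift: "\<epsilon> > 0 \<Longrightarrow> Ck n (\<lambda>x. (r2 x + \<epsilon>) powr p)"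
  by (intro Ck_powr Ck_add Ck_r2 Ck_const add_nonneg_pos) auto

lemma grad_shift: "\<epsilon> > 0 \<Longrightarrow> grad (\<lambda>x. (r2 x + \<epsilon>) powr p) x = (2 * p * (r2 x + \<epsilon>) powr (p - 1)) *\<^sub>R E x"
proof -
  assume e: "\<epsilon> > 0"
  have 1: "Ck (Suc 0) (\<lambda>x. r2 x + \<epsilon>)" by (intro Ck_add Ck_r2 Ck_const)
  have "((\<lambda>x. r2 x + \<epsilon>) has_derivative (\<lambda>v. (2 *\<^sub>R E x) \<bullet> v)) (at x)"
    using has_derivative_grad[OF Ck_r2] by (auto intro!: derivative_eq_intros simp: grad_r2)
  from grad_eqI[OF this] show ?thesis
    using e by (subst grad_powr[OF 1]) (auto simp: add_nonneg_pos mult_ac)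
qed

text \<open>The previous identity applied to a shifted power times f. Since X . E = r2 (1 - r2),
  differentiating the power brings out a factor \<open>r2\<close> that compensates the exponent p -
  1.\<close>

lemma integral_shift_divergence:
  assumes f: "Ck (Suc 0) f" and e: "\<epsilon> > 0"
  shows "(\<integral>x. (r2 x + \<epsilon>) powr p * (X x \<bullet> grad f x + (k - (M + 2) * r2 x) * f x)
     + 2 * p * ((r2 x + \<epsilon>) powr (p - 1) * r2 x) * ((1 - r2 x) * f x) \<partial>\<mu>) = 0"
proof -
  have "X x \<bullet> grad (\<lambda>x. (r2 x + \<epsilon>) powr p * f x) x + (k - (M + 2) * r2 x) * ((r2 x + \<epsilon>) powr p * f x)
    = (r2 x + \<epsilon>) powr p * (X x \<bullet> grad f x + (k - (M + 2) * r2 x) * f x)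
     + 2 * p * ((r2 x + \<epsilon>) powr (p - 1) * r2 x) * ((1 - r2 x) * f x)" for x
    unfolding grad_mult[OF Ck_shift[OF e] f] grad_shift[OF e]
    by (simp add: inner_add_right X_inner_E algebra_simps)
  then show ?thesis
    using integral_X_divergence[OF Ck_mult[OF Ck_shift[OF e, of _ p] f]] by simp
qed

text \<open>Testing the divergence identity with \<open>(r2 + \<epsilon>) powr p\<close> itself bounds its integral, because
  the leading coefficient \<open>k + 2 p\<close> is positive.\<close>

lemma integral_shift_powr_bounded:
  assumes p: "p < 0" "2 * p > - k"
  obtains C where "\<And>\<epsilon>. \<epsilon> > 0 \<Longrightarrow> (\<integral>x. (r2 x + \<epsilon>) powr p \<partial>\<mu>) \<le> C"
proof -
  \<comment> \<open>\<open>m\<close> dominates the coefficient of \<open>r2\<close> and is positive.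
    The threshold \<open>d\<close> is chosen so that m d = c, half of the leading coefficient: where
    r2 <= d the term m r2 is absorbed by that half, and where r2 > d the power is at most d powr
    p.\<close>
  define m where "m = \<bar>M + 2\<bar> + 1"
  define d where "d = (k + 2 * p) / (2 * m)"
  define c where "c = (k + 2 * p) / 2"
  have m: "m > 0" by (simp add: m_def)
  have d: "d > 0" "m * d = c" and c: "c > 0" using p m by (auto simp: d_def c_def)
  have "(\<integral>x. (r2 x + \<epsilon>) powr p \<partial>\<mu>) \<le> (\<integral>x. m * d powr p \<partial>\<mu>) / c" if e: "\<epsilon> > 0" for \<epsilon>
  proof -
    let ?q = "\<lambda>x. (r2 x + \<epsilon>) powr p"
    let ?J = "\<lambda>x. ?q x * (k - (M + 2) * r2 x) + 2 * p * ((r2 x + \<epsilon>) powr (p - 1) * r2 x) * (1 - r2 x)"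
    have pt: "c * ?q x \<le> ?J x + m * d powr p" if "norm x = 1" for x
    proof -
      have r: "0 \<le> r2 x" "r2 x \<le> 1" using r2_le_1[OF that] by auto
      have q0: "0 \<le> ?q x" by simp
      have "r2 x * ?q x \<le> d * ?q x + d powr p"
      proof (cases "r2 x \<le> d")
        case True
        then have "r2 x * ?q x \<le> d * ?q x" by (intro mult_right_mono) auto
        then show ?thesis by (simp add: add_increasing2)
      next
        case False
        have "?q x \<le> d powr p" using False e p d by (intro powr_mono2') auto
        then have "r2 x * ?q x \<le> 1 * d powr p" using r by (intro mult_mono) auto
        moreover have "0 \<le> d * ?q x" using d by simp
        ultimately show ?thesis by linarith
      qed
      then have "m * (r2 x * ?q x) \<le> m * (d * ?q x + d powr p)" using m by (intro mult_left_mono) auto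
      then have 1: "m * (r2 x * ?q x) \<le> c * ?q x + m * d powr p"
        unfolding d(2)[symmetric] by (simp add: algebra_simps)
      have "(M + 2) * (r2 x * ?q x) \<le> m * (r2 x * ?q x)"
        using r by (intro mult_right_mono) (auto simp: m_def)
      moreover have "((r2 x + \<epsilon>) powr (p - 1) * r2 x) * (1 - r2 x) \<le> ?q x * 1"
        using r powr_diff_one_mult_le[OF r(1) e] by (intro mult_mono) auto
      then have "2 * p * ?q x \<le> 2 * p * (((r2 x + \<epsilon>) powr (p - 1) * r2 x) * (1 - r2 x))"
        using p by (intro mult_left_mono_neg) auto
      ultimately have "k * ?q x - (c * ?q x + m * d powr p) + 2 * p * ?q x \<le> ?J x"
        using 1 by (simp add: algebra_simps)
      moreover have "k * ?q x + 2 * p * ?q x = 2 * c * ?q x" by (simp add: c_def algebra_simps)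
      ultimately show ?thesis by linarith
    qed
    have J0: "(\<integral>x. ?J x \<partial>\<mu>) = 0"
    proof -
      have "grad (\<lambda>x::'a. 1) x = 0" for x by (rule grad_eqI) simp
      then show ?thesis using integral_shift_divergence[OF Ck_const[of _ 1] e, of p] by simp
    qed
    have Jint: "integrable \<mu> ?J"
      by (intro integrable_continuous continuous_intros continuous_shift_powr e continuous_r2)
    have "(\<integral>x. c * ?q x \<partial>\<mu>) \<le> (\<integral>x. ?J x + m * d powr p \<partial>\<mu>)"
    proof (rule integral_mono_AE)
      show "integrable \<mu> (\<lambda>x. c * ?q x)"
        by (intro integrable_continuous continuous_intros continuous_shift_powr e)
      show "integrable \<mu> (\<lambda>x. ?J x + m * d powr p)"
        by (intro Bochner_Integration.integrable_add Jint) simp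
      show "AE x in \<mu>. c * ?q x \<le> ?J x + m * d powr p"
        using AE_norm by eventually_elim (rule pt)
    qed
    also have "\<dots> = (\<integral>x. m * d powr p \<partial>\<mu>)"
      using Jint J0 by (subst Bochner_Integration.integral_add) auto
    finally show ?thesis using c by (simp add: pos_le_divide_eq mult.commute)
  qed
  then show thesis by (rule that)
qed

text \<open>On the zero set of \<open>r2\<close> the shifted power equals \<epsilon>^(-1/4), so the
  uniform bound C on its integral gives that set measure at most C \<epsilon>^(1/4). The exponent
  -1/4 meets 2 p > -k for every k >= 1, hence also for a single direction.\<close>

lemma AE_r2_pos: "AE x in \<mu>. 0 < r2 x"
proof -
  have "- 1 / 4 < (0::real)" "2 * (- 1 / 4) > - k" using k_pos by auto
  from integral_shift_powr_bounded[OF this]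
  obtain C where C: "\<And>\<epsilon>. \<epsilon> > 0 \<Longrightarrow> (\<integral>x. (r2 x + \<epsilon>) powr (- 1 / 4) \<partial>\<mu>) \<le> C"
    by metis
  let ?N = "{x. r2 x = 0}"
  have [measurable]: "?N \<in> sets borel" by measurable
  have *: "measure \<mu> ?N \<le> C * \<epsilon> powr (1 / 4)" if e: "\<epsilon> > 0" for \<epsilon>
  proof -
    have "(\<integral>x. \<epsilon> powr (- 1 / 4) * indicator ?N x \<partial>\<mu>) \<le> (\<integral>x. (r2 x + \<epsilon>) powr (- 1 / 4) \<partial>\<mu>)"
    proof (rule integral_mono)
      show "integrable \<mu> (\<lambda>x. \<epsilon> powr (- 1 / 4) * indicator ?N x)"
        by (intro integrable_mult_right integrable_real_indicator) (auto simp: less_top[symmetric])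
    qed (use e in \<open>simp_all add: integrable_continuous continuous_shift_powr indicator_def\<close>)
    also have "\<dots> \<le> C" using C e by simp
    finally have "\<epsilon> powr (- 1 / 4) * measure \<mu> ?N \<le> C" by simp
    then have "\<epsilon> powr (1 / 4) * (\<epsilon> powr (- 1 / 4) * measure \<mu> ?N) \<le> \<epsilon> powr (1 / 4) * C"
      by (intro mult_left_mono) auto
    moreover have "\<epsilon> powr (1 / 4) * (\<epsilon> powr (- 1 / 4) * y) = y" for y
      using e by (simp add: powr_minus divide_simps)
    ultimately show ?thesis by (simp only: mult.commute[of C])
  qed
  \<comment> \<open>The limit is 0, because \<open>0 powr (1 / 4) = 0\<close>.\<close>
  have "(\<lambda>n. C * inverse (real (Suc n)) powr (1 / 4)) \<longlonglongrightarrow> C * 0 powr (1 / 4)"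
    by (intro tendsto_mult_left tendsto_powr' LIMSEQ_inverse_real_of_nat tendsto_const) simp
  then have "measure \<mu> ?N \<le> C * 0 powr (1 / 4)"
    by (rule LIMSEQ_le_const) (use * in \<open>auto simp del: of_nat_Suc\<close>)
  then have "emeasure \<mu> ?N = 0" by (simp add: emeasure_eq_measure measure_le_0_iff)
  then have "AE x in \<mu>. x \<notin> ?N" by (intro AE_not_in) auto
  then show ?thesis by (auto elim!: eventually_mono simp: less_le)
qed

lemma tendsto_shift: "r2 x > 0 \<Longrightarrow> (\<lambda>n. (r2 x + inverse (real (Suc n))) powr p) \<longlonglongrightarrow> r2 x powr p"
  using tendsto_powr[OF tendsto_add[OF tendsto_const LIMSEQ_inverse_real_of_nat] tendsto_const, of "r2 x" p]
  by simp

text \<open>A negative power inherits the bound uniform in \<epsilon> through Fatou; a nonnegative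
  one is at most 1 on the sphere.\<close>

lemma integrable_r2_powr:
  assumes "2 * p > - k"
  shows "integrable \<mu> (\<lambda>x. r2 x powr p)"
proof (cases "p \<ge> 0")
  case True
  show ?thesis
    using AE_norm True
    by (intro integrable_const_bound[where B = 1]) (auto elim!: eventually_mono intro!: powr_le1 r2_le_1)
next
  case False
  then obtain C where C: "\<And>\<epsilon>. \<epsilon> > 0 \<Longrightarrow> (\<integral>x. (r2 x + \<epsilon>) powr p \<partial>\<mu>) \<le> C"
    using integral_shift_powr_bounded[of p] assms by (meson not_le)
  have "(\<integral>\<^sup>+x. ennreal (r2 x powr p) \<partial>\<mu>) \<le> ennreal C"
  proof (rule nn_integral_le_of_tendsto)
    show "AE x in \<mu>. (\<lambda>n. ennreal ((r2 x + inverse (real (Suc n))) powr p)) \<longlonglongrightarrow> ennreal (r2 x powr p)"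
      using AE_r2_pos by (auto elim!: eventually_mono intro!: tendsto_ennrealI tendsto_shift simp del: of_nat_Suc)
    show "(\<integral>\<^sup>+x. ennreal ((r2 x + inverse (real (Suc n))) powr p) \<partial>\<mu>) \<le> ennreal C" for n
      using C by (subst nn_integral_eq_integral)
        (auto intro!: integrable_continuous continuous_shift_powr ennreal_leI)
  qed measurable
  then show ?thesis by (intro integrableI_bounded) (auto intro: le_less_trans)
qed

text \<open>Dominated convergence as \<epsilon> tends to 0. The bracket in front of f is the
  divergence of r2^p X divided by r2^p; the powers r2^(p - 1) r2 and r2^p agree where r2 > 0, that
  is, almost everywhere.\<close>

lemma r2_divergence:
  assumes p: "2 * p > - k" and f: "Ck (Suc 0) f"
  defines "J \<equiv> \<lambda>x. r2 x powr p * (X x \<bullet> grad f x + (2 * p * (1 - r2 x) + k - (M + 2) * r2 x) * f x)"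
  shows "integrable \<mu> J" "(\<integral>x. J x \<partial>\<mu>) = 0"
proof -
  let ?e = "\<lambda>n. inverse (real (Suc n))"
  let ?a = "\<lambda>x. X x \<bullet> grad f x + (k - (M + 2) * r2 x) * f x"
  let ?b = "\<lambda>x. (1 - r2 x) * f x"
  let ?J = "\<lambda>n x. (r2 x + ?e n) powr p * ?a x
     + 2 * p * ((r2 x + ?e n) powr (p - 1) * r2 x) * ?b x"
  have cont: "continuous_on UNIV ?a" "continuous_on UNIV ?b"
    using f by (auto intro!: continuous_intros continuous_X continuous_r2 continuous_on_grad dest: Ck_imp_continuous_on)
  then have [measurable]: "?a \<in> borel_measurable borel" "?b \<in> borel_measurable borel"
    by (auto intro: borel_measurable_continuous_onI)
  obtain Ka where Ka: "\<And>x. norm x \<le> 1 \<Longrightarrow> \<bar>?a x\<bar> \<le> Ka"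
    using continuous_on_bounded_cball[OF cont(1)] by auto
  obtain Kb where Kb: "\<And>x. norm x \<le> 1 \<Longrightarrow> \<bar>?b x\<bar> \<le> Kb"
    using continuous_on_bounded_cball[OF cont(2)] by auto
  have J: "J x = r2 x powr p * ?a x + 2 * p * (r2 x powr (p - 1) * r2 x) * ?b x" if "r2 x > 0" for x
    using that by (simp add: J_def powr_diff algebra_simps)
  have lim: "AE x in \<mu>. (\<lambda>n. ?J n x) \<longlonglongrightarrow> J x"
    using AE_r2_pos
    by (rule eventually_mono) (simp only: J, intro tendsto_intros tendsto_shift)
  have dom: "AE x in \<mu>. norm (?J n x) \<le> (Ka + 2 * \<bar>p\<bar> * Kb) * (r2 x powr p + 2 powr \<bar>p\<bar>)" for n
    using AE_r2_pos AE_norm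
  proof eventually_elim
    case (elim x)
    have e: "0 < ?e n" "?e n \<le> 1" by (auto simp: inverse_le_1_iff)
    define q where "q = (r2 x + ?e n) powr p"
    define q' where "q' = (r2 x + ?e n) powr (p - 1) * r2 x"
    have q: "0 \<le> q" "q \<le> r2 x powr p + 2 powr \<bar>p\<bar>"
      using powr_shift_le[of "r2 x" "?e n" p] e elim r2_le_1[of x] by (auto simp: q_def)
    have q': "0 \<le> q'" "q' \<le> r2 x powr p + 2 powr \<bar>p\<bar>"
      using powr_diff_one_mult_le[of "r2 x" "?e n" p] e q(2) unfolding q_def q'_def by auto
    have "\<bar>q * ?a x + 2 * p * q' * ?b x\<bar> \<le> q * \<bar>?a x\<bar> + 2 * \<bar>p\<bar> * (q' * \<bar>?b x\<bar>)"
      using q q' by (intro order_trans[OF abs_triangle_ineq]) (auto simp: abs_mult)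
    also have "\<dots> \<le> (r2 x powr p + 2 powr \<bar>p\<bar>) * Ka + 2 * \<bar>p\<bar> * ((r2 x powr p + 2 powr \<bar>p\<bar>) * Kb)"
      using q q' Ka[of x] Kb[of x] elim by (intro add_mono mult_mono mult_nonneg_nonneg) auto
    finally show ?case by (simp add: q_def q'_def algebra_simps)
  qed
  have int: "integrable \<mu> (\<lambda>x. (Ka + 2 * \<bar>p\<bar> * Kb) * (r2 x powr p + 2 powr \<bar>p\<bar>))"
    using integrable_r2_powr[OF p] by simp
  have "grad f \<in> borel_measurable borel" "f \<in> borel_measurable borel"
    using f by (auto intro: borel_measurable_continuous_onI continuous_on_grad Ck_imp_continuous_on)
  then have [measurable]: "J \<in> borel_measurable borel" unfolding J_def by measurable
  show "integrable \<mu> J"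
    by (rule integrable_dominated_convergence[OF _ _ int lim dom]) measurable
  have "(\<lambda>n. \<integral>x. ?J n x \<partial>\<mu>) \<longlonglongrightarrow> (\<integral>x. J x \<partial>\<mu>)"
    by (rule integral_dominated_convergence[OF _ _ int lim dom]) measurable
  then show "(\<integral>x. J x \<partial>\<mu>) = 0"
    using integral_shift_divergence[OF f, of "?e _" p] by (simp add: LIMSEQ_const_iff del: of_nat_Suc)
qed

end

section \<open>The inequalities of Picone and Hardy\<close>

lemma nn_integral_linear_combination:
  fixes f g :: "'a \<Rightarrow> ennreal"
  assumes "f \<in> borel_measurable M" "g \<in> borel_measurable M"
  shows "(\<integral>\<^sup>+x. c * f x + d * g x \<partial>M) = c * (\<integral>\<^sup>+x. f x \<partial>M) + d * (\<integral>\<^sup>+x. g x \<partial>M)"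
  using assms by (simp add: nn_integral_add nn_integral_cmult)

context sphere_ibp
begin

lemma measurable_sphere_grad: "Ck (Suc 0) f \<Longrightarrow> sphere_grad f \<in> borel_measurable borel"
  by (intro borel_measurable_continuous_onI continuous_on_sphere_grad)

lemma measurable_Ck: "Ck n f \<Longrightarrow> f \<in> borel_measurable borel"
  by (intro borel_measurable_continuous_onI Ck_imp_continuous_on)

text \<open>The exponent p = -1 satisfies 2 p > -k exactly when k > 2.\<close>

lemma integrable_mult_inverse_r2:
  assumes "k > 2" and f: "continuous_on UNIV f"
  shows "integrable \<mu> (\<lambda>x. f x / r2 x)"
proof -
  obtain K where K: "\<And>x. norm x \<le> 1 \<Longrightarrow> \<bar>f x\<bar> \<le> K"
    using continuous_on_bounded_cball[OF f] by auto
  have [measurable]: "f \<in> borel_measurable borel" by (rule borel_measurable_continuous_onI[OF f])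
  have "integrable \<mu> (\<lambda>x. K * r2 x powr (- 1))"
    using assms by (intro integrable_mult_right integrable_r2_powr) simp
  then show ?thesis
  proof (rule Bochner_Integration.integrable_bound)
    show "AE x in \<mu>. norm (f x / r2 x) \<le> norm (K * r2 x powr (- 1))"
      using AE_norm AE_r2_pos
    proof eventually_elim
      case (elim x)
      then have "\<bar>f x\<bar> \<le> \<bar>K\<bar>" using K[of x] by simp
      then show ?case using elim by (simp add: powr_minus divide_inverse abs_mult mult_right_mono)
    qed
  qed simp
qed

text \<open>Picone's inequality for the positive function \<open>r2 powr (\<sigma> / 2)\<close>: integrating the square of
  \<open>sphere_grad \<phi> - \<phi> \<sigma> X / r2\<close> and using the divergence identity for \<open>\<phi>\<^sup>2 / r2\<close>.\<close>

lemma Picone: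
  assumes k: "k > 2" and f: "Ck (Suc 0) f"
  shows "0 \<le> (\<integral>x. (norm (sphere_grad f x))\<^sup>2 + \<sigma> * (\<sigma> + k - 2) * ((f x)\<^sup>2 / r2 x)
     - \<sigma> * (\<sigma> + M) * (f x)\<^sup>2 \<partial>\<mu>)"
proof -
  let ?T = "\<lambda>x. (norm (sphere_grad f x))\<^sup>2 + \<sigma> * (\<sigma> + k - 2) * ((f x)\<^sup>2 / r2 x) - \<sigma> * (\<sigma> + M) * (f x)\<^sup>2"
  let ?J = "\<lambda>x. r2 x powr (- 1) * (X x \<bullet> grad (\<lambda>x. f x * f x) x
    + (2 * (- 1) * (1 - r2 x) + k - (M + 2) * r2 x) * (f x * f x))"
  have cont: "continuous_on UNIV f" using Ck_imp_continuous_on f by blast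
  have J: "integrable \<mu> ?J" "(\<integral>x. ?J x \<partial>\<mu>) = 0"
    using r2_divergence[of "- 1" "\<lambda>x. f x * f x"] k f Ck_mult by auto
  have T: "integrable \<mu> ?T"
    by (intro Bochner_Integration.integrable_add Bochner_Integration.integrable_diff
        integrable_mult_right integrable_mult_inverse_r2 k integrable_continuous continuous_intros
        cont continuous_on_sphere_grad f)
  have "0 \<le> (\<integral>x. ?T x - \<sigma> * ?J x \<partial>\<mu>)"
  proof (rule integral_nonneg_AE)
    show "AE x in \<mu>. 0 \<le> ?T x - \<sigma> * ?J x"
      using AE_norm AE_r2_pos
    proof eventually_elim
      case (elim x)
      define s where "s = \<sigma> * f x / r2 x"
      have sX: "s * s * (r2 x * (1 - r2 x)) = \<sigma> * \<sigma> * ((f x)\<^sup>2 / r2 x) - \<sigma> * \<sigma> * (f x)\<^sup>2"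
        using elim by (simp add: s_def field_simps power2_eq_square)
      have "(norm (sphere_grad f x - s *\<^sub>R X x))\<^sup>2 =
          (norm (sphere_grad f x))\<^sup>2 - 2 * s * (sphere_grad f x \<bullet> X x) + s * s * (X x \<bullet> X x)"
        by (simp only: power2_norm_eq_inner) (simp add: algebra_simps inner_commute)
      also have "\<dots> = (norm (sphere_grad f x))\<^sup>2 - 2 * s * (X x \<bullet> grad f x) + \<sigma> * \<sigma> * ((f x)\<^sup>2 / r2 x) - \<sigma> * \<sigma> * (f x)\<^sup>2"
        using elim by (simp add: sphere_grad_inner_X X_inner_X sX)
      \<comment> \<open>Here \<open>?J\<close> is X . grad (f^2) / r2 + (k - 2) f^2 / r2 - M f^2.
        Subtracting \<sigma> times it removes the terms of \<open>?T\<close> linear in \<sigma> and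
        supplies the mixed term of the square.\<close>
      also have "\<dots> = ?T x - \<sigma> * ?J x"
        unfolding grad_mult[OF f f] using elim
        by (simp add: s_def powr_minus inner_add_right field_simps power2_eq_square)
      finally show ?case using zero_le_power2 by metis
    qed
  qed
  also have "\<dots> = (\<integral>x. ?T x \<partial>\<mu>)"
    by (simp only: Bochner_Integration.integral_diff[OF T integrable_mult_right[OF J(1)]]
        integral_mult_right_zero J(2) mult_zero_right diff_zero)
  finally show ?thesis .
qed

text \<open>The exponent -(k - 2) / 2 minimizes \<sigma> (\<sigma> + k - 2), with minimum -((k - 2)
  / 2)^2, so \<open>Picone\<close> controls the singular term and the lower order term is absorbed
  in \<open>l\<close>. As a result f / rho in L2 is controlled by the norm underlying
  \<open>sphere_H1\<close>.\<close>

lemma Hardy: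
  assumes k: "k > 2"
  shows "\<exists>C\<ge>0. \<forall>f. Ck (Suc 0) f \<longrightarrow>
    (\<integral>x. (f x)\<^sup>2 / r2 x \<partial>\<mu>) \<le> C * (\<integral>x. (f x)\<^sup>2 + (norm (sphere_grad f x))\<^sup>2 \<partial>\<mu>)"
proof -
  define \<sigma> where "\<sigma> = - (k - 2) / 2"
  define a where "a = ((k - 2) / 2)\<^sup>2"
  define l where "l = \<bar>\<sigma> * (\<sigma> + M)\<bar> + 1"
  have "\<sigma> + k - 2 = (k - 2) / 2" by (simp add: \<sigma>_def field_simps)
  then have "\<sigma> * (\<sigma> + k - 2) = \<sigma> * ((k - 2) / 2)" by (simp only:)
  also have "\<dots> = - a" by (simp add: a_def \<sigma>_def power2_eq_square field_simps)
  finally have a: "a > 0" "\<sigma> * (\<sigma> + k - 2) = - a"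
    using k by (auto simp: a_def)
  have l: "l \<ge> 1" by (simp add: l_def)
  have "(\<integral>x. (f x)\<^sup>2 / r2 x \<partial>\<mu>) \<le> (l / a) * (\<integral>x. (f x)\<^sup>2 + (norm (sphere_grad f x))\<^sup>2 \<partial>\<mu>)"
    if f: "Ck (Suc 0) f" for f
  proof -
    have cont: "continuous_on UNIV f" using Ck_imp_continuous_on f by blast
    have i1: "integrable \<mu> (\<lambda>x. (f x)\<^sup>2)" and i2: "integrable \<mu> (\<lambda>x. (norm (sphere_grad f x))\<^sup>2)"
      by (intro integrable_continuous continuous_intros cont continuous_on_sphere_grad f)+
    have i3: "integrable \<mu> (\<lambda>x. (f x)\<^sup>2 / r2 x)"
      by (intro integrable_mult_inverse_r2 k continuous_intros cont)
    have "0 \<le> (\<integral>x. (norm (sphere_grad f x))\<^sup>2 \<partial>\<mu>) - a * (\<integral>x. (f x)\<^sup>2 / r2 x \<partial>\<mu>) - \<sigma> * (\<sigma> + M) * (\<integral>x. (f x)\<^sup>2 \<partial>\<mu>)"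
      using Picone[OF k f, of \<sigma>] i1 i2 i3 by (simp add: a(2) del: times_divide_eq_right)
    moreover have "- (\<sigma> * (\<sigma> + M) * (\<integral>x. (f x)\<^sup>2 \<partial>\<mu>)) \<le> l * (\<integral>x. (f x)\<^sup>2 \<partial>\<mu>)"
      unfolding minus_mult_left by (intro mult_right_mono) (auto simp: l_def)
    moreover have "1 * (\<integral>x. (norm (sphere_grad f x))\<^sup>2 \<partial>\<mu>) \<le> l * (\<integral>x. (norm (sphere_grad f x))\<^sup>2 \<partial>\<mu>)"
      using l by (intro mult_right_mono) auto
    ultimately have "a * (\<integral>x. (f x)\<^sup>2 / r2 x \<partial>\<mu>) \<le> l * (\<integral>x. (f x)\<^sup>2 + (norm (sphere_grad f x))\<^sup>2 \<partial>\<mu>)"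
      unfolding Bochner_Integration.integral_add[OF i1 i2] distrib_left[of l] by linarith
    then show ?thesis using a by (simp add: pos_le_divide_eq mult.commute)
  qed
  moreover have "0 \<le> l / a" using a l by simp
  ultimately show ?thesis by (intro exI[of _ "l / a"]) simp
qed

text \<open>Passing to the limit in the regularized weight \<open>1 / (r2 + \<epsilon>)\<close>, which is bounded, avoids
  having to extract an almost everywhere convergent subsequence.\<close>

lemma Hardy_limit:
  assumes C: "0 \<le> C"
    "\<And>f. Ck (Suc 0) f \<Longrightarrow> (\<integral>x. (f x)\<^sup>2 / r2 x \<partial>\<mu>) \<le> C * (\<integral>x. (f x)\<^sup>2 + (norm (sphere_grad f x))\<^sup>2 \<partial>\<mu>)"
    and k: "k > 2"
    and [measurable]: "Z \<in> borel_measurable borel" "G \<in> borel_measurable borel"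
    and \<phi>: "\<And>n. Ck (Suc 0) (\<phi> n)"
    and lim: "(\<lambda>n. \<integral>\<^sup>+x. ennreal ((Z x - \<phi> n x)\<^sup>2 + (norm (G x - sphere_grad (\<phi> n) x))\<^sup>2) \<partial>\<mu>) \<longlonglongrightarrow> 0"
  shows "(\<integral>\<^sup>+x. ennreal ((Z x)\<^sup>2 / r2 x) \<partial>\<mu>) \<le> ennreal (4 * C) * (\<integral>\<^sup>+x. ennreal ((Z x)\<^sup>2 + (norm (G x))\<^sup>2) \<partial>\<mu>)"
proof (rule nn_integral_le_of_tendsto)
  let ?R = "\<integral>\<^sup>+x. ennreal ((Z x)\<^sup>2 + (norm (G x))\<^sup>2) \<partial>\<mu>"
  let ?e = "\<lambda>n. \<integral>\<^sup>+x. ennreal ((Z x - \<phi> n x)\<^sup>2 + (norm (G x - sphere_grad (\<phi> n) x))\<^sup>2) \<partial>\<mu>"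
  have [measurable]: "\<phi> n \<in> borel_measurable borel" "sphere_grad (\<phi> n) \<in> borel_measurable borel" for n
    using \<phi> measurable_Ck measurable_sphere_grad by auto
  show "AE x in \<mu>. (\<lambda>m. ennreal ((Z x)\<^sup>2 / (r2 x + inverse (real (Suc m))))) \<longlonglongrightarrow> ennreal ((Z x)\<^sup>2 / r2 x)"
    using AE_r2_pos
  proof eventually_elim
    case (elim x)
    have "(\<lambda>m. (Z x)\<^sup>2 / (r2 x + inverse (real (Suc m)))) \<longlonglongrightarrow> (Z x)\<^sup>2 / (r2 x + 0)"
      using elim by (intro tendsto_intros LIMSEQ_inverse_real_of_nat) auto
    then show ?case by (intro tendsto_ennrealI) simp
  qed
  fix m
  define \<epsilon> where "\<epsilon> = inverse (real (Suc m))"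
  have e: "\<epsilon> > 0" by (simp add: \<epsilon>_def)
  \<comment> \<open>Write Z as (Z - \<phi>) + \<phi>. The first part costs a factor 2 / \<epsilon>
    times the error, the second falls under Hardy for smooth functions, whose right-hand side is
    then compared back with that of Z.\<close>
  have bound: "(\<integral>\<^sup>+x. ennreal ((Z x)\<^sup>2 / (r2 x + \<epsilon>)) \<partial>\<mu>) \<le> ennreal (2 / \<epsilon>) * ?e n + ennreal (2 * C) * (2 * ?e n + 2 * ?R)" for n
  proof -
    let ?f = "\<phi> n"
    have cont: "continuous_on UNIV ?f" using Ck_imp_continuous_on \<phi> by blast
    have i1: "integrable \<mu> (\<lambda>x. (?f x)\<^sup>2 + (norm (sphere_grad ?f x))\<^sup>2)"
      by (intro integrable_continuous continuous_intros cont continuous_on_sphere_grad \<phi>)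
    have i3: "integrable \<mu> (\<lambda>x. (?f x)\<^sup>2 / r2 x)"
      by (intro integrable_mult_inverse_r2 k continuous_intros cont)
    have "(\<integral>\<^sup>+x. ennreal ((Z x)\<^sup>2 / (r2 x + \<epsilon>)) \<partial>\<mu>) \<le>
       (\<integral>\<^sup>+x. ennreal (2 / \<epsilon>) * ennreal ((Z x - ?f x)\<^sup>2 + (norm (G x - sphere_grad ?f x))\<^sup>2) + 2 * ennreal ((?f x)\<^sup>2 / r2 x) \<partial>\<mu>)"
    proof (rule nn_integral_mono_AE)
      show "AE x in \<mu>. ennreal ((Z x)\<^sup>2 / (r2 x + \<epsilon>)) \<le>
        ennreal (2 / \<epsilon>) * ennreal ((Z x - ?f x)\<^sup>2 + (norm (G x - sphere_grad ?f x))\<^sup>2) + 2 * ennreal ((?f x)\<^sup>2 / r2 x)"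
        using AE_r2_pos
      proof eventually_elim
        case (elim x)
        have "(Z x)\<^sup>2 / (r2 x + \<epsilon>) \<le> (2 * (Z x - ?f x)\<^sup>2 + 2 * (?f x)\<^sup>2) / (r2 x + \<epsilon>)"
          using norm_power2_le_diff[of "Z x" "?f x"] elim e by (intro divide_right_mono) auto
        also have "\<dots> = 2 * (Z x - ?f x)\<^sup>2 / (r2 x + \<epsilon>) + 2 * (?f x)\<^sup>2 / (r2 x + \<epsilon>)"
          by (simp add: add_divide_distrib)
        also have "\<dots> \<le> 2 * ((Z x - ?f x)\<^sup>2 + (norm (G x - sphere_grad ?f x))\<^sup>2) / \<epsilon> + 2 * (?f x)\<^sup>2 / r2 x"
          using elim e by (intro add_mono frac_le) auto
        finally have "ennreal ((Z x)\<^sup>2 / (r2 x + \<epsilon>)) \<le>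
          ennreal ((2 / \<epsilon>) * ((Z x - ?f x)\<^sup>2 + (norm (G x - sphere_grad ?f x))\<^sup>2) + 2 * ((?f x)\<^sup>2 / r2 x))"
          by (intro ennreal_leI) simp
        also have "\<dots> = ennreal (2 / \<epsilon>) * ennreal ((Z x - ?f x)\<^sup>2 + (norm (G x - sphere_grad ?f x))\<^sup>2) + 2 * ennreal ((?f x)\<^sup>2 / r2 x)"
          using e elim by (simp add: ennreal_plus ennreal_mult del: ennreal_plus[symmetric] times_divide_eq_left times_divide_eq_right)
        finally show ?case .
      qed
    qed
    also have "\<dots> = ennreal (2 / \<epsilon>) * ?e n + 2 * (\<integral>\<^sup>+x. ennreal ((?f x)\<^sup>2 / r2 x) \<partial>\<mu>)"
      by (rule nn_integral_linear_combination) measurable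
    finally have S1: "(\<integral>\<^sup>+x. ennreal ((Z x)\<^sup>2 / (r2 x + \<epsilon>)) \<partial>\<mu>) \<le> \<dots>" .
    have "(\<integral>\<^sup>+x. ennreal ((?f x)\<^sup>2 / r2 x) \<partial>\<mu>) = ennreal (\<integral>x. (?f x)\<^sup>2 / r2 x \<partial>\<mu>)"
      by (rule nn_integral_eq_integral[OF i3]) simp
    also have "\<dots> \<le> ennreal (C * (\<integral>x. (?f x)\<^sup>2 + (norm (sphere_grad ?f x))\<^sup>2 \<partial>\<mu>))"
      by (intro ennreal_leI C \<phi>)
    also have "\<dots> = ennreal C * (\<integral>\<^sup>+x. ennreal ((?f x)\<^sup>2 + (norm (sphere_grad ?f x))\<^sup>2) \<partial>\<mu>)"
      by (subst nn_integral_eq_integral[OF i1]) (simp_all add: ennreal_mult C(1))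
    finally have S2: "(\<integral>\<^sup>+x. ennreal ((?f x)\<^sup>2 / r2 x) \<partial>\<mu>) \<le> \<dots>" .
    have "(\<integral>\<^sup>+x. ennreal ((?f x)\<^sup>2 + (norm (sphere_grad ?f x))\<^sup>2) \<partial>\<mu>) \<le> 
      (\<integral>\<^sup>+x. 2 * ennreal ((Z x - ?f x)\<^sup>2 + (norm (G x - sphere_grad ?f x))\<^sup>2) + 2 * ennreal ((Z x)\<^sup>2 + (norm (G x))\<^sup>2) \<partial>\<mu>)"
    proof (rule nn_integral_mono)
      fix x
      have "(?f x)\<^sup>2 + (norm (sphere_grad ?f x))\<^sup>2 \<le> 2 * ((Z x - ?f x)\<^sup>2 + (norm (G x - sphere_grad ?f x))\<^sup>2) + 2 * ((Z x)\<^sup>2 + (norm (G x))\<^sup>2)"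
        using norm_power2_le_diff[of "?f x" "Z x"] norm_power2_le_diff[of "sphere_grad ?f x" "G x"]
        by (simp add: norm_minus_commute power2_commute)
      then have "ennreal ((?f x)\<^sup>2 + (norm (sphere_grad ?f x))\<^sup>2) \<le> ennreal (2 * ((Z x - ?f x)\<^sup>2 + (norm (G x - sphere_grad ?f x))\<^sup>2) + 2 * ((Z x)\<^sup>2 + (norm (G x))\<^sup>2))"
        by (rule ennreal_leI)
      also have "\<dots> = 2 * ennreal ((Z x - ?f x)\<^sup>2 + (norm (G x - sphere_grad ?f x))\<^sup>2) + 2 * ennreal ((Z x)\<^sup>2 + (norm (G x))\<^sup>2)"
        by (subst ennreal_plus) (auto simp: ennreal_mult)
      finally show "ennreal ((?f x)\<^sup>2 + (norm (sphere_grad ?f x))\<^sup>2) \<le> \<dots>" .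
    qed
    also have "\<dots> = 2 * ?e n + 2 * ?R"
      by (rule nn_integral_linear_combination) measurable
    finally have S3: "ennreal C * (\<integral>\<^sup>+x. ennreal ((?f x)\<^sup>2 + (norm (sphere_grad ?f x))\<^sup>2) \<partial>\<mu>) \<le> ennreal C * (2 * ?e n + 2 * ?R)"
      by (rule mult_left_mono) simp
    have "2 * (\<integral>\<^sup>+x. ennreal ((?f x)\<^sup>2 / r2 x) \<partial>\<mu>) \<le> 2 * (ennreal C * (2 * ?e n + 2 * ?R))"
      by (rule mult_left_mono[OF order_trans[OF S2 S3]]) simp
    also have "\<dots> = ennreal (2 * C) * (2 * ?e n + 2 * ?R)"
      using C(1) by (simp add: ennreal_mult mult.assoc)
    finally show ?thesis
      by (intro order_trans[OF S1] add_left_mono)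
  qed
  \<comment> \<open>Now n tends to infinity with \<epsilon> fixed: the factor 2 / \<epsilon>
    multiplies a null sequence, and the surviving constant 4 C does not involve \<epsilon>.\<close>
  have "(\<lambda>n. ennreal (2 / \<epsilon>) * ?e n + ennreal (2 * C) * (2 * ?e n + 2 * ?R)) \<longlonglongrightarrow>
      ennreal (2 / \<epsilon>) * 0 + ennreal (2 * C) * (2 * 0 + 2 * ?R)"
    by (intro tendsto_add ennreal_tendsto_cmult tendsto_const lim) auto
  then have "(\<integral>\<^sup>+x. ennreal ((Z x)\<^sup>2 / (r2 x + \<epsilon>)) \<partial>\<mu>) \<le> ennreal (2 / \<epsilon>) * 0 + ennreal (2 * C) * (2 * 0 + 2 * ?R)"
    by (rule LIMSEQ_le_const) (use bound in auto)
  also have "\<dots> = ennreal (4 * C) * ?R"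
  proof -
    have "ennreal (2 * C) * 2 = ennreal (2 * C) * ennreal 2" by simp
    also have "\<dots> = ennreal (2 * C * 2)" using C(1) by (intro ennreal_mult[symmetric]) auto
    finally have "ennreal (2 * C) * 2 = ennreal (4 * C)" by (simp add: mult.commute)
    then show ?thesis by (simp add: mult.assoc[symmetric])
  qed
  finally show "(\<integral>\<^sup>+x. ennreal ((Z x)\<^sup>2 / (r2 x + inverse (real (Suc m)))) \<partial>\<mu>) \<le> ennreal (4 * C) * ?R"
    by (simp only: \<epsilon>_def)
qed measurable

text \<open>Every term of the weak equation is an inner product of such limits, so relations between
  smooth functions extend to \<open>sphere_H1\<close>. Convergence of the quotients by rho is
  Hardy's inequality for differences.\<close>

lemma sphere_H1_L2_conv:
  assumes k: "k > 2" and ZG: "(Z, G) \<in> sphere_H1 \<mu>"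
  obtains \<phi> where "\<forall>n. smooth (\<phi> n)" "L2_conv \<mu> \<phi> Z" "L2_conv \<mu> (\<lambda>n. sphere_grad (\<phi> n)) G"
    "L2_conv \<mu> (\<lambda>n x. \<phi> n x / sqrt (r2 x)) (\<lambda>x. Z x / sqrt (r2 x))"
proof -
  note H = ZG[unfolded sphere_H1_def mem_Collect_eq prod.case borel_measurable_mu]
  have [measurable]: "Z \<in> borel_measurable borel" "G \<in> borel_measurable borel"
    using H[THEN conjunct1] H[THEN conjunct2, THEN conjunct1] .
  from H[THEN conjunct2, THEN conjunct2] obtain \<phi> where \<phi>: "(\<forall>n. smooth (\<phi> n)) \<and>
    (\<lambda>n. \<integral>\<^sup>+x. ennreal ((Z x - \<phi> n x)\<^sup>2 + (norm (G x - sphere_grad (\<phi> n) x))\<^sup>2) \<partial>\<mu>) \<longlonglongrightarrow> 0"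
    by (rule exE)
  note sm = \<phi>[THEN conjunct1] and lim = \<phi>[THEN conjunct2]
  let ?e = "\<lambda>n. \<integral>\<^sup>+x. ennreal ((Z x - \<phi> n x)\<^sup>2 + (norm (G x - sphere_grad (\<phi> n) x))\<^sup>2) \<partial>\<mu>"
  have C1: "Ck (Suc 0) (\<phi> n)" for n using sm by (simp add: smooth_Ck)
  have cont: "continuous_on UNIV (\<phi> n)" for n using C1 Ck_imp_continuous_on by blast
  have [measurable]: "\<phi> n \<in> borel_measurable borel" "sphere_grad (\<phi> n) \<in> borel_measurable borel" for n
    using C1 measurable_Ck measurable_sphere_grad by auto
  have squeeze: "g \<longlonglongrightarrow> 0" if "\<And>n. g n \<le> ennreal c * ?e n" for g :: "nat \<Rightarrow> ennreal" and c
  proof (rule tendsto_sandwich[OF _ _ tendsto_const])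
    show "(\<lambda>n. ennreal c * ?e n) \<longlonglongrightarrow> 0"
      using ennreal_tendsto_cmult[OF _ lim, of "ennreal c"] by simp
    show "\<forall>\<^sub>F n in sequentially. g n \<le> ennreal c * ?e n" using that by (intro always_eventually allI)
  qed simp
  have 1: "L2_conv \<mu> \<phi> Z"
  proof (rule L2_convI)
    show "integrable \<mu> (\<lambda>x. (norm (\<phi> n x))\<^sup>2)" for n
      by (intro integrable_continuous continuous_intros cont)
    show "(\<lambda>n. \<integral>\<^sup>+x. ennreal ((norm (Z x - \<phi> n x))\<^sup>2) \<partial>\<mu>) \<longlonglongrightarrow> 0"
      by (rule squeeze[of _ 1], unfold ennreal_1 mult_1, intro nn_integral_mono ennreal_leI) simp
  qed auto
  have 2: "L2_conv \<mu> (\<lambda>n. sphere_grad (\<phi> n)) G"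
  proof (rule L2_convI)
    show "integrable \<mu> (\<lambda>x. (norm (sphere_grad (\<phi> n) x))\<^sup>2)" for n
      by (intro integrable_continuous continuous_intros continuous_on_sphere_grad C1)
    show "(\<lambda>n. \<integral>\<^sup>+x. ennreal ((norm (G x - sphere_grad (\<phi> n) x))\<^sup>2) \<partial>\<mu>) \<longlonglongrightarrow> 0"
      by (rule squeeze[of _ 1], unfold ennreal_1 mult_1, intro nn_integral_mono ennreal_leI) simp
  qed auto
  have 3: "L2_conv \<mu> (\<lambda>n x. \<phi> n x / sqrt (r2 x)) (\<lambda>x. Z x / sqrt (r2 x))"
  proof (rule L2_convI)
    have "(norm (y / sqrt (r2 x)))\<^sup>2 = y\<^sup>2 / r2 x" for x y
      by (simp add: power_divide)
    note sq = this
    have "integrable \<mu> (\<lambda>x. (\<phi> n x)\<^sup>2 / r2 x)" for n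
      by (intro integrable_mult_inverse_r2 k continuous_intros cont)
    then show "integrable \<mu> (\<lambda>x. (norm (\<phi> n x / sqrt (r2 x)))\<^sup>2)" for n
      by (simp only: sq)
    obtain C where C: "0 \<le> C" "\<forall>f. Ck (Suc 0) f \<longrightarrow>
      (\<integral>x. (f x)\<^sup>2 / r2 x \<partial>\<mu>) \<le> C * (\<integral>x. (f x)\<^sup>2 + (norm (sphere_grad f x))\<^sup>2 \<partial>\<mu>)"
      using Hardy[OF k] by blast
    have cancel: "a - b - (c - b) = a - c" "u - v - (w - v) = u - w" for a b c :: real and u v w :: 'a
      by simp_all
    \<comment> \<open>With n fixed, \<open>\<phi> m - \<phi> n\<close> approximates
      \<open>Z - \<phi> n\<close> as m tends to infinity, so the quotient error at n is bounded by
      the error \<open>?e n\<close>.\<close>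
    have "(\<integral>\<^sup>+x. ennreal ((Z x - \<phi> n x)\<^sup>2 / r2 x) \<partial>\<mu>) \<le> ennreal (4 * C) * ?e n" for n
    proof (rule Hardy_limit[OF C(1) C(2)[rule_format] k, where \<phi> = "\<lambda>m x. \<phi> m x - \<phi> n x" and G = "\<lambda>x. G x - sphere_grad (\<phi> n) x"])
      have "Ck (Suc 0) (\<lambda>x. \<phi> m x + (- 1) * \<phi> n x)" for m
        by (intro Ck_add Ck_mult Ck_const C1)
      then show "Ck (Suc 0) (\<lambda>x. \<phi> m x - \<phi> n x)" for m by simp
      show "(\<lambda>m. \<integral>\<^sup>+x. ennreal ((Z x - \<phi> n x - (\<phi> m x - \<phi> n x))\<^sup>2 +
        (norm (G x - sphere_grad (\<phi> n) x - sphere_grad (\<lambda>x. \<phi> m x - \<phi> n x) x))\<^sup>2) \<partial>\<mu>) \<longlonglongrightarrow> 0"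
        unfolding sphere_grad_diff[OF C1 C1] cancel by (rule lim)
    qed measurable
    then show "(\<lambda>n. \<integral>\<^sup>+x. ennreal ((norm (Z x / sqrt (r2 x) - \<phi> n x / sqrt (r2 x)))\<^sup>2) \<partial>\<mu>) \<longlonglongrightarrow> 0"
      unfolding diff_divide_distrib[symmetric] sq by (rule squeeze)
  qed auto
  show thesis using that[OF sm 1 2 3] .
qed

end

section \<open>The first eigenvalue\<close>

text \<open>The hypothesis \<open>b \<le> a + c\<close> is what \<open>powr_shift_le\<close>
  provides; the two cases avoid a cross term, so the majorant stays a sum of a power and a
  constant.\<close>

lemma square_diff_le:
  fixes a b c :: real
  assumes "0 \<le> a" "0 \<le> b" "b \<le> a + c" "0 \<le> c"
  shows "(a - b)\<^sup>2 \<le> a\<^sup>2 + c\<^sup>2"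
proof (cases "b \<le> a")
  case True
  then have "(a - b)\<^sup>2 \<le> a\<^sup>2" using assms by (intro power_mono) auto
  then show ?thesis by (simp add: add_increasing2)
next
  case False
  then have "(b - a)\<^sup>2 \<le> c\<^sup>2" using assms by (intro power_mono) auto
  then show ?thesis by (simp add: add_increasing power2_commute)
qed

context sphere_ibp
begin

text \<open>Distributes the singularity over two factors 1 / rho, which makes the potential term an
  L2 inner product. At rho = 0 both sides are 0 by the convention for division.\<close>

lemma form_pointwise: "\<alpha> / r2 x * z * y = \<alpha> * ((z / sqrt (r2 x)) \<bullet> (y / sqrt (r2 x)))"
  using real_sqrt_mult_self[of "r2 x"] by (simp add: inner_real_def divide_simps)

text \<open>The relation between \<alpha> and \<sigma> turns the middle coefficient of
  \<open>Picone\<close> into -\<alpha>. All three terms are L2 inner products, hence continuous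
  along the approximating sequence.\<close>

lemma Picone_H1:
  assumes k: "k > 2" and ZG: "(Z, G) \<in> sphere_H1 \<mu>" and \<alpha>: "\<alpha> = - (\<sigma> * (\<sigma> + k - 2))"
  shows "\<sigma> * (\<sigma> + M) * (\<integral>x. Z x * Z x \<partial>\<mu>) \<le> (\<integral>x. G x \<bullet> G x - \<alpha> / r2 x * Z x * Z x \<partial>\<mu>)"
proof -
  obtain \<phi> where sm: "\<forall>n. smooth (\<phi> n)" and conv: "L2_conv \<mu> \<phi> Z" "L2_conv \<mu> (\<lambda>n. sphere_grad (\<phi> n)) G"
    "L2_conv \<mu> (\<lambda>n x. \<phi> n x / sqrt (r2 x)) (\<lambda>x. Z x / sqrt (r2 x))"
    by (rule sphere_H1_L2_conv[OF k ZG])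
  have C1: "Ck (Suc 0) (\<phi> n)" for n using sm by (simp add: smooth_Ck)
  have cont: "continuous_on UNIV (\<phi> n)" for n using C1 by (rule Ck_imp_continuous_on)
  let ?g = "\<lambda>n. \<integral>x. sphere_grad (\<phi> n) x \<bullet> sphere_grad (\<phi> n) x \<partial>\<mu>"
  let ?w = "\<lambda>n. \<integral>x. (\<phi> n x / sqrt (r2 x)) \<bullet> (\<phi> n x / sqrt (r2 x)) \<partial>\<mu>"
  let ?z = "\<lambda>n. \<integral>x. \<phi> n x \<bullet> \<phi> n x \<partial>\<mu>"
  have lim: "(\<lambda>n. ?g n - \<alpha> * ?w n - \<sigma> * (\<sigma> + M) * ?z n) \<longlonglongrightarrow>
     (\<integral>x. G x \<bullet> G x \<partial>\<mu>) - \<alpha> * (\<integral>x. (Z x / sqrt (r2 x)) \<bullet> (Z x / sqrt (r2 x)) \<partial>\<mu>)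
      - \<sigma> * (\<sigma> + M) * (\<integral>x. Z x \<bullet> Z x \<partial>\<mu>)"
    by (intro tendsto_intros L2_conv_tendsto_inner conv)
  have "0 \<le> ?g n - \<alpha> * ?w n - \<sigma> * (\<sigma> + M) * ?z n" for n
  proof -
    have i1: "integrable \<mu> (\<lambda>x. (norm (sphere_grad (\<phi> n) x))\<^sup>2)" and i2: "integrable \<mu> (\<lambda>x. (\<phi> n x)\<^sup>2)"
      by (intro integrable_continuous continuous_intros cont continuous_on_sphere_grad C1)+
    have i3: "integrable \<mu> (\<lambda>x. (\<phi> n x)\<^sup>2 / r2 x)"
      by (intro integrable_mult_inverse_r2 k continuous_intros cont)
    have "?g n = (\<integral>x. (norm (sphere_grad (\<phi> n) x))\<^sup>2 \<partial>\<mu>)"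
      by (simp only: power2_norm_eq_inner)
    moreover have "?z n = (\<integral>x. (\<phi> n x)\<^sup>2 \<partial>\<mu>)"
      "?w n = (\<integral>x. (\<phi> n x)\<^sup>2 / r2 x \<partial>\<mu>)"
      by (simp_all add: inner_real_def power2_eq_square)
    ultimately show ?thesis
      using Picone[OF k C1[of n], of \<sigma>] i1 i2 i3 by (simp add: \<alpha> del: times_divide_eq_right)
  qed
  then have "0 \<le> (\<integral>x. G x \<bullet> G x \<partial>\<mu>) - \<alpha> * (\<integral>x. (Z x / sqrt (r2 x)) \<bullet> (Z x / sqrt (r2 x)) \<partial>\<mu>)
      - \<sigma> * (\<sigma> + M) * (\<integral>x. Z x \<bullet> Z x \<partial>\<mu>)"
    by (intro LIMSEQ_le_const[OF lim]) simp
  also have "(\<integral>x. G x \<bullet> G x \<partial>\<mu>) - \<alpha> * (\<integral>x. (Z x / sqrt (r2 x)) \<bullet> (Z x / sqrt (r2 x)) \<partial>\<mu>)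
     = (\<integral>x. G x \<bullet> G x - \<alpha> / r2 x * Z x * Z x \<partial>\<mu>)"
    unfolding form_pointwise
    by (simp only: Bochner_Integration.integral_diff integral_mult_right_zero integrable_mult_right
        L2_conv_integrable_inner[OF conv(2) conv(2)] L2_conv_integrable_inner[OF conv(3) conv(3)])
  finally show ?thesis by (simp add: inner_real_def)
qed

section \<open>The power rho^\<sigma> as a weak eigenfunction\<close>

definition eigenfunction :: "real \<Rightarrow> 'a \<Rightarrow> real" where
  "eigenfunction \<sigma> x = r2 x powr (\<sigma> / 2)"
text \<open>Elements of \<open>sphere_H1\<close> are pairs, so the tangential gradient of
  rho^\<sigma> is given explicitly. On the null set rho = 0 both components are 0 because
  \<open>0 powr p = 0\<close>, even for \<sigma> = 0.\<close>

definition eigenfunction_grad :: "real \<Rightarrow> 'a \<Rightarrow> 'a" where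
  "eigenfunction_grad \<sigma> x = (\<sigma> * r2 x powr (\<sigma> / 2 - 1)) *\<^sub>R X x"

text \<open>The smooth approximants are the shifted powers. The squared gradient is of order
  r2^(\<sigma> - 2) |X|^2, at most r2^(\<sigma> - 1), and the hypothesis on \<sigma> is exactly the
  integrability condition for that power.\<close>

lemma eigenfunction_in_H1:
  assumes \<sigma>: "2 * \<sigma> > - (k - 2)"
  shows "(eigenfunction \<sigma>, eigenfunction_grad \<sigma>) \<in> sphere_H1 \<mu>"
proof -
  let ?e = "\<lambda>n. inverse (real (Suc n))"
  define \<phi> where "\<phi> n x = (r2 x + ?e n) powr (\<sigma> / 2)" for n x
  have e: "0 < ?e n" "?e n \<le> 1" for n by (auto simp: inverse_le_1_iff)
  have sm: "smooth (\<phi> n)" for n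
    using Ck_shift[OF e(1)] by (simp add: smooth_def \<phi>_def[abs_def])
  have sg: "sphere_grad (\<phi> n) x = (\<sigma> * (r2 x + ?e n) powr (\<sigma> / 2 - 1)) *\<^sub>R X x" for n x
    unfolding sphere_grad_def \<phi>_def grad_shift[OF e(1)]
    by (simp add: X_def E_inner_self algebra_simps)
  have [measurable]: "eigenfunction \<sigma> \<in> borel_measurable borel" "eigenfunction_grad \<sigma> \<in> borel_measurable borel"
    unfolding eigenfunction_def[abs_def] eigenfunction_grad_def[abs_def] by measurable
  have [measurable]: "\<phi> n \<in> borel_measurable borel" "sphere_grad (\<phi> n) \<in> borel_measurable borel" for n
    using measurable_Ck[OF smooth_Ck[OF sm]] measurable_sphere_grad[OF smooth_Ck[OF sm]] by auto
  let ?u = "\<lambda>n x. (eigenfunction \<sigma> x - \<phi> n x)\<^sup>2 + (norm (eigenfunction_grad \<sigma> x - sphere_grad (\<phi> n) x))\<^sup>2"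
  define c1 c2 where "c1 = 2 powr \<bar>\<sigma> / 2\<bar>" and "c2 = 2 powr \<bar>\<sigma> / 2 - 1\<bar>"
  \<comment> \<open>A majorant of \<open>?u\<close>: the first summand is for the functions, the
    second for the gradients. The constants \<open>c1\<close> and \<open>c2\<close> come from
    \<open>powr_shift_le\<close>.\<close>
  define w where "w x = (r2 x powr \<sigma> + c1\<^sup>2) + \<sigma>\<^sup>2 * (r2 x powr (\<sigma> - 1) + c2\<^sup>2)" for x
  have [measurable]: "w \<in> borel_measurable borel" unfolding w_def[abs_def] by measurable
  have norm_diff: "(norm (eigenfunction_grad \<sigma> x - sphere_grad (\<phi> n) x))\<^sup>2
     = \<sigma>\<^sup>2 * (r2 x powr (\<sigma> / 2 - 1) - (r2 x + ?e n) powr (\<sigma> / 2 - 1))\<^sup>2 * (X x \<bullet> X x)" for n x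
  proof -
    have "eigenfunction_grad \<sigma> x - sphere_grad (\<phi> n) x
      = (\<sigma> * (r2 x powr (\<sigma> / 2 - 1) - (r2 x + ?e n) powr (\<sigma> / 2 - 1))) *\<^sub>R X x"
      unfolding sg eigenfunction_grad_def by (simp add: algebra_simps)
    then show ?thesis
      by (simp add: power_mult_distrib power2_norm_eq_inner[of "X x"] del: of_nat_Suc)
  qed
  have "integrable \<mu> w"
    unfolding w_def using k_pos \<sigma>
    by (intro Bochner_Integration.integrable_add integrable_mult_right integrable_r2_powr) auto
  then have w: "(\<integral>\<^sup>+x. ennreal (w x) \<partial>\<mu>) < \<infinity>"
    by (subst nn_integral_eq_integral) (auto simp: w_def)
  have bound: "AE x in \<mu>. ennreal (?u n x) \<le> ennreal (w x)" for n
    using AE_norm AE_r2_pos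
  proof eventually_elim
    case (elim x)
    have r: "r2 x \<le> 1" using elim r2_le_1 by auto
    have "(eigenfunction \<sigma> x - \<phi> n x)\<^sup>2 \<le> (r2 x powr (\<sigma> / 2))\<^sup>2 + c1\<^sup>2"
      unfolding eigenfunction_def \<phi>_def c1_def
      by (rule square_diff_le) (use powr_shift_le[OF elim(2) r e, where p = "\<sigma> / 2"] in auto)
    also have "(r2 x powr (\<sigma> / 2))\<^sup>2 = r2 x powr \<sigma>"
      by (simp add: power2_eq_square powr_add[symmetric])
    finally have 1: "(eigenfunction \<sigma> x - \<phi> n x)\<^sup>2 \<le> r2 x powr \<sigma> + c1\<^sup>2" .
    have "(r2 x powr (\<sigma> / 2 - 1) - (r2 x + ?e n) powr (\<sigma> / 2 - 1))\<^sup>2 \<le> (r2 x powr (\<sigma> / 2 - 1))\<^sup>2 + c2\<^sup>2"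
      unfolding c2_def
      by (rule square_diff_le) (use powr_shift_le[OF elim(2) r e, where p = "\<sigma> / 2 - 1"] in auto)
    also have "(r2 x powr (\<sigma> / 2 - 1))\<^sup>2 = r2 x powr (\<sigma> - 2)"
      by (simp add: power2_eq_square powr_add[symmetric])
    finally have "(r2 x powr (\<sigma> / 2 - 1) - (r2 x + ?e n) powr (\<sigma> / 2 - 1))\<^sup>2 * (X x \<bullet> X x) \<le> (r2 x powr (\<sigma> - 2) + c2\<^sup>2) * r2 x"
      by (rule mult_mono) (use elim r in \<open>auto simp: X_inner_X mult_left_le\<close>)
    also have "\<dots> = r2 x powr (\<sigma> - 1) + c2\<^sup>2 * r2 x"
    proof -
      have "r2 x powr (\<sigma> - 2) * r2 x = r2 x powr ((\<sigma> - 2) + 1)"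
        using elim by (simp only: powr_add powr_one)
      then show ?thesis by (simp add: distrib_right)
    qed
    also have "\<dots> \<le> r2 x powr (\<sigma> - 1) + c2\<^sup>2" using r by (simp add: mult_left_le)
    finally have "\<sigma>\<^sup>2 * ((r2 x powr (\<sigma> / 2 - 1) - (r2 x + ?e n) powr (\<sigma> / 2 - 1))\<^sup>2 * (X x \<bullet> X x))
       \<le> \<sigma>\<^sup>2 * (r2 x powr (\<sigma> - 1) + c2\<^sup>2)"
      by (rule mult_left_mono) simp
    then show ?case
      using 1 unfolding norm_diff w_def mult.assoc by (intro ennreal_leI add_mono)
  qed
  have lim: "AE x in \<mu>. (\<lambda>n. ennreal (?u n x)) \<longlonglongrightarrow> 0"
    using AE_r2_pos
  proof eventually_elim
    case (elim x)
    have "(\<lambda>n. ?u n x) \<longlonglongrightarrow> (eigenfunction \<sigma> x - r2 x powr (\<sigma> / 2))\<^sup>2 +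
       \<sigma>\<^sup>2 * (r2 x powr (\<sigma> / 2 - 1) - r2 x powr (\<sigma> / 2 - 1))\<^sup>2 * (X x \<bullet> X x)"
      unfolding norm_diff \<phi>_def by (intro tendsto_intros tendsto_shift elim)
    then have "(\<lambda>n. ?u n x) \<longlonglongrightarrow> 0" by (simp add: eigenfunction_def)
    from tendsto_ennrealI[OF this] show ?case by simp
  qed
  have "(\<lambda>n. \<integral>\<^sup>+x. ennreal (?u n x) \<partial>\<mu>) \<longlonglongrightarrow> (\<integral>\<^sup>+x. 0 \<partial>\<mu>)"
    by (rule nn_integral_dominated_convergence[OF _ _ _ bound w lim]) measurable
  then have "(\<lambda>n. \<integral>\<^sup>+x. ennreal (?u n x) \<partial>\<mu>) \<longlonglongrightarrow> 0"
    by (simp only: nn_integral_const mult_zero_left)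
  with sm have "\<exists>\<phi>. (\<forall>n. smooth (\<phi> n)) \<and> (\<lambda>n. \<integral>\<^sup>+x. ennreal ((eigenfunction \<sigma> x - \<phi> n x)\<^sup>2
      + (norm (eigenfunction_grad \<sigma> x - sphere_grad (\<phi> n) x))\<^sup>2) \<partial>\<mu>) \<longlonglongrightarrow> 0"
    by (intro exI[of _ \<phi>] conjI allI)
  moreover have "eigenfunction \<sigma> \<in> borel_measurable \<mu>" "eigenfunction_grad \<sigma> \<in> borel_measurable \<mu>"
    by measurable
  ultimately show ?thesis
    unfolding sphere_H1_def mem_Collect_eq prod.case by (intro conjI)
qed

text \<open>For p = \<sigma> / 2 - 1 the field \<sigma> r2^p X is the tangential gradient of
  rho^\<sigma>, so \<sigma> times the identity \<open>r2_divergence\<close> is the weak equation.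
  Its zero order part splits into -\<alpha> r2^p and -\<sigma> (\<sigma> + M) rho^\<sigma>.\<close>

lemma eigenfunction_weak_smooth:
  assumes k: "k > 2" and \<sigma>: "2 * \<sigma> > - (k - 2)" and f: "Ck (Suc 0) f" and \<alpha>: "\<alpha> = - (\<sigma> * (\<sigma> + k - 2))"
    and int: "integrable \<mu> (\<lambda>x. eigenfunction_grad \<sigma> x \<bullet> sphere_grad f x)"
      "integrable \<mu> (\<lambda>x. (eigenfunction \<sigma> x / sqrt (r2 x)) \<bullet> (f x / sqrt (r2 x)))"
      "integrable \<mu> (\<lambda>x. eigenfunction \<sigma> x \<bullet> f x)"
  shows "(\<integral>x. eigenfunction_grad \<sigma> x \<bullet> sphere_grad f x \<partial>\<mu>)
    - \<alpha> * (\<integral>x. (eigenfunction \<sigma> x / sqrt (r2 x)) \<bullet> (f x / sqrt (r2 x)) \<partial>\<mu>)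
    - \<sigma> * (\<sigma> + M) * (\<integral>x. eigenfunction \<sigma> x \<bullet> f x \<partial>\<mu>) = 0"
proof -
  define p where "p = \<sigma> / 2 - 1"
  let ?J = "\<lambda>x. r2 x powr p * (X x \<bullet> grad f x + (2 * p * (1 - r2 x) + k - (M + 2) * r2 x) * f x)"
  have "2 * (\<sigma> / 2 - 1) > - c" if "2 * \<sigma> > - (c - 2)" "c > 2" for c
    using that by (simp add: field_simps)
  from this[OF \<sigma> k] have p: "2 * p > - k" unfolding p_def .
  have "(\<integral>x. eigenfunction_grad \<sigma> x \<bullet> sphere_grad f x \<partial>\<mu>)
    - \<alpha> * (\<integral>x. (eigenfunction \<sigma> x / sqrt (r2 x)) \<bullet> (f x / sqrt (r2 x)) \<partial>\<mu>)
    - \<sigma> * (\<sigma> + M) * (\<integral>x. eigenfunction \<sigma> x \<bullet> f x \<partial>\<mu>)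
   = (\<integral>x. eigenfunction_grad \<sigma> x \<bullet> sphere_grad f x
    - \<alpha> * ((eigenfunction \<sigma> x / sqrt (r2 x)) \<bullet> (f x / sqrt (r2 x)))
    - \<sigma> * (\<sigma> + M) * (eigenfunction \<sigma> x \<bullet> f x) \<partial>\<mu>)"
    using int
    by (simp only: Bochner_Integration.integral_diff integral_mult_right_zero integrable_mult_right
        Bochner_Integration.integrable_diff)
  also have "\<dots> = (\<integral>x. \<sigma> * ?J x \<partial>\<mu>)"
  proof (rule integral_cong_AE)
    show "AE x in \<mu>. eigenfunction_grad \<sigma> x \<bullet> sphere_grad f x
      - \<alpha> * ((eigenfunction \<sigma> x / sqrt (r2 x)) \<bullet> (f x / sqrt (r2 x)))
      - \<sigma> * (\<sigma> + M) * (eigenfunction \<sigma> x \<bullet> f x) = \<sigma> * ?J x"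
      using AE_norm AE_r2_pos
    proof eventually_elim
      case (elim x)
      have "r2 x powr (p + 1) = r2 x powr p * r2 x" using elim by (simp only: powr_add powr_one)
      then have ef: "eigenfunction \<sigma> x = r2 x powr p * r2 x" by (simp add: eigenfunction_def p_def)
      have 1: "eigenfunction_grad \<sigma> x \<bullet> sphere_grad f x = \<sigma> * r2 x powr p * (X x \<bullet> grad f x)"
        unfolding eigenfunction_grad_def p_def[symmetric]
        using sphere_grad_inner_X[OF elim(1), of f] by (simp add: inner_commute)
      have 2: "(eigenfunction \<sigma> x / sqrt (r2 x)) \<bullet> (f x / sqrt (r2 x)) = r2 x powr p * f x"
        using form_pointwise[of 1 x "eigenfunction \<sigma> x" "f x"] elim by (simp add: ef)
      have 3: "\<sigma> = 2 * p + 2" by (simp add: p_def)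
      show ?case
        unfolding 1 2 inner_real_def ef \<alpha> unfolding 3 by (simp add: algebra_simps)
    qed
    show "(\<lambda>x. eigenfunction_grad \<sigma> x \<bullet> sphere_grad f x
      - \<alpha> * ((eigenfunction \<sigma> x / sqrt (r2 x)) \<bullet> (f x / sqrt (r2 x)))
      - \<sigma> * (\<sigma> + M) * (eigenfunction \<sigma> x \<bullet> f x)) \<in> borel_measurable \<mu>"
      by (intro borel_measurable_integrable Bochner_Integration.integrable_diff integrable_mult_right int)
    show "(\<lambda>x. \<sigma> * ?J x) \<in> borel_measurable \<mu>"
      by (intro borel_measurable_integrable integrable_mult_right r2_divergence(1) p f)
  qed
  also have "\<dots> = 0" using r2_divergence(2)[OF p f] by simp
  finally show ?thesis .
qed

text \<open>Only the test pair is approximated. The eigenfunction enters as a constant sequence, for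
  which square integrability of it, its gradient and its quotient by rho is enough.\<close>

lemma eigenfunction_weak:
  assumes k: "k > 2" and \<sigma>: "2 * \<sigma> > - (k - 2)" and \<alpha>: "\<alpha> = - (\<sigma> * (\<sigma> + k - 2))"
    and \<Psi>: "(\<Psi>, P) \<in> sphere_H1 \<mu>"
  shows "(\<integral>x. eigenfunction_grad \<sigma> x \<bullet> P x - \<alpha> / r2 x * eigenfunction \<sigma> x * \<Psi> x \<partial>\<mu>)
    = \<sigma> * (\<sigma> + M) * (\<integral>x. eigenfunction \<sigma> x * \<Psi> x \<partial>\<mu>)"
proof -
  obtain \<phi> where "\<forall>n. smooth (\<phi> n)" and z: "L2_conv \<mu> \<phi> (eigenfunction \<sigma>)"
    "L2_conv \<mu> (\<lambda>n. sphere_grad (\<phi> n)) (eigenfunction_grad \<sigma>)"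
    "L2_conv \<mu> (\<lambda>n x. \<phi> n x / sqrt (r2 x)) (\<lambda>x. eigenfunction \<sigma> x / sqrt (r2 x))"
    by (rule sphere_H1_L2_conv[OF k eigenfunction_in_H1[OF \<sigma>]])
  obtain \<psi> where sm: "\<forall>n. smooth (\<psi> n)" and p: "L2_conv \<mu> \<psi> \<Psi>"
    "L2_conv \<mu> (\<lambda>n. sphere_grad (\<psi> n)) P"
    "L2_conv \<mu> (\<lambda>n x. \<psi> n x / sqrt (r2 x)) (\<lambda>x. \<Psi> x / sqrt (r2 x))"
    by (rule sphere_H1_L2_conv[OF k \<Psi>])
  have C1: "Ck (Suc 0) (\<psi> n)" for n using sm by (simp add: smooth_Ck)
  let ?Z = "eigenfunction \<sigma>" and ?G = "eigenfunction_grad \<sigma>"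
  let ?a = "\<lambda>n. (\<integral>x. ?G x \<bullet> sphere_grad (\<psi> n) x \<partial>\<mu>)
      - \<alpha> * (\<integral>x. (?Z x / sqrt (r2 x)) \<bullet> (\<psi> n x / sqrt (r2 x)) \<partial>\<mu>) - \<sigma> * (\<sigma> + M) * (\<integral>x. ?Z x \<bullet> \<psi> n x \<partial>\<mu>)"
  have "?a \<longlonglongrightarrow> (\<integral>x. ?G x \<bullet> P x \<partial>\<mu>)
     - \<alpha> * (\<integral>x. (?Z x / sqrt (r2 x)) \<bullet> (\<Psi> x / sqrt (r2 x)) \<partial>\<mu>) - \<sigma> * (\<sigma> + M) * (\<integral>x. ?Z x \<bullet> \<Psi> x \<partial>\<mu>)"
    by (intro tendsto_intros L2_conv_tendsto_inner p z[THEN L2_conv_const])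
  moreover have "?a n = 0" for n
    by (intro eigenfunction_weak_smooth[OF k \<sigma> C1 \<alpha>] integrable_inner_L2)
      (use z p in \<open>auto simp: L2_conv_def\<close>)
  ultimately have "(\<integral>x. ?G x \<bullet> P x \<partial>\<mu>)
     - \<alpha> * (\<integral>x. (?Z x / sqrt (r2 x)) \<bullet> (\<Psi> x / sqrt (r2 x)) \<partial>\<mu>) - \<sigma> * (\<sigma> + M) * (\<integral>x. ?Z x \<bullet> \<Psi> x \<partial>\<mu>) = 0"
    by (simp add: LIMSEQ_const_iff)
  moreover have "(\<integral>x. ?G x \<bullet> P x \<partial>\<mu>) - \<alpha> * (\<integral>x. (?Z x / sqrt (r2 x)) \<bullet> (\<Psi> x / sqrt (r2 x)) \<partial>\<mu>)
     = (\<integral>x. ?G x \<bullet> P x - \<alpha> / r2 x * ?Z x * \<Psi> x \<partial>\<mu>)"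
    unfolding form_pointwise
    by (simp only: Bochner_Integration.integral_diff integral_mult_right_zero integrable_mult_right
        L2_conv_integrable_inner[OF z(2) p(2)] L2_conv_integrable_inner[OF z(3) p(3)])
  ultimately show ?thesis by (simp add: inner_real_def)
qed

text \<open>Testing the weak equation with the eigenfunction itself turns \<open>Picone_H1\<close>
  into a comparison of two multiples of the integral of Z^2.\<close>

lemma sphere_eigenvalue_ge:
  assumes k: "k > 2" and \<alpha>: "\<alpha> = - (\<sigma> * (\<sigma> + k - 2))"
    and ev: "sphere_eigenvalue \<mu> (\<lambda>x. \<alpha> / r2 x) \<gamma>"
  shows "\<sigma> * (\<sigma> + M) \<le> \<gamma>"
proof -
  from ev obtain Z G where ZG: "(Z, G) \<in> sphere_H1 \<mu>"
    and nz: "\<not> (AE \<theta> in \<mu>. Z \<theta> = 0 \<and> G \<theta> = 0)"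
    and weak: "\<forall>(\<Psi>, P) \<in> sphere_H1 \<mu>.
      (\<integral>\<theta>. (G \<theta> \<bullet> P \<theta> - \<alpha> / r2 \<theta> * Z \<theta> * \<Psi> \<theta>) \<partial>\<mu>) = \<gamma> * (\<integral>\<theta>. Z \<theta> * \<Psi> \<theta> \<partial>\<mu>)"
    unfolding sphere_eigenvalue_def by blast
  have eq: "(\<integral>\<theta>. (G \<theta> \<bullet> G \<theta> - \<alpha> / r2 \<theta> * Z \<theta> * Z \<theta>) \<partial>\<mu>) = \<gamma> * (\<integral>\<theta>. Z \<theta> * Z \<theta> \<partial>\<mu>)"
    using weak ZG by blast
  obtain \<phi> where "\<forall>n. smooth (\<phi> n)" and conv: "L2_conv \<mu> \<phi> Z" "L2_conv \<mu> (\<lambda>n. sphere_grad (\<phi> n)) G"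
    "L2_conv \<mu> (\<lambda>n x. \<phi> n x / sqrt (r2 x)) (\<lambda>x. Z x / sqrt (r2 x))"
    by (rule sphere_H1_L2_conv[OF k ZG])
  have iZ: "integrable \<mu> (\<lambda>x. Z x * Z x)" and iG: "integrable \<mu> (\<lambda>x. G x \<bullet> G x)"
    using L2_conv_integrable_inner[OF conv(1) conv(1)] L2_conv_integrable_inner[OF conv(2) conv(2)]
    by (simp_all add: inner_real_def)
  \<comment> \<open>An eigenvalue excludes only the zero pair (Z, G). If Z vanished almost
    everywhere, the tested equation would make the integral of |G|^2 zero, and then the pair would
    be zero.\<close>
  have "(\<integral>x. Z x * Z x \<partial>\<mu>) \<noteq> 0"
  proof
    assume 0: "(\<integral>x. Z x * Z x \<partial>\<mu>) = 0"
    have "AE x in \<mu>. Z x * Z x = 0"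
      using integral_nonneg_eq_0_iff_AE[OF iZ] 0 by simp
    then have Z0: "AE x in \<mu>. Z x = 0" by simp
    have "(\<integral>x. G x \<bullet> G x \<partial>\<mu>) = (\<integral>\<theta>. (G \<theta> \<bullet> G \<theta> - \<alpha> / r2 \<theta> * Z \<theta> * Z \<theta>) \<partial>\<mu>)"
    proof (rule integral_cong_AE)
      have [measurable]: "G \<in> borel_measurable borel" "Z \<in> borel_measurable borel"
        using conv unfolding L2_conv_def by simp_all
      show "(\<lambda>x. G x \<bullet> G x) \<in> borel_measurable \<mu>" "(\<lambda>\<theta>. G \<theta> \<bullet> G \<theta> - \<alpha> / r2 \<theta> * Z \<theta> * Z \<theta>) \<in> borel_measurable \<mu>"
        by measurable
      show "AE x in \<mu>. G x \<bullet> G x = G x \<bullet> G x - \<alpha> / r2 x * Z x * Z x"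
        using Z0 by eventually_elim simp
    qed
    then have "(\<integral>x. G x \<bullet> G x \<partial>\<mu>) = 0" using eq 0 by simp
    then have "AE x in \<mu>. G x \<bullet> G x = 0"
      using integral_nonneg_eq_0_iff_AE[OF iG] by simp
    then have "AE x in \<mu>. G x = 0" by simp
    with Z0 have "AE \<theta> in \<mu>. Z \<theta> = 0 \<and> G \<theta> = 0" by eventually_elim simp
    with nz show False ..
  qed
  moreover have "0 \<le> (\<integral>x. Z x * Z x \<partial>\<mu>)" by simp
  ultimately have "0 < (\<integral>x. Z x * Z x \<partial>\<mu>)" by linarith
  moreover have "\<sigma> * (\<sigma> + M) * (\<integral>x. Z x * Z x \<partial>\<mu>) \<le> \<gamma> * (\<integral>x. Z x * Z x \<partial>\<mu>)"
    using Picone_H1[OF k ZG \<alpha>] unfolding eq .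
  ultimately show ?thesis by (rule mult_right_le_imp_le[rotated])
qed

text \<open>The sign of the square root selects the larger root of \<sigma> (\<sigma> + k - 2) =
  -\<alpha>; strictness of the bound on \<alpha> puts it above -(k - 2) / 2, as membership in
  \<open>sphere_H1\<close> demands.\<close>

theorem Least_sphere_eigenvalue:
  assumes k: "k > 2" and \<alpha>: "\<alpha> < ((k - 2) / 2)\<^sup>2" and nonzero: "emeasure \<mu> UNIV \<noteq> 0"
  defines "\<sigma> \<equiv> sqrt (((k - 2) / 2)\<^sup>2 - \<alpha>) - (k - 2) / 2"
  shows "(LEAST \<gamma>. sphere_eigenvalue \<mu> (\<lambda>x. \<alpha> / r2 x) \<gamma>) = \<sigma> * (\<sigma> + M)"
proof (rule Least_equality)
  have "0 < sqrt (((k - 2) / 2)\<^sup>2 - \<alpha>)" using \<alpha> by simp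
  moreover have "2 * (S - c / 2) > - c" if "0 < S" for S c :: real
    using that by (simp add: field_simps)
  ultimately have \<sigma>: "2 * \<sigma> > - (k - 2)" unfolding \<sigma>_def by blast
  have "(\<sigma> + (k - 2) / 2)\<^sup>2 = ((k - 2) / 2)\<^sup>2 - \<alpha>" using \<alpha> by (simp add: \<sigma>_def)
  moreover have "a = - (s * (s + 2 * c))" if "(s + c)\<^sup>2 = c\<^sup>2 - a" for a s c :: real
    using that by (simp add: power2_eq_square algebra_simps)
  ultimately have "\<alpha> = - (\<sigma> * (\<sigma> + 2 * ((k - 2) / 2)))" by blast
  moreover have "2 * (c / 2) = c" for c :: real by simp
  ultimately have eq: "\<alpha> = - (\<sigma> * (\<sigma> + k - 2))" by (simp only: add_diff_eq)
  show "\<sigma> * (\<sigma> + M) \<le> \<gamma>" if "sphere_eigenvalue \<mu> (\<lambda>x. \<alpha> / r2 x) \<gamma>" for \<gamma>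
    using sphere_eigenvalue_ge[OF k eq that] .
  have "\<not> (AE x in \<mu>. eigenfunction \<sigma> x = 0 \<and> eigenfunction_grad \<sigma> x = 0)"
  proof
    assume "AE x in \<mu>. eigenfunction \<sigma> x = 0 \<and> eigenfunction_grad \<sigma> x = 0"
    with AE_r2_pos have "AE x in \<mu>. False"
      by eventually_elim (simp add: eigenfunction_def)
    then have "emeasure \<mu> (space \<mu>) = 0" by (simp add: AE_iff_measurable[OF _ refl])
    then show False using nonzero by simp
  qed
  moreover have "\<forall>(\<Psi>, P) \<in> sphere_H1 \<mu>.
      (\<integral>x. eigenfunction_grad \<sigma> x \<bullet> P x - \<alpha> / r2 x * eigenfunction \<sigma> x * \<Psi> x \<partial>\<mu>)
        = \<sigma> * (\<sigma> + M) * (\<integral>x. eigenfunction \<sigma> x * \<Psi> x \<partial>\<mu>)"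
    using eigenfunction_weak[OF k \<sigma> eq] by blast
  ultimately show "sphere_eigenvalue \<mu> (\<lambda>x. \<alpha> / r2 x) (\<sigma> * (\<sigma> + M))"
    unfolding sphere_eigenvalue_def
    by (intro bexI[OF _ eigenfunction_in_H1[OF \<sigma>]]) (simp only: prod.case simp_thms)
qed

end

section \<open>The weighted hemisphere\<close>

lemma sphere_ibp_sphere_measure:
  fixes B :: "'a::euclidean_space set"
  assumes "B \<subseteq> Basis" "B \<noteq> {}"
  shows "sphere_ibp sphere_measure B (real DIM('a) - 2)"
proof (intro sphere_ibp.intro finite_measureI sphere_ibp_axioms.intro)
  show "emeasure (sphere_measure :: 'a measure) (space sphere_measure) \<noteq> \<infinity>"
    using emeasure_sphere_measure_finite[where 'a = 'a] by simp
  show "AE x in (sphere_measure :: 'a measure). norm x = 1"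
    by (rule AE_sphere_measure)
  fix F :: "'a \<Rightarrow> real" and b :: 'a
  assume "Ck (Suc 0) F" "b \<in> B"
  then show "(\<integral>x. sphere_grad F x \<bullet> b \<partial>sphere_measure)
    = (real DIM('a) - 2 + 1) * (\<integral>x. (x \<bullet> b) * F x \<partial>sphere_measure)"
    using sphere_measure_ibp[of F b] assms by auto
qed (use assms in auto)

text \<open>The preimage under \<open>sgn\<close>, cut with the unit ball, is an open half ball,
  which is nonempty and therefore not negligible.\<close>

lemma emeasure_sphere_measure_halfspace:
  fixes e :: "'a::euclidean_space"
  assumes e: "e \<in> Basis"
  shows "emeasure sphere_measure {x. 0 < x \<bullet> e} \<noteq> 0"
proof
  let ?A = "{x::'a. 0 < x \<bullet> e}"
  have [measurable]: "?A \<in> sets borel" "ball 0 1 - {0::'a} \<in> sets borel" by auto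
  assume "emeasure sphere_measure ?A = 0"
  then have "AE x in sphere_measure. x \<notin> ?A" by (intro AE_not_in) (auto simp: null_sets_def)
  then have "AE x in lborel. 0 < ennreal (real DIM('a) * indicator (ball 0 1 - {0}) x) \<longrightarrow> sgn x \<notin> ?A"
    unfolding sphere_measure_def density_lborel_punctured_ball
    by (subst (asm) AE_distr_iff) (simp_all add: AE_density del: ennreal_less_zero_iff)
  then have "AE x in lborel. x \<notin> ball 0 1 \<inter> ?A"
  proof eventually_elim
    case (elim x)
    show ?case
    proof
      assume x: "x \<in> ball 0 1 \<inter> ?A"
      then have "x \<noteq> 0" by auto
      then have "0 < sgn x \<bullet> e" using x by (simp add: sgn_div_norm)
      then show False using elim x \<open>x \<noteq> 0\<close> by simp
    qed
  qed
  then have "ball 0 1 \<inter> ?A \<in> null_sets lborel"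
    by (subst (asm) AE_iff_null_sets[symmetric]) auto
  then have "negligible (ball 0 1 \<inter> ?A)"
    by (simp add: negligible_iff_null_sets null_sets_completionI)
  moreover have "open (ball 0 1 \<inter> ?A)"
    by (intro open_Int open_ball open_Collect_less continuous_intros)
  moreover have "(1 / 2) *\<^sub>R e \<in> ball 0 1 \<inter> ?A" using e by simp
  ultimately show False using open_not_negligible by blast
qed

text \<open>The weight \<open>(x \<bullet> e) powr a\<close> is the limit of the continuously differentiable weights
  \<open>(max 0 t)\<^sup>2 (t\<^sup>2 + \<epsilon>) powr (a / 2 - 1)\<close>, where \<open>t = x \<bullet> e\<close>.\<close>

lemma weighted_sphere_measure_ibp:
  fixes F :: "'a::euclidean_space \<Rightarrow> real" and e b :: 'a
  assumes F: "Ck (Suc 0) F" and e: "e \<in> Basis" and b: "b \<in> Basis" "b \<noteq> e" and a: "- 1 < a" "a < 1"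
  defines "w \<equiv> \<lambda>x. indicator {x. 0 < x \<bullet> e} x * (x \<bullet> e) powr a"
  shows "integrable sphere_measure w"
    "(\<integral>x. w x * (sphere_grad F x \<bullet> b) \<partial>sphere_measure)
       = (real DIM('a) - 1 + a) * (\<integral>x. w x * ((x \<bullet> b) * F x) \<partial>sphere_measure)"
proof -
  \<comment> \<open>With the single direction e, \<open>T.r2\<close> is (x . e)^2 and its power a /
    2 is integrable because a > -1. This spares a direct computation for the weight.\<close>
  interpret T: sphere_ibp sphere_measure "{e}" "real DIM('a) - 2"
    by (rule sphere_ibp_sphere_measure) (use e in auto)
  have r2: "T.r2 x = (x \<bullet> e)\<^sup>2" and E: "T.E x = (x \<bullet> e) *\<^sub>R e" for x
    by (simp_all add: T.r2_def T.E_def)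
  have [measurable]: "w \<in> borel_measurable borel" unfolding w_def by measurable
  have w0: "0 \<le> w x" for x by (simp add: w_def)
  show int_w: "integrable sphere_measure w"
  proof (rule Bochner_Integration.integrable_bound[OF T.integrable_r2_powr[of "a / 2"]])
    show "AE x in sphere_measure. norm (w x) \<le> norm (T.r2 x powr (a / 2))"
    proof (intro always_eventually allI)
      fix x
      show "norm (w x) \<le> norm (T.r2 x powr (a / 2))"
      proof (cases "0 < x \<bullet> e")
        case True
        then have "T.r2 x powr (a / 2) = (x \<bullet> e) powr a"
          unfolding r2 by (simp add: powr_powr flip: powr_numeral)
        then show ?thesis using True by (simp add: w_def)
      qed (simp add: w_def)
    qed
  qed (use a in auto)
  define m where "m x = (max 0 (x \<bullet> e))\<^sup>2" for x :: 'a
  have m_deriv: "(m has_derivative (\<lambda>v. ((2 * max 0 (x \<bullet> e)) *\<^sub>R e) \<bullet> v)) (at x)" for x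
  proof -
    have "((\<lambda>z. (max 0 z)\<^sup>2) has_derivative (*) (2 * max 0 (x \<bullet> e))) (at (x \<bullet> e))"
      using has_real_derivative_max_square by (simp add: has_field_derivative_def)
    moreover have "((\<lambda>x. x \<bullet> e) has_derivative (\<lambda>v. v \<bullet> e)) (at x)"
      by (auto intro!: derivative_eq_intros)
    ultimately have "((\<lambda>x. (max 0 (x \<bullet> e))\<^sup>2) has_derivative (\<lambda>v. 2 * max 0 (x \<bullet> e) * (v \<bullet> e))) (at x)"
      using has_derivative_compose by blast
    then show ?thesis by (simp add: m_def[abs_def] inner_commute)
  qed
  have Cm: "Ck (Suc 0) m"
    by (rule Ck_SucI[OF m_deriv]) (auto simp: Ck.simps intro!: continuous_intros)
  define q where "q = a / 2 - 1"
  have q: "q < 0" using a by (simp add: q_def)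
  let ?e = "\<lambda>n. inverse (real (Suc n))"
  have e0: "0 < ?e n" for n by simp
  define v where "v n x = m x * (T.r2 x + ?e n) powr q" for n x
  \<comment> \<open>\<open>d\<close> is x . grad v, the radial derivative of \<open>v\<close>. The
    limit weight is homogeneous of degree a, so by Euler's relation a times the weight is the
    expected limit of \<open>d\<close>.\<close>
  define d where "d n x = 2 * v n x + 2 * q * (m x * ((T.r2 x + ?e n) powr (q - 1) * T.r2 x))" for n x
  have Cv: "Ck (Suc 0) (v n)" for n
    unfolding v_def[abs_def] by (intro Ck_mult Cm T.Ck_shift e0)
  have grad_v: "\<exists>c. grad (v n) x = c *\<^sub>R e \<and> (x \<bullet> e) * c = d n x" for n x
  proof (intro exI conjI)
    let ?Q = "\<lambda>p. (T.r2 x + ?e n) powr p"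
    let ?c = "m x * (2 * q * ?Q (q - 1) * (x \<bullet> e)) + ?Q q * (2 * max 0 (x \<bullet> e))"
    show "grad (v n) x = ?c *\<^sub>R e"
      unfolding v_def grad_mult[OF Cm T.Ck_shift[OF e0]] T.grad_shift[OF e0] grad_eqI[OF m_deriv] E
      by (simp add: scaleR_left_distrib del: of_nat_Suc)
    have "(x \<bullet> e) * max 0 (x \<bullet> e) = m x" by (simp add: m_def power2_eq_square max_def)
    moreover have "t * (z * (2 * q * Q' * t) + Q * (2 * y)) = 2 * ((t * y) * Q) + 2 * q * (z * (Q' * t\<^sup>2))" for t z Q Q' y :: real
      by (simp add: power2_eq_square algebra_simps)
    ultimately show "(x \<bullet> e) * ?c = d n x"
      unfolding d_def v_def r2 by metis
  qed
  \<comment> \<open>The gradient of \<open>v\<close> is parallel to e, hence invisible in direction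
    b. Its radial part, subtracted by the tangential projection, is \<open>d\<close>; in the limit
    it moves the constant from DIM - 1 to DIM - 1 + a.\<close>
  have grad_v_b: "grad (v n) x \<bullet> b = 0" and grad_v_x: "grad (v n) x \<bullet> x = d n x" for n x
  proof -
    have eb: "e \<bullet> b = 0" using e b by (auto simp: inner_Basis)
    obtain c where "grad (v n) x = c *\<^sub>R e" "(x \<bullet> e) * c = d n x" using grad_v by blast
    then show "grad (v n) x \<bullet> b = 0" "grad (v n) x \<bullet> x = d n x"
      by (simp_all add: eb inner_commute[of e x] mult.commute)
  qed
  have F_cont: "continuous_on UNIV F" "continuous_on UNIV (sphere_grad F)"
    using F Ck_imp_continuous_on continuous_on_sphere_grad by blast+
  have [measurable]: "F \<in> borel_measurable borel" "sphere_grad F \<in> borel_measurable borel"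
    "v n \<in> borel_measurable borel" "d n \<in> borel_measurable borel" for n
    using F_cont Cv unfolding d_def[abs_def] v_def[abs_def] m_def
    by (auto intro: borel_measurable_continuous_onI)
  let ?S = "\<lambda>x. sphere_grad F x \<bullet> b" and ?F = "\<lambda>x. (x \<bullet> b) * F x"
  have ibp: "(\<integral>x. v n x * ?S x - d n x * ?F x \<partial>sphere_measure)
      = (real DIM('a) - 1) * (\<integral>x. v n x * ?F x \<partial>sphere_measure)" for n
  proof -
    have "sphere_grad (\<lambda>x. v n x * F x) x \<bullet> b = v n x * ?S x - d n x * ?F x" for x
      unfolding sphere_grad_def grad_mult[OF Cv F]
      by (simp add: inner_diff_left inner_add_left grad_v_b grad_v_x algebra_simps)
    then show ?thesis
      using sphere_measure_ibp[OF Ck_mult[OF Cv F] b(1), of n] by (simp add: mult.left_commute)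
  qed
  have v_le: "0 \<le> v n x" "v n x \<le> w x" for n x
  proof -
    show "0 \<le> v n x" by (simp add: v_def m_def)
    show "v n x \<le> w x"
    proof (cases "0 < x \<bullet> e")
      case True
      have "v n x \<le> (x \<bullet> e)\<^sup>2 * (x \<bullet> e)\<^sup>2 powr q"
        unfolding v_def m_def r2 using True q by (intro mult_mono powr_mono2') auto
      also have "\<dots> = (x \<bullet> e) powr (2 + 2 * q)"
        using True by (simp add: powr_add powr_powr flip: powr_numeral)
      finally show ?thesis using True by (simp add: w_def q_def)
    qed (simp add: v_def m_def w_def)
  qed
  \<comment> \<open>Since |q| <= 3 / 2, the two parts of \<open>d\<close> contribute at most 2 and 3
    times \<open>v\<close>.\<close>
  have d_le: "\<bar>d n x\<bar> \<le> 5 * w x" for n x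
  proof -
    have "m x * ((T.r2 x + ?e n) powr (q - 1) * T.r2 x) \<le> v n x"
      unfolding v_def by (intro mult_left_mono powr_diff_one_mult_le) (auto simp: m_def)
    moreover have "0 \<le> m x * ((T.r2 x + ?e n) powr (q - 1) * T.r2 x)" by (simp add: m_def)
    ultimately have "\<bar>q\<bar> * (m x * ((T.r2 x + ?e n) powr (q - 1) * T.r2 x)) \<le> (3 / 2) * v n x"
      using a by (intro mult_mono) (auto simp: q_def)
    moreover have "\<bar>d n x\<bar> \<le> 2 * v n x + 2 * (\<bar>q\<bar> * (m x * ((T.r2 x + ?e n) powr (q - 1) * T.r2 x)))"
    proof -
      have "\<bar>2 * y + 2 * q * z\<bar> \<le> 2 * y + 2 * (\<bar>q\<bar> * z)" if "0 \<le> y" "0 \<le> z" for y z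
        using that by (intro order_trans[OF abs_triangle_ineq]) (simp add: abs_mult)
      then show ?thesis unfolding d_def using v_le(1) \<open>0 \<le> m x * _\<close> by blast
    qed
    ultimately show ?thesis using v_le[of n x] by linarith
  qed
  have lim_v: "(\<lambda>n. v n x) \<longlonglongrightarrow> w x" and lim_d: "(\<lambda>n. d n x) \<longlonglongrightarrow> a * w x" for x
  proof -
    have "(\<lambda>n. v n x) \<longlonglongrightarrow> w x \<and> (\<lambda>n. d n x) \<longlonglongrightarrow> a * w x"
    proof (cases "0 < x \<bullet> e")
      case True
      then have r: "0 < T.r2 x" by (simp add: r2)
      have mr: "m x = T.r2 x" using True by (simp add: m_def r2)
      have "T.r2 x powr (q + 1) = (x \<bullet> e) powr (2 * (q + 1))"
        unfolding r2 using True by (simp add: powr_powr flip: powr_numeral)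
      moreover have "T.r2 x powr (q + 1) = T.r2 x powr q * T.r2 x" using r by (simp only: powr_add powr_one)
      moreover have "2 * (q + 1) = a" by (simp add: q_def)
      ultimately have w: "T.r2 x * T.r2 x powr q = w x"
        using True by (simp add: w_def mult.commute)
      have v: "(\<lambda>n. v n x) \<longlonglongrightarrow> T.r2 x * T.r2 x powr q"
        unfolding v_def mr by (intro tendsto_intros T.tendsto_shift r)
      have "(\<lambda>n. d n x) \<longlonglongrightarrow> 2 * (T.r2 x * T.r2 x powr q) + 2 * q * (T.r2 x * (T.r2 x powr (q - 1) * T.r2 x))"
        unfolding d_def mr by (intro tendsto_intros T.tendsto_shift r v)
      also have "T.r2 x powr (q - 1) * T.r2 x = T.r2 x powr q" using r by (simp add: powr_diff)
      also have "2 * (T.r2 x * T.r2 x powr q) + 2 * q * (T.r2 x * T.r2 x powr q) = a * w x"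
        unfolding w by (simp add: q_def algebra_simps)
      finally show ?thesis using v w by simp
    qed (simp add: v_def d_def m_def w_def)
    then show "(\<lambda>n. v n x) \<longlonglongrightarrow> w x" "(\<lambda>n. d n x) \<longlonglongrightarrow> a * w x" by auto
  qed
  have S_cont: "continuous_on UNIV ?S" "continuous_on UNIV ?F"
    by (intro continuous_intros F_cont)+
  obtain KS where KS: "\<And>x. norm x \<le> 1 \<Longrightarrow> \<bar>?S x\<bar> \<le> KS"
    using continuous_on_bounded_cball[OF S_cont(1)] by auto
  obtain KF where KF: "\<And>x. norm x \<le> 1 \<Longrightarrow> \<bar>?F x\<bar> \<le> KF"
    using continuous_on_bounded_cball[OF S_cont(2)] by auto
  have int1: "integrable sphere_measure (\<lambda>x. w x * (KS + 5 * KF))"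
    and int2: "integrable sphere_measure (\<lambda>x. w x * KF)"
    using int_w by simp_all
  have lim1: "(\<lambda>n. \<integral>x. v n x * ?S x - d n x * ?F x \<partial>sphere_measure)
     \<longlonglongrightarrow> (\<integral>x. w x * ?S x - a * w x * ?F x \<partial>sphere_measure)"
  proof (rule integral_dominated_convergence[OF _ _ int1])
    show "AE x in sphere_measure. norm (v n x * ?S x - d n x * ?F x) \<le> w x * (KS + 5 * KF)" for n
      using T.AE_norm
    proof eventually_elim
      case (elim x)
      have "\<bar>v n x * ?S x - d n x * ?F x\<bar> \<le> \<bar>v n x\<bar> * \<bar>?S x\<bar> + \<bar>d n x\<bar> * \<bar>?F x\<bar>"
        using abs_triangle_ineq4[of "v n x * ?S x" "d n x * ?F x"] by (simp add: abs_mult)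
      also have "\<dots> \<le> w x * KS + (5 * w x) * KF"
        using elim KS[of x] KF[of x] v_le[of n x] d_le[of n x] w0[of x]
        by (intro add_mono mult_mono) auto
      finally show ?case by (simp add: algebra_simps)
    qed
    show "AE x in sphere_measure. (\<lambda>n. v n x * ?S x - d n x * ?F x) \<longlonglongrightarrow> w x * ?S x - a * w x * ?F x"
      by (intro always_eventually allI tendsto_intros lim_v lim_d)
  qed measurable
  have lim2: "(\<lambda>n. \<integral>x. v n x * ?F x \<partial>sphere_measure) \<longlonglongrightarrow> (\<integral>x. w x * ?F x \<partial>sphere_measure)"
  proof (rule integral_dominated_convergence[OF _ _ int2])
    show "AE x in sphere_measure. norm (v n x * ?F x) \<le> w x * KF" for n
      using T.AE_norm
    proof eventually_elim
      case (elim x)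
      have "\<bar>v n x\<bar> * \<bar>?F x\<bar> \<le> w x * KF"
        using elim KF[of x] v_le[of n x] w0[of x] by (intro mult_mono) auto
      then show ?case by (simp add: abs_mult)
    qed
    show "AE x in sphere_measure. (\<lambda>n. v n x * ?F x) \<longlonglongrightarrow> w x * ?F x"
      by (intro always_eventually allI tendsto_intros lim_v)
  qed measurable
  have intF: "integrable sphere_measure (\<lambda>x. w x * ?F x)"
    and intS: "integrable sphere_measure (\<lambda>x. w x * ?S x)"
  proof -
    show "integrable sphere_measure (\<lambda>x. w x * ?F x)"
    proof (rule Bochner_Integration.integrable_bound[OF int2])
      show "AE x in sphere_measure. norm (w x * ?F x) \<le> norm (w x * KF)"
        using T.AE_norm
      proof eventually_elim
        case (elim x)
        have "\<bar>?F x\<bar> \<le> \<bar>KF\<bar>" using KF[of x] elim by auto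
        then have "\<bar>w x\<bar> * \<bar>?F x\<bar> \<le> \<bar>w x\<bar> * \<bar>KF\<bar>" by (rule mult_left_mono) simp
        then show ?case by (simp only: abs_mult real_norm_def)
      qed
    qed measurable
    have "integrable sphere_measure (\<lambda>x. w x * KS)" using int_w by simp
    then show "integrable sphere_measure (\<lambda>x. w x * ?S x)"
    proof (rule Bochner_Integration.integrable_bound)
      show "AE x in sphere_measure. norm (w x * ?S x) \<le> norm (w x * KS)"
        using T.AE_norm
      proof eventually_elim
        case (elim x)
        have "\<bar>?S x\<bar> \<le> \<bar>KS\<bar>" using KS[of x] elim by auto
        then have "\<bar>w x\<bar> * \<bar>?S x\<bar> \<le> \<bar>w x\<bar> * \<bar>KS\<bar>" by (rule mult_left_mono) simp
        then show ?case by (simp only: abs_mult real_norm_def)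
      qed
    qed measurable
  qed
  have "(\<integral>x. w x * ?S x - a * w x * ?F x \<partial>sphere_measure)
     = (real DIM('a) - 1) * (\<integral>x. w x * ?F x \<partial>sphere_measure)"
    by (rule LIMSEQ_unique[OF lim1]) (unfold ibp, intro tendsto_mult_left lim2)
  moreover have "(\<integral>x. w x * ?S x - a * w x * ?F x \<partial>sphere_measure)
     = (\<integral>x. w x * ?S x \<partial>sphere_measure) - a * (\<integral>x. w x * ?F x \<partial>sphere_measure)"
    unfolding mult.assoc[of a]
    by (simp only: Bochner_Integration.integral_diff[OF intS integrable_mult_right[OF intF]] integral_mult_right_zero)
  ultimately show "(\<integral>x. w x * ?S x \<partial>sphere_measure)
       = (real DIM('a) - 1 + a) * (\<integral>x. w x * ?F x \<partial>sphere_measure)"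
    by (simp add: distrib_right)
qed

text \<open>All directions in B are orthogonal to e, so the weight is never differentiated along
  them and only shifts the constant by a.\<close>

lemma sphere_ibp_weighted:
  fixes e :: "'a::euclidean_space"
  assumes e: "e \<in> Basis" and B: "B \<subseteq> Basis - {e}" "B \<noteq> {}" and a: "- 1 < a" "a < 1"
  defines "\<mu> \<equiv> density sphere_measure (\<lambda>x. ennreal (indicator {x. 0 < x \<bullet> e} x * (x \<bullet> e) powr a))"
  shows "sphere_ibp \<mu> B (real DIM('a) - 2 + a)" "emeasure \<mu> UNIV \<noteq> 0"
proof -
  define w where "w x = indicator {x. 0 < x \<bullet> e} x * (x \<bullet> e) powr a" for x
  have \<mu>: "\<mu> = density sphere_measure (\<lambda>x. ennreal (w x))" by (simp add: \<mu>_def w_def)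
  have [measurable]: "w \<in> borel_measurable borel" unfolding w_def by measurable
  have w0: "0 \<le> w x" for x by (simp add: w_def)
  have integral_\<mu>: "(\<integral>x. f x \<partial>\<mu>) = (\<integral>x. w x * f x \<partial>sphere_measure)"
    if "f \<in> borel_measurable borel" for f :: "'a \<Rightarrow> real"
    unfolding \<mu> using that w0 by (simp add: integral_density)
  obtain b where "b \<in> B" using B by auto
  \<comment> \<open>Integrability of the weight is independent of the function, so the instance for
    the zero function supplies it.\<close>
  then have int_w: "integrable sphere_measure w"
    using weighted_sphere_measure_ibp(1)[OF Ck_const[of _ 0] e _ _ a, of b] B by (auto simp: w_def[abs_def])
  show "sphere_ibp \<mu> B (real DIM('a) - 2 + a)"
  proof (intro sphere_ibp.intro finite_measureI sphere_ibp_axioms.intro)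
    have "emeasure \<mu> (space \<mu>) = ennreal (\<integral>x. w x \<partial>sphere_measure)"
      unfolding \<mu> by (simp add: emeasure_density nn_integral_eq_integral[OF int_w] w0)
    then show "emeasure \<mu> (space \<mu>) \<noteq> \<infinity>" by simp
    show "AE x in \<mu>. norm x = 1"
      unfolding \<mu> using AE_sphere_measure by (auto simp: AE_density elim!: eventually_mono)
    fix F :: "'a \<Rightarrow> real" and b :: 'a
    assume F: "Ck (Suc 0) F" and b: "b \<in> B"
    have [measurable]: "F \<in> borel_measurable borel" "sphere_grad F \<in> borel_measurable borel"
      using F by (auto intro!: borel_measurable_continuous_onI continuous_on_sphere_grad Ck_imp_continuous_on)
    show "(\<integral>x. sphere_grad F x \<bullet> b \<partial>\<mu>) = (real DIM('a) - 2 + a + 1) * (\<integral>x. (x \<bullet> b) * F x \<partial>\<mu>)"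
      using weighted_sphere_measure_ibp(2)[OF F e _ _ a, of b] b B
      by (subst (1 2) integral_\<mu>) (auto simp: w_def algebra_simps)
  qed (use B in \<open>auto simp: \<mu>\<close>)
  show "emeasure \<mu> UNIV \<noteq> 0"
  proof
    assume "emeasure \<mu> UNIV = 0"
    then have "AE x in sphere_measure. w x = 0"
      using w0 by (simp add: \<mu> emeasure_density nn_integral_0_iff_AE)
    then have "AE x in sphere_measure. \<not> 0 < x \<bullet> e"
      by (rule eventually_mono) (auto simp: w_def)
    then have "emeasure sphere_measure {x. 0 < x \<bullet> e} = 0"
      by (subst (asm) AE_iff_measurable[where N = "{x. 0 < x \<bullet> e}"]) auto
    then show False using emeasure_sphere_measure_halfspace[OF e] by simp
  qed
qed

section \<open>Both first eigenvalues in closed form, and their relation\<close>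

lemma equator_eigenvalue_1_eq:
  fixes e :: "nat \<Rightarrow> 'n::finite" and k :: nat and \<alpha> :: real
  assumes e: "inj_on e {1..k}" and k: "k \<ge> 3" and \<alpha>: "\<alpha> < ((real k - 2) / 2)\<^sup>2"
  defines "\<sigma> \<equiv> sqrt (((real k - 2) / 2)\<^sup>2 - \<alpha>) - (real k - 2) / 2"
  shows "equator_eigenvalue_1 e \<alpha> k = \<sigma> * (\<sigma> + (real CARD('n) - 2))"
proof -
  define b where "b i = (axis (e i) 1 :: real ^ 'n)" for i
  have inj: "inj_on b {1..k}"
  proof (rule inj_onI)
    fix i j
    assume "i \<in> {1..k}" "j \<in> {1..k}" "b i = b j"
    then show "i = j" using inj_onD[OF e, of i j] by (simp add: b_def axis_eq_axis)
  qed
  have "b ` {1..k} \<subseteq> Basis" by (auto simp: b_def Basis_vec_def)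
  moreover have "b ` {1..k} \<noteq> {}" using k by simp
  ultimately interpret sphere_ibp sphere_measure "b ` {1..k}" "real DIM(real ^ 'n) - 2"
    by (rule sphere_ibp_sphere_measure)
  have card: "card (b ` {1..k}) = k" using inj by (simp add: card_image)
  have r2: "r2 = partial_norm_sq e k"
    by (rule ext, unfold r2_def sum.reindex[OF inj] o_def partial_norm_sq_def)
      (simp add: b_def inner_axis)
  \<comment> \<open>Any axis would do: an open half of the sphere of nonzero measure shows that the
    measure is not trivial.\<close>
  let ?e = "axis undefined 1 :: real ^ 'n"
  have "?e \<in> Basis" by (auto simp: Basis_vec_def)
  then have "emeasure sphere_measure {x. 0 < x \<bullet> ?e} \<noteq> 0"
    by (rule emeasure_sphere_measure_halfspace)
  then have nonzero: "emeasure (sphere_measure :: (real ^ 'n) measure) UNIV \<noteq> 0"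
    using emeasure_mono[of "{x. 0 < x \<bullet> ?e}" UNIV "sphere_measure :: (real ^ 'n) measure"]
    by (metis UNIV_I le_zero_eq sets.top space_sphere_measure subset_UNIV)
  have "2 < real (card (b ` {1..k}))" "\<alpha> < ((real (card (b ` {1..k})) - 2) / 2)\<^sup>2"
    unfolding card using k \<alpha> by simp_all
  from Least_sphere_eigenvalue[OF this nonzero] show ?thesis
    unfolding equator_eigenvalue_1_def equator_eigenvalue_def card r2 \<sigma>_def by simp
qed

lemma hemisphere_eigenvalue_1_eq:
  fixes e :: "nat \<Rightarrow> 'n::finite" and k :: nat and s \<alpha> :: real
  assumes e: "inj_on e {1..k}" and s: "0 < s" "s < 1" and k: "k \<ge> 3" and \<alpha>: "\<alpha> < ((real k - 2) / 2)\<^sup>2"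
  defines "\<sigma> \<equiv> sqrt (((real k - 2) / 2)\<^sup>2 - \<alpha>) - (real k - 2) / 2"
  shows "hemisphere_eigenvalue_1 e s \<alpha> k = \<sigma> * (\<sigma> + (real CARD('n) - 2 * s))"
proof -
  define b where "b i = (axis (e i) 1 :: real ^ 'n, 0 :: real)" for i
  let ?t = "(0, 1) :: (real ^ 'n) \<times> real"
  have inj: "inj_on b {1..k}"
  proof (rule inj_onI)
    fix i j
    assume "i \<in> {1..k}" "j \<in> {1..k}" "b i = b j"
    then show "i = j" using inj_onD[OF e, of i j] by (simp add: b_def axis_eq_axis)
  qed
  have t: "?t \<in> Basis" by (simp add: Basis_prod_def)
  have B: "b ` {1..k} \<subseteq> Basis - {?t}" "b ` {1..k} \<noteq> {}"
    using k by (auto simp: b_def Basis_prod_def Basis_vec_def)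
  have a: "- 1 < 1 - 2 * s" "1 - 2 * s < 1" using s by auto
  have \<mu>: "hemisphere_measure s =
    density sphere_measure (\<lambda>x. ennreal (indicator {x. 0 < x \<bullet> ?t} x * (x \<bullet> ?t) powr (1 - 2 * s)))"
    by (simp add: hemisphere_measure_def inner_prod_def)
  \<comment> \<open>The ambient dimension is N + 1 and the weight exponent 1 - 2 s, so
    \<open>M\<close> comes out as N - 2 s.\<close>
  interpret sphere_ibp "hemisphere_measure s" "b ` {1..k}" "real DIM((real ^ 'n) \<times> real) - 2 + (1 - 2 * s)"
    unfolding \<mu> by (rule sphere_ibp_weighted(1)[OF t B a])
  have card: "card (b ` {1..k}) = k" using inj by (simp add: card_image)
  have r2: "r2 = (\<lambda>\<theta>. partial_norm_sq e k (fst \<theta>))"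
    by (rule ext, unfold r2_def sum.reindex[OF inj] o_def partial_norm_sq_def)
      (simp add: b_def inner_axis inner_prod_def)
  have nonzero: "emeasure (hemisphere_measure s :: ((real ^ 'n) \<times> real) measure) UNIV \<noteq> 0"
    unfolding \<mu> by (rule sphere_ibp_weighted(2)[OF t B a])
  have "2 < real (card (b ` {1..k}))" "\<alpha> < ((real (card (b ` {1..k})) - 2) / 2)\<^sup>2"
    unfolding card using k \<alpha> by simp_all
  moreover have "real DIM((real ^ 'n) \<times> real) - 2 + (1 - 2 * s) = real CARD('n) - 2 * s"
    by simp
  ultimately show ?thesis
    using Least_sphere_eigenvalue[OF _ _ nonzero, of \<alpha>]
    unfolding hemisphere_eigenvalue_1_def hemisphere_eigenvalue_def card r2 \<sigma>_def by metis
qed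

theorem proposition7p1:
  fixes e :: "nat \<Rightarrow> 'n::finite" and N k :: nat and s \<alpha> :: real
  assumes "N = CARD('n)" and "N \<ge> 3"
    and "bij_betw e {1..N} (UNIV :: 'n set)"
    and "0 < s" and "s < 1"
    and "k \<in> {3..N}"
    and "\<alpha> < ((real k - 2) / 2)\<^sup>2"
  shows "hemisphere_eigenvalue_1 e s \<alpha> k =
           2 * (1 - s) * (sqrt (((real N - 2) / 2)\<^sup>2 + equator_eigenvalue_1 e \<alpha> k)
                           - (real N - 2) / 2)
           + equator_eigenvalue_1 e \<alpha> k
       \<and> (k = N \<longrightarrow>
           hemisphere_eigenvalue_1 e s \<alpha> N =
             2 * (1 - s) * (sqrt (((real N - 2) / 2)\<^sup>2 - \<alpha>) - (real N - 2) / 2) - \<alpha>)"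
proof -
  define \<sigma> where "\<sigma> = sqrt (((real k - 2) / 2)\<^sup>2 - \<alpha>) - (real k - 2) / 2"
  define c where "c = (real N - 2) / 2"
  have c2: "2 * c = real N - 2" using field_sum_of_halves[of "real N - 2"] by (simp only: c_def mult_2)
  have k: "3 \<le> k" "k \<le> N" using assms by auto
  have inj: "inj_on e {1..k}"
    using bij_betw_imp_inj_on[OF assms(3)] by (rule inj_on_subset) (use k in auto)
  have eta: "equator_eigenvalue_1 e \<alpha> k = \<sigma> * (\<sigma> + 2 * c)"
    using equator_eigenvalue_1_eq[OF inj k(1) assms(7)] assms(1) by (simp only: \<sigma>_def c2)
  have "hemisphere_eigenvalue_1 e s \<alpha> k = \<sigma> * (\<sigma> + (real N - 2 * s))"
    using hemisphere_eigenvalue_1_eq[OF inj assms(4,5) k(1) assms(7)] assms(1) by (simp add: \<sigma>_def)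
  also have "real N = 2 * c + 2" using c2 by simp
  \<comment> \<open>The values of \<open>M\<close> for the two problems differ by (N - 2 s) - (N -
    2) = 2 (1 - s).\<close>
  also have "\<sigma> * (\<sigma> + (2 * c + 2 - 2 * s)) = 2 * (1 - s) * \<sigma> + \<sigma> * (\<sigma> + 2 * c)"
    by (simp add: algebra_simps)
  finally have gamma: "hemisphere_eigenvalue_1 e s \<alpha> k = 2 * (1 - s) * \<sigma> + \<sigma> * (\<sigma> + 2 * c)" .
  \<comment> \<open>Since k <= N, the subtracted (k - 2) / 2 is at most c; hence \<sigma> + c is
    nonnegative and is itself the square root of its square.\<close>
  have "0 < sqrt (((real k - 2) / 2)\<^sup>2 - \<alpha>)" using assms(7) by simp
  moreover have "(real k - 2) / 2 \<le> c" using k(2) by (simp add: c_def)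
  ultimately have pos: "0 \<le> \<sigma> + c" unfolding \<sigma>_def by linarith
  have "c\<^sup>2 + \<sigma> * (\<sigma> + 2 * c) = (\<sigma> + c)\<^sup>2" by (simp add: power2_eq_square algebra_simps)
  then have "sqrt (c\<^sup>2 + \<sigma> * (\<sigma> + 2 * c)) = \<sigma> + c" using pos by simp
  then have first: "hemisphere_eigenvalue_1 e s \<alpha> k =
      2 * (1 - s) * (sqrt (c\<^sup>2 + equator_eigenvalue_1 e \<alpha> k) - c) + equator_eigenvalue_1 e \<alpha> k"
    unfolding gamma eta by simp
  moreover have "hemisphere_eigenvalue_1 e s \<alpha> N = 2 * (1 - s) * (sqrt (c\<^sup>2 - \<alpha>) - c) - \<alpha>" if "k = N"
  proof -
    have "\<alpha> < c\<^sup>2" using assms(7) that by (simp add: c_def)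
    moreover have \<sigma>: "\<sigma> = sqrt (c\<^sup>2 - \<alpha>) - c" using that by (simp add: \<sigma>_def c_def)
    ultimately have "(\<sigma> + c)\<^sup>2 = c\<^sup>2 - \<alpha>" by simp
    \<comment> \<open>For k = N the equator potential is the constant \<alpha>, so its first
      eigenvalue is -\<alpha>.\<close>
    then have "\<sigma> * (\<sigma> + 2 * c) = - \<alpha>" by (simp add: power2_eq_square algebra_simps)
    then show ?thesis using gamma that \<sigma> by simp
  qed
  ultimately show ?thesis unfolding c_def by blast
qed

end
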